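(* Let $\mathcal{A},\mathcal{B},\mathcal{C}$ be extriangulated categories, where $\mathcal{B}$ has enough projectives, and let $(\mathcal{A},\mathcal{B},\mathcal{C})$ be a recollement of extriangulated categories, given by functors $i^{*},i^{!}\colon\mathcal{B}\to\mathcal{A}$, $i_{*}\colon\mathcal{A}\to\mathcal{B}$, $j^{*}\colon\mathcal{B}\to\mathcal{C}$, $j_{!},j_{*}\colon\mathcal{C}\to\mathcal{B}$. Assume that $i^{*}$ and $i^{!}$ are exact, and that $\mathcal{T}$ is a cluster tilting subcategory of $\mathcal{B}$ satisfying $j_{*}j^{*}\mathcal{T}\subseteq\mathcal{T}$ and $i_{*}i^{*}\mathcal{T}\subseteq\mathcal{T}$. Then the categories $\mathcal{A}/i^{*}\mathcal{T}$, $\mathcal{B}/\mathcal{T}$ and $\mathcal{C}/j^{*}\mathcal{T}$ are abelian, and the abelian category $\mathcal{B}/\mathcal{T}$ admits a recollement (of abelian categories) relative to $\mathcal{A}/i^{*}\mathcal{T}$ and $\mathcal{C}/j^{*}\mathcal{T}$, given by the functors $$\overline{i}^{*},\overline{i}^{!}\colon\mathcal{B}/\mathcal{T}\to\mathcal{A}/i^{*}\mathcal{T},\quad \overline{i}_{*}\colon\mathcal{A}/i^{*}\mathcal{T}\to\mathcal{B}/\mathcal{T},\quad \overline{j}^{*}\colon\mathcal{B}/\mathcal{T}\to\mathcal{C}/j^{*}\mathcal{T},\quad \overline{j}_{!},\overline{j}_{*}\colon\mathcal{C}/j^{*}\mathcal{T}\to\mathcal{B}/\mathcal{T}$$ induced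 by $i^{*},i^{!},i_{*},j^{*},j_{!},j_{*}$, respectively.
   Context: **Extriangulated categories (Nakaoka–Palu).** Let $\mathcal{C}$ be an additive category with an additive bifunctor $\mathbb{E}\colon\mathcal{C}^{op}\times\mathcal{C}\to \mathrm{Ab}$. Elements $\delta\in\mathbb{E}(C,A)$ are called $\mathbb{E}$-extensions; for $a\colon A\to A'$ and $c\colon C'\to C$ write $a_*\delta=\mathbb{E}(C,a)(\delta)$, $c^*\delta=\mathbb{E}(c,A)(\delta)$. A morphism from $\delta\in\mathbb{E}(C,A)$ to $\delta'\in\mathbb{E}(C',A')$ is a pair $(a\colon A\to A',c\colon C\to C')$ with $a_*\delta=c^*\delta'$. Two sequences $A\to B\to C$ and $A\to B'\to C$ are equivalent if there is an isomorphism $B\cong B'$ compatible with the maps from $A$ and to $C$. A realization $\mathfrak{s}$ assigns to each $\delta\in\mathbb{E}(C,A)$ an equivalence class $\mathfrak{s}(\delta)=[A\xrightarrow{x}B\xrightarrow{y}C]$ such that for every morphism $(a,c)\colon\delta\to\delta'$, with $\mathfrak{s}(\delta')=[A'\xrightarrow{x'}B'\xrightarrow{y'}C']$, there is $b\colon B\to B'$ with $bx=x'a$, $y'b=cy$. It is additive if $\mathfrak{s}(0)=[A\to A\oplus C\to C]$ (the split sequence) and $\mathfrak{s}(\delta\oplus\delta')=\mathfrak{s}(\delta)\oplus\mathfrak{s}(\delta')$. The triple $(\mathcal{C},\mathbb{E},\mathfrak{s})$ is an extriangulated category if $\mathbb{E}$ is an additive bifunctor, $\mathfrak{s}$ is an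 additive realization and the following hold. (ET3) If $\mathfrak{s}(\delta)=[A\xrightarrow{x}B\xrightarrow{y}C]$, $\mathfrak{s}(\delta')=[A'\xrightarrow{x'}B'\xrightarrow{y'}C']$ and $bx=x'a$, then there is $c\colon C\to C'$ with $cy=y'b$ and $a_*\delta=c^*\delta'$. (ET3)$^{op}$: the dual. (ET4) If $A\xrightarrow{f}B\xrightarrow{f'}D$ realizes $\delta$ and $B\xrightarrow{g}C\xrightarrow{g'}F$ realizes $\delta'$, then there are an object $E$, morphisms $h'\colon C\to E$, $d\colon D\to E$, $e\colon E\to F$ and $\delta''\in\mathbb{E}(E,A)$ realized by $A\xrightarrow{gf}C\xrightarrow{h'}E$ such that $df'=h'g$, $eh'=g'$, $D\xrightarrow{d}E\xrightarrow{e}F$ realizes $f'_*\delta'$, $d^*\delta''=\delta$ and $f_*\delta''=e^*\delta'$. (ET4)$^{op}$: the dual. A sequence $A\xrightarrow{x}B\xrightarrow{y}C$ realizing some $\delta\in\mathbb{E}(C,A)$ is a conflation, $x$ is an inflation, $y$ is a deflation, and the sequence together with $\delta$ is an $\mathbb{E}$-triangle, written $A\to B\to C\dashrightarrow$. An object $P$ is projective if for every $\mathbb{E}$-triangle $A\to B\xrightarrow{y}C\dashrightarrow$ every morphism $P\to C$ factors through $y$; $\mathcal{C}$ has enough projectives if for every $C$ there is an $\mathbb{E}$-triangle $A\to P\to C\dashrightarrow$ with $P$ projective. **Exactness.** A morphism $f$ is compatible if "$f$ is both an inflation and a deflation" implies that $f$ is an isomorphism. A sequence $A\xrightarrow{f}B\xrightarrow{g}C$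 is right exact if there are an $\mathbb{E}$-triangle $K\xrightarrow{h_2}B\xrightarrow{g}C\dashrightarrow$ and a compatible deflation $h_1\colon A\to K$ with $f=h_2h_1$; dually it is left exact if there are an $\mathbb{E}$-triangle $A\xrightarrow{f}B\xrightarrow{h_1}K\dashrightarrow$ and a compatible inflation $h_2\colon K\to C$ with $g=h_2h_1$. A 4-term $\mathbb{E}$-triangle sequence $A\xrightarrow{f}B\xrightarrow{g}C\xrightarrow{h}D$ is right exact (resp. left exact) if there are $\mathbb{E}$-triangles $A\xrightarrow{f}B\xrightarrow{g_1}K\dashrightarrow$ and $K\xrightarrow{g_2}C\xrightarrow{h}D\dashrightarrow$ with $g=g_2g_1$ and $g_1$ (resp. $g_2$) compatible. An additive functor $F\colon\mathcal{A}\to\mathcal{B}$ between extriangulated categories is right exact if (1) $F$ preserves compatible morphisms; (2) $F$ preserves right exact sequences (so for every $\mathbb{E}_{\mathcal A}$-triangle $A\xrightarrow{f}B\xrightarrow{g}C\overset{\delta}{\dashrightarrow}$ there is an $\mathbb{E}_{\mathcal B}$-triangle $A'\xrightarrow{x}FB\xrightarrow{Fg}FC\dashrightarrow$ with $Ff=xy$ for a compatible deflation $y\colon FA\to A'$, where $A'$ is unique up to isomorphism); (3) there is a natural transformation $\eta_{(C,A)}\colon\mathbb{E}_{\mathcal A}(C,A)\to\mathbb{E}_{\mathcal B}(FC,A')$ with $\mathfrak{s}_{\mathcal B}(\eta_{(C,A)}(\delta))=[A'\xrightarrow{x}FB\xrightarrow{Fg}FC]$. Left exact functors are defined dually. $F$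 is exact if it preserves compatible morphisms and there is a natural transformation $\eta\colon\mathbb{E}_{\mathcal A}(-,-)\Rightarrow\mathbb{E}_{\mathcal B}(F-,F-)$ such that $\mathfrak{s}_{\mathcal A}(\delta)=[A\xrightarrow{x}B\xrightarrow{y}C]$ implies $\mathfrak{s}_{\mathcal B}(\eta(\delta))=[FA\xrightarrow{Fx}FB\xrightarrow{Fy}FC]$ (equivalently, $F$ is both left and right exact). **Recollement.** A recollement $(\mathcal{A},\mathcal{B},\mathcal{C})$ of extriangulated categories consists of two exact functors $i_*\colon\mathcal{A}\to\mathcal{B}$, $j^*\colon\mathcal{B}\to\mathcal{C}$, two right exact functors $i^*\colon\mathcal{B}\to\mathcal{A}$, $j_!\colon\mathcal{C}\to\mathcal{B}$, and two left exact functors $i^!\colon\mathcal{B}\to\mathcal{A}$, $j_*\colon\mathcal{C}\to\mathcal{B}$ such that: (R1) $(i^*,i_*,i^!)$ and $(j_!,j^*,j_* )$ are adjoint triples; (R2) $\operatorname{Im} i_*=\operatorname{Ker} j^*$ (essential image; objects killed by $j^*$); (R3) $i_*,j_!,j_*$ are fully faithful; (R4) for each $X\in\mathcal{B}$ there is a left exact 4-term $\mathbb{E}_{\mathcal B}$-triangle sequence $i_*i^!X\to X\to j_*j^*X\to i_*A$ with $A\in\mathcal{A}$, the first two maps being the adjunction morphisms; (R5) for each $X\in\mathcal{B}$ there is a right exact 4-term $\mathbb{E}_{\mathcal B}$-triangle sequence $i_*A'\to j_!j^*X\to X\to i_*i^*X$ with $A'\in\mathcal{A}$, the last two maps being the adjunction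 morphisms. For abelian categories this coincides with the usual notion of recollement of abelian categories: additive functors $i^*,i_*,i^!,j_!,j^*,j_*$ satisfying (R1), (R2), (R3). **Cluster tilting.** Subcategories are full and closed under isomorphisms. A subcategory $\mathcal{T}$ of an extriangulated category $\mathcal{C}$ is strongly contravariantly (resp. covariantly) finite if for every $C\in\mathcal{C}$ there is an $\mathbb{E}$-triangle $K\to T\xrightarrow{g}C\dashrightarrow$ (resp. $C\xrightarrow{f}T\to L\dashrightarrow$) with $g$ a right (resp. $f$ a left) $\mathcal{T}$-approximation of $C$; strongly functorially finite means both. $\mathcal{T}$ is cluster tilting if it is strongly functorially finite and, for every object $T$: $T\in\mathcal{T}$ iff $\mathbb{E}(T,\mathcal{T})=0$, and $T\in\mathcal{T}$ iff $\mathbb{E}(\mathcal{T},T)=0$. **Quotients.** $\mathcal{C}/\mathcal{T}$ is the additive quotient: same objects as $\mathcal{C}$, morphisms of $\mathcal{C}$ modulo those factoring through an object of $\mathcal{T}$; $\pi_{\mathcal C}\colon\mathcal{C}\to\mathcal{C}/\mathcal{T}$ is the projection. An additive functor $G\colon\mathcal{X}\to\mathcal{Y}$ sending $\mathcal{S}\subseteq\mathcal{X}$ into $\mathcal{S}'\subseteq\mathcal{Y}$ induces the unique additive functor $\overline{G}\colon\mathcal{X}/\mathcal{S}\to\mathcal{Y}/\mathcal{S}'$ with $\overline{G}\pi_{\mathcal X}=\pi_{\mathcal Y}G$. For a functor $G$ and a subcategory $\mathcal{S}$, $G\mathcal{S}$ denotes the full subcategory of objects isomorphic to $GS$ for some $S\in\mathcal{S}$.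 *)

theory Defs
  imports "HOL-Algebra.Group"
begin

section \<open>Additive and abelian categories\<close>

text \<open>Hom sets are disjoint: an arrow determines its domain and codomain. \<open>Comp\<close> and \<open>Add\<close> are only
  meaningful on composable, respectively parallel, arrows.\<close>

record ('o, 'm) precat =
  Obj :: "'o set"
  Arr :: "'m set"
  Dom :: "'m \<Rightarrow> 'o"
  Cod :: "'m \<Rightarrow> 'o"
  Ident :: "'o \<Rightarrow> 'm"
  Comp :: "'m \<Rightarrow> 'm \<Rightarrow> 'm" (infixl "\<cdot>\<index>" 70)
  Add :: "'m \<Rightarrow> 'm \<Rightarrow> 'm" (infixl "\<oplus>\<index>" 65)
  Zero :: "'o \<Rightarrow> 'o \<Rightarrow> 'm"

definition Hom :: "('o, 'm, 'z) precat_scheme \<Rightarrow> 'o \<Rightarrow> 'o \<Rightarrow> 'm set" where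
  "Hom C X Y = {f \<in> Arr C. Dom C f = X \<and> Cod C f = Y}"

definition HomG :: "('o, 'm, 'z) precat_scheme \<Rightarrow> 'o \<Rightarrow> 'o \<Rightarrow> 'm monoid" where
  "HomG C X Y = \<lparr>carrier = Hom C X Y, mult = Add C, one = Zero C X Y\<rparr>"

definition is_isomorphism :: "('o, 'm, 'z) precat_scheme \<Rightarrow> 'm \<Rightarrow> bool" where
  "is_isomorphism C f \<longleftrightarrow> f \<in> Arr C \<and> (\<exists>g \<in> Hom C (Cod C f) (Dom C f).
     g \<cdot>\<^bsub>C\<^esub> f = Ident C (Dom C f) \<and> f \<cdot>\<^bsub>C\<^esub> g = Ident C (Cod C f))"

definition isomorphic :: "('o, 'm, 'z) precat_scheme \<Rightarrow> 'o \<Rightarrow> 'o \<Rightarrow> bool" where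
  "isomorphic C X Y \<longleftrightarrow> (\<exists>f \<in> Hom C X Y. is_isomorphism C f)"

definition is_zero_object :: "('o, 'm, 'z) precat_scheme \<Rightarrow> 'o \<Rightarrow> bool" where
  "is_zero_object C Z \<longleftrightarrow> Z \<in> Obj C \<and>
     (\<forall>X \<in> Obj C. (\<exists>!f. f \<in> Hom C X Z) \<and> (\<exists>!f. f \<in> Hom C Z X))"

definition biproduct ::
  "('o, 'm, 'z) precat_scheme \<Rightarrow> 'o \<Rightarrow> 'o \<Rightarrow> 'o \<Rightarrow> 'm \<Rightarrow> 'm \<Rightarrow> 'm \<Rightarrow> 'm \<Rightarrow> bool" where
  "biproduct C X Y S i1 i2 p1 p2 \<longleftrightarrow>
     i1 \<in> Hom C X S \<and> i2 \<in> Hom C Y S \<and> p1 \<in> Hom C S X \<and> p2 \<in> Hom C S Y \<and>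
     p1 \<cdot>\<^bsub>C\<^esub> i1 = Ident C X \<and> p2 \<cdot>\<^bsub>C\<^esub> i2 = Ident C Y \<and>
     p1 \<cdot>\<^bsub>C\<^esub> i2 = Zero C Y X \<and> p2 \<cdot>\<^bsub>C\<^esub> i1 = Zero C X Y \<and>
     (i1 \<cdot>\<^bsub>C\<^esub> p1) \<oplus>\<^bsub>C\<^esub> (i2 \<cdot>\<^bsub>C\<^esub> p2) = Ident C S"

locale category =
  fixes C :: "('o, 'm, 'z) precat_scheme" (structure)
  assumes Dom_Obj: "f \<in> Arr C \<Longrightarrow> Dom C f \<in> Obj C"
    and Cod_Obj: "f \<in> Arr C \<Longrightarrow> Cod C f \<in> Obj C"
    and Ident_Hom: "X \<in> Obj C \<Longrightarrow> Ident C X \<in> Hom C X X"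
    and Comp_Hom: "\<lbrakk>f \<in> Hom C X Y; g \<in> Hom C Y Z\<rbrakk> \<Longrightarrow> g \<cdot> f \<in> Hom C X Z"
    and Comp_Ident_right: "f \<in> Hom C X Y \<Longrightarrow> f \<cdot> Ident C X = f"
    and Comp_Ident_left: "f \<in> Hom C X Y \<Longrightarrow> Ident C Y \<cdot> f = f"
    and Comp_assoc: "\<lbrakk>f \<in> Hom C X Y; g \<in> Hom C Y Z; h \<in> Hom C Z W\<rbrakk>
      \<Longrightarrow> (h \<cdot> g) \<cdot> f = h \<cdot> (g \<cdot> f)"

locale additive_category = category +
  assumes HomG_comm_group: "\<lbrakk>X \<in> Obj C; Y \<in> Obj C\<rbrakk> \<Longrightarrow> comm_group (HomG C X Y)"
    and Comp_Add_right: "\<lbrakk>f \<in> Hom C X Y; f' \<in> Hom C X Y; g \<in> Hom C Y Z\<rbrakk>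
      \<Longrightarrow> g \<cdot> (f \<oplus> f') = (g \<cdot> f) \<oplus> (g \<cdot> f')"
    and Comp_Add_left: "\<lbrakk>f \<in> Hom C X Y; g \<in> Hom C Y Z; g' \<in> Hom C Y Z\<rbrakk>
      \<Longrightarrow> (g \<oplus> g') \<cdot> f = (g \<cdot> f) \<oplus> (g' \<cdot> f)"
    and ex_zero_object: "\<exists>Z. is_zero_object C Z"
    and ex_biproduct: "\<lbrakk>X \<in> Obj C; Y \<in> Obj C\<rbrakk> \<Longrightarrow> \<exists>S i1 i2 p1 p2. biproduct C X Y S i1 i2 p1 p2"

definition is_mono :: "('o, 'm, 'z) precat_scheme \<Rightarrow> 'm \<Rightarrow> bool" where
  "is_mono C f \<longleftrightarrow> f \<in> Arr C \<and> (\<forall>X \<in> Obj C. inj_on (\<lambda>u. f \<cdot>\<^bsub>C\<^esub> u) (Hom C X (Dom C f)))"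

definition is_epi :: "('o, 'm, 'z) precat_scheme \<Rightarrow> 'm \<Rightarrow> bool" where
  "is_epi C f \<longleftrightarrow> f \<in> Arr C \<and> (\<forall>X \<in> Obj C. inj_on (\<lambda>u. u \<cdot>\<^bsub>C\<^esub> f) (Hom C (Cod C f) X))"

definition is_kernel :: "('o, 'm, 'z) precat_scheme \<Rightarrow> 'm \<Rightarrow> 'm \<Rightarrow> bool" where
  "is_kernel C k f \<longleftrightarrow> k \<in> Arr C \<and> f \<in> Arr C \<and> Cod C k = Dom C f \<and>
     f \<cdot>\<^bsub>C\<^esub> k = Zero C (Dom C k) (Cod C f) \<and>
     (\<forall>g \<in> Arr C. Cod C g = Dom C f \<and> f \<cdot>\<^bsub>C\<^esub> g = Zero C (Dom C g) (Cod C f) \<longrightarrow>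
        (\<exists>!u. u \<in> Hom C (Dom C g) (Dom C k) \<and> k \<cdot>\<^bsub>C\<^esub> u = g))"

definition is_cokernel :: "('o, 'm, 'z) precat_scheme \<Rightarrow> 'm \<Rightarrow> 'm \<Rightarrow> bool" where
  "is_cokernel C q f \<longleftrightarrow> q \<in> Arr C \<and> f \<in> Arr C \<and> Dom C q = Cod C f \<and>
     q \<cdot>\<^bsub>C\<^esub> f = Zero C (Dom C f) (Cod C q) \<and>
     (\<forall>g \<in> Arr C. Dom C g = Cod C f \<and> g \<cdot>\<^bsub>C\<^esub> f = Zero C (Dom C f) (Cod C g) \<longrightarrow>
        (\<exists>!u. u \<in> Hom C (Cod C q) (Cod C g) \<and> u \<cdot>\<^bsub>C\<^esub> q = g))"

locale abelian_category = additive_category +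
  assumes ex_kernel: "f \<in> Arr C \<Longrightarrow> \<exists>k. is_kernel C k f"
    and ex_cokernel: "f \<in> Arr C \<Longrightarrow> \<exists>q. is_cokernel C q f"
    and mono_is_kernel: "is_mono C f \<Longrightarrow> \<exists>g. is_kernel C f g"
    and epi_is_cokernel: "is_epi C f \<Longrightarrow> \<exists>g. is_cokernel C f g"


section \<open>Functors and adjunctions\<close>

record ('o, 'm, 'p, 'n) fct =
  FO :: "'o \<Rightarrow> 'p"
  FM :: "'m \<Rightarrow> 'n"

definition is_functor ::
  "('o, 'm, 'z) precat_scheme \<Rightarrow> ('p, 'n, 'y) precat_scheme \<Rightarrow> ('o, 'm, 'p, 'n) fct \<Rightarrow> bool" where
  "is_functor C D F \<longleftrightarrow>
     (\<forall>X \<in> Obj C. FO F X \<in> Obj D \<and> FM F (Ident C X) = Ident D (FO F X)) \<and>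
     (\<forall>f \<in> Arr C. FM F f \<in> Hom D (FO F (Dom C f)) (FO F (Cod C f))) \<and>
     (\<forall>f \<in> Arr C. \<forall>g \<in> Arr C. Dom C g = Cod C f \<longrightarrow> FM F (g \<cdot>\<^bsub>C\<^esub> f) = FM F g \<cdot>\<^bsub>D\<^esub> FM F f)"

definition additive_functor ::
  "('o, 'm, 'z) precat_scheme \<Rightarrow> ('p, 'n, 'y) precat_scheme \<Rightarrow> ('o, 'm, 'p, 'n) fct \<Rightarrow> bool" where
  "additive_functor C D F \<longleftrightarrow> is_functor C D F \<and>
     (\<forall>X \<in> Obj C. \<forall>Y \<in> Obj C. FM F \<in> hom (HomG C X Y) (HomG D (FO F X) (FO F Y)))"

definition fully_faithful ::
  "('o, 'm, 'z) precat_scheme \<Rightarrow> ('p, 'n, 'y) precat_scheme \<Rightarrow> ('o, 'm, 'p, 'n) fct \<Rightarrow> bool" where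
  "fully_faithful C D F \<longleftrightarrow>
     (\<forall>X \<in> Obj C. \<forall>Y \<in> Obj C. bij_betw (FM F) (Hom C X Y) (Hom D (FO F X) (FO F Y)))"

text \<open>\<open>F\<close> is left adjoint to \<open>G\<close>, with unit \<open>\<eta>\<close> and counit \<open>\<epsilon>\<close>.\<close>

definition adjunction ::
  "('o, 'm, 'z) precat_scheme \<Rightarrow> ('p, 'n, 'y) precat_scheme \<Rightarrow> ('o, 'm, 'p, 'n) fct \<Rightarrow>
   ('p, 'n, 'o, 'm) fct \<Rightarrow> ('o \<Rightarrow> 'm) \<Rightarrow> ('p \<Rightarrow> 'n) \<Rightarrow> bool" where
  "adjunction C D F G \<eta> \<epsilon> \<longleftrightarrow>
     is_functor C D F \<and> is_functor D C G \<and>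
     (\<forall>X \<in> Obj C. \<eta> X \<in> Hom C X (FO G (FO F X))) \<and>
     (\<forall>Y \<in> Obj D. \<epsilon> Y \<in> Hom D (FO F (FO G Y)) Y) \<and>
     (\<forall>f \<in> Arr C. \<eta> (Cod C f) \<cdot>\<^bsub>C\<^esub> f = FM G (FM F f) \<cdot>\<^bsub>C\<^esub> \<eta> (Dom C f)) \<and>
     (\<forall>g \<in> Arr D. \<epsilon> (Cod D g) \<cdot>\<^bsub>D\<^esub> FM F (FM G g) = g \<cdot>\<^bsub>D\<^esub> \<epsilon> (Dom D g)) \<and>
     (\<forall>X \<in> Obj C. \<epsilon> (FO F X) \<cdot>\<^bsub>D\<^esub> FM F (\<eta> X) = Ident D (FO F X)) \<and>
     (\<forall>Y \<in> Obj D. FM G (\<epsilon> Y) \<cdot>\<^bsub>C\<^esub> \<eta> (FO G Y) = Ident C (FO G Y))"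

text \<open>The full subcategory of objects isomorphic to \<open>G S\<close> with \<open>S \<in> T\<close>; for \<open>T = Obj C\<close> this is the
  essential image. Full subcategories are represented by their sets of objects.\<close>

definition image_subcat ::
  "('p, 'n, 'y) precat_scheme \<Rightarrow> ('o \<Rightarrow> 'p) \<Rightarrow> 'o set \<Rightarrow> 'p set" where
  "image_subcat D G T = {Y \<in> Obj D. \<exists>S \<in> T. isomorphic D (G S) Y}"

definition kernel_subcat ::
  "('o, 'm, 'z) precat_scheme \<Rightarrow> ('p, 'n, 'y) precat_scheme \<Rightarrow> ('o, 'm, 'p, 'n) fct \<Rightarrow> 'o set" where
  "kernel_subcat C D F = {X \<in> Obj C. is_zero_object D (FO F X)}"


section \<open>Extriangulated categories\<close>

text \<open>\<open>Ext K C A\<close> is the group E(C,A), written multiplicatively; its elements are the E-extensions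
  from \<open>C\<close> by \<open>A\<close>. \<open>EAct K c a\<close> is the map E(c,a), and \<open>Real K C A \<delta>\<close> is the equivalence class
  s(\<open>\<delta>\<close>), a set of pairs (x,y) of arrows x: A \<open>\<rightarrow>\<close> B, y: B \<open>\<rightarrow>\<close> C.\<close>

record ('o, 'm, 'e) extcat = "('o, 'm) precat" +
  Ext :: "'o \<Rightarrow> 'o \<Rightarrow> 'e monoid"
  EAct :: "'m \<Rightarrow> 'm \<Rightarrow> 'e \<Rightarrow> 'e"
  Real :: "'o \<Rightarrow> 'o \<Rightarrow> 'e \<Rightarrow> ('m \<times> 'm) set"

definition push :: "('o, 'm, 'e) extcat \<Rightarrow> 'o \<Rightarrow> 'm \<Rightarrow> 'e \<Rightarrow> 'e" where
  "push K C a \<delta> = EAct K (Ident K C) a \<delta>"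

definition pull :: "('o, 'm, 'e) extcat \<Rightarrow> 'o \<Rightarrow> 'm \<Rightarrow> 'e \<Rightarrow> 'e" where
  "pull K A c \<delta> = EAct K c (Ident K A) \<delta>"

definition ext_morphism ::
  "('o, 'm, 'e) extcat \<Rightarrow> 'o \<Rightarrow> 'o \<Rightarrow> 'e \<Rightarrow> 'o \<Rightarrow> 'o \<Rightarrow> 'e \<Rightarrow> 'm \<Rightarrow> 'm \<Rightarrow> bool" where
  "ext_morphism K C A \<delta> C' A' \<delta>' a c \<longleftrightarrow>
     \<delta> \<in> carrier (Ext K C A) \<and> \<delta>' \<in> carrier (Ext K C' A') \<and>
     a \<in> Hom K A A' \<and> c \<in> Hom K C C' \<and> push K C a \<delta> = pull K A' c \<delta>'"

definition is_sequence :: "('o, 'm, 'z) precat_scheme \<Rightarrow> 'o \<Rightarrow> 'o \<Rightarrow> 'm \<Rightarrow> 'm \<Rightarrow> bool" where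
  "is_sequence K A C x y \<longleftrightarrow>
     x \<in> Arr K \<and> y \<in> Arr K \<and> Dom K x = A \<and> Cod K x = Dom K y \<and> Cod K y = C"

definition seq_class :: "('o, 'm, 'z) precat_scheme \<Rightarrow> 'o \<Rightarrow> 'o \<Rightarrow> 'm \<Rightarrow> 'm \<Rightarrow> ('m \<times> 'm) set" where
  "seq_class K A C x y = {(x', y'). is_sequence K A C x' y' \<and>
     (\<exists>b \<in> Hom K (Cod K x) (Cod K x'). is_isomorphism K b \<and> b \<cdot>\<^bsub>K\<^esub> x = x' \<and> y' \<cdot>\<^bsub>K\<^esub> b = y)}"

definition etriangle :: "('o, 'm, 'e) extcat \<Rightarrow> 'o \<Rightarrow> 'o \<Rightarrow> 'e \<Rightarrow> 'm \<Rightarrow> 'm \<Rightarrow> bool" where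
  "etriangle K A C \<delta> x y \<longleftrightarrow>
     A \<in> Obj K \<and> C \<in> Obj K \<and> \<delta> \<in> carrier (Ext K C A) \<and> (x, y) \<in> Real K C A \<delta>"

definition direct_sum_arr :: "('o, 'm, 'z) precat_scheme \<Rightarrow> 'm \<Rightarrow> 'm \<Rightarrow> 'm \<Rightarrow> 'm \<Rightarrow> 'm \<Rightarrow> 'm \<Rightarrow> 'm" where
  "direct_sum_arr K p1 p2 i1' i2' f g = (i1' \<cdot>\<^bsub>K\<^esub> f \<cdot>\<^bsub>K\<^esub> p1) \<oplus>\<^bsub>K\<^esub> (i2' \<cdot>\<^bsub>K\<^esub> g \<cdot>\<^bsub>K\<^esub> p2)"

text \<open>The opposite structure: E-op(C,A) = E(A,C), and all sequences are reversed.\<close>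

definition opp :: "('o, 'm, 'e) extcat \<Rightarrow> ('o, 'm, 'e) extcat" where
  "opp K = \<lparr>Obj = Obj K, Arr = Arr K, Dom = Cod K, Cod = Dom K, Ident = Ident K,
     Comp = (\<lambda>g f. f \<cdot>\<^bsub>K\<^esub> g), Add = Add K, Zero = (\<lambda>X Y. Zero K Y X),
     Ext = (\<lambda>C A. Ext K A C), EAct = (\<lambda>c a. EAct K a c),
     Real = (\<lambda>C A \<delta>. {(y, x). (x, y) \<in> Real K A C \<delta>})\<rparr>"

definition ET3 :: "('o, 'm, 'e) extcat \<Rightarrow> bool" where
  "ET3 K \<longleftrightarrow> (\<forall>A C \<delta> x y A' C' \<delta>' x' y' a b.
     etriangle K A C \<delta> x y \<and> etriangle K A' C' \<delta>' x' y' \<and>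
     a \<in> Hom K A A' \<and> b \<in> Hom K (Cod K x) (Cod K x') \<and> b \<cdot>\<^bsub>K\<^esub> x = x' \<cdot>\<^bsub>K\<^esub> a \<longrightarrow>
     (\<exists>c \<in> Hom K C C'. c \<cdot>\<^bsub>K\<^esub> y = y' \<cdot>\<^bsub>K\<^esub> b \<and> push K C a \<delta> = pull K A' c \<delta>'))"

definition ET4 :: "('o, 'm, 'e) extcat \<Rightarrow> bool" where
  "ET4 K \<longleftrightarrow> (\<forall>A B D F \<delta> \<delta>' f f' g g'.
     etriangle K A D \<delta> f f' \<and> etriangle K B F \<delta>' g g' \<and> Cod K f = B \<longrightarrow>
     (\<exists>E \<in> Obj K. \<exists>h' \<in> Hom K (Cod K g) E. \<exists>d \<in> Hom K D E. \<exists>e \<in> Hom K E F.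
      \<exists>\<delta>'' \<in> carrier (Ext K E A).
        etriangle K A E \<delta>'' (g \<cdot>\<^bsub>K\<^esub> f) h' \<and>
        d \<cdot>\<^bsub>K\<^esub> f' = h' \<cdot>\<^bsub>K\<^esub> g \<and> e \<cdot>\<^bsub>K\<^esub> h' = g' \<and>
        etriangle K D F (push K F f' \<delta>') d e \<and>
        pull K A d \<delta>'' = \<delta> \<and> push K E f \<delta>'' = pull K B e \<delta>'))"

locale extriangulated_category = additive_category K
  for K :: "('o, 'm, 'e) extcat" (structure) +
  assumes Ext_comm_group: "\<lbrakk>C \<in> Obj K; A \<in> Obj K\<rbrakk> \<Longrightarrow> comm_group (Ext K C A)"
    and EAct_hom: "\<lbrakk>c \<in> Hom K C' C; a \<in> Hom K A A'\<rbrakk>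
      \<Longrightarrow> EAct K c a \<in> hom (Ext K C A) (Ext K C' A')"
    and EAct_Ident: "\<lbrakk>C \<in> Obj K; A \<in> Obj K; \<delta> \<in> carrier (Ext K C A)\<rbrakk>
      \<Longrightarrow> EAct K (Ident K C) (Ident K A) \<delta> = \<delta>"
    and EAct_Comp: "\<lbrakk>c \<in> Hom K C' C; c' \<in> Hom K C'' C'; a \<in> Hom K A A'; a' \<in> Hom K A' A'';
        \<delta> \<in> carrier (Ext K C A)\<rbrakk>
      \<Longrightarrow> EAct K (c \<cdot> c') (a' \<cdot> a) \<delta> = EAct K c' a' (EAct K c a \<delta>)"
    and EAct_Add_right: "\<lbrakk>c \<in> Hom K C' C; a \<in> Hom K A A'; a' \<in> Hom K A A'; \<delta> \<in> carrier (Ext K C A)\<rbrakk>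
      \<Longrightarrow> EAct K c (a \<oplus> a') \<delta> = EAct K c a \<delta> \<otimes>\<^bsub>Ext K C' A'\<^esub> EAct K c a' \<delta>"
    and EAct_Add_left: "\<lbrakk>c \<in> Hom K C' C; c' \<in> Hom K C' C; a \<in> Hom K A A'; \<delta> \<in> carrier (Ext K C A)\<rbrakk>
      \<Longrightarrow> EAct K (c \<oplus> c') a \<delta> = EAct K c a \<delta> \<otimes>\<^bsub>Ext K C' A'\<^esub> EAct K c' a \<delta>"
    and Real_class: "\<lbrakk>C \<in> Obj K; A \<in> Obj K; \<delta> \<in> carrier (Ext K C A)\<rbrakk>
      \<Longrightarrow> \<exists>x y. is_sequence K A C x y \<and> Real K C A \<delta> = seq_class K A C x y"
    and Real_morphism: "\<lbrakk>ext_morphism K C A \<delta> C' A' \<delta>' a c;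
        (x, y) \<in> Real K C A \<delta>; (x', y') \<in> Real K C' A' \<delta>'\<rbrakk>
      \<Longrightarrow> \<exists>b \<in> Hom K (Cod K x) (Cod K x'). b \<cdot> x = x' \<cdot> a \<and> y' \<cdot> b = c \<cdot> y"
    and Real_zero: "biproduct K A C S i1 i2 p1 p2
      \<Longrightarrow> Real K C A \<one>\<^bsub>Ext K C A\<^esub> = seq_class K A C i1 p2"
    and Real_sum: "\<lbrakk>etriangle K A C \<delta> x y; etriangle K A' C' \<delta>' x' y';
        biproduct K A A' SA iA iA' pA pA';
        biproduct K (Cod K x) (Cod K x') SB iB iB' pB pB';
        biproduct K C C' SC iC iC' pC pC'\<rbrakk>
      \<Longrightarrow> Real K SC SA (EAct K pC iA \<delta> \<otimes>\<^bsub>Ext K SC SA\<^esub> EAct K pC' iA' \<delta>') =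
          seq_class K SA SC (direct_sum_arr K pA pA' iB iB' x x') (direct_sum_arr K pB pB' iC iC' y y')"
    and ET3: "ET3 K"
    and ET3_op: "ET3 (opp K)"
    and ET4: "ET4 K"
    and ET4_op: "ET4 (opp K)"

definition inflation :: "('o, 'm, 'e) extcat \<Rightarrow> 'm \<Rightarrow> bool" where
  "inflation K x \<longleftrightarrow> (\<exists>A C \<delta> y. etriangle K A C \<delta> x y)"

definition deflation :: "('o, 'm, 'e) extcat \<Rightarrow> 'm \<Rightarrow> bool" where
  "deflation K y \<longleftrightarrow> (\<exists>A C \<delta> x. etriangle K A C \<delta> x y)"

definition projective :: "('o, 'm, 'e) extcat \<Rightarrow> 'o \<Rightarrow> bool" where
  "projective K P \<longleftrightarrow> P \<in> Obj K \<and>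
     (\<forall>A C \<delta> x y. etriangle K A C \<delta> x y \<longrightarrow>
        (\<forall>f \<in> Hom K P C. \<exists>g \<in> Hom K P (Dom K y). y \<cdot>\<^bsub>K\<^esub> g = f))"

definition enough_projectives :: "('o, 'm, 'e) extcat \<Rightarrow> bool" where
  "enough_projectives K \<longleftrightarrow>
     (\<forall>C \<in> Obj K. \<exists>A \<delta> x y. etriangle K A C \<delta> x y \<and> projective K (Dom K y))"


section \<open>Exactness\<close>

definition compatible :: "('o, 'm, 'e) extcat \<Rightarrow> 'm \<Rightarrow> bool" where
  "compatible K f \<longleftrightarrow> f \<in> Arr K \<and> (inflation K f \<and> deflation K f \<longrightarrow> is_isomorphism K f)"

definition right_exact_seq :: "('o, 'm, 'e) extcat \<Rightarrow> 'm \<Rightarrow> 'm \<Rightarrow> bool" where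
  "right_exact_seq K f g \<longleftrightarrow> (\<exists>Q \<delta> h1 h2.
     etriangle K Q (Cod K g) \<delta> h2 g \<and> h1 \<in> Hom K (Dom K f) Q \<and>
     deflation K h1 \<and> compatible K h1 \<and> f = h2 \<cdot>\<^bsub>K\<^esub> h1)"

definition left_exact_seq :: "('o, 'm, 'e) extcat \<Rightarrow> 'm \<Rightarrow> 'm \<Rightarrow> bool" where
  "left_exact_seq K f g \<longleftrightarrow> (\<exists>Q \<delta> h1 h2.
     etriangle K (Dom K f) Q \<delta> f h1 \<and> h2 \<in> Hom K Q (Cod K g) \<and>
     inflation K h2 \<and> compatible K h2 \<and> g = h2 \<cdot>\<^bsub>K\<^esub> h1)"

definition right_exact_seq4 :: "('o, 'm, 'e) extcat \<Rightarrow> 'm \<Rightarrow> 'm \<Rightarrow> 'm \<Rightarrow> bool" where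
  "right_exact_seq4 K f g h \<longleftrightarrow> (\<exists>Q \<delta> \<delta>' g1 g2.
     etriangle K (Dom K f) Q \<delta> f g1 \<and> etriangle K Q (Cod K h) \<delta>' g2 h \<and>
     g = g2 \<cdot>\<^bsub>K\<^esub> g1 \<and> compatible K g1)"

definition left_exact_seq4 :: "('o, 'm, 'e) extcat \<Rightarrow> 'm \<Rightarrow> 'm \<Rightarrow> 'm \<Rightarrow> bool" where
  "left_exact_seq4 K f g h \<longleftrightarrow> (\<exists>Q \<delta> \<delta>' g1 g2.
     etriangle K (Dom K f) Q \<delta> f g1 \<and> etriangle K Q (Cod K h) \<delta>' g2 h \<and>
     g = g2 \<cdot>\<^bsub>K\<^esub> g1 \<and> compatible K g2)"

text \<open>In the natural transformation of a right exact functor \<open>F\<close>, the object A' depends on the extension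
  \<open>\<delta>\<close> (for abelian categories A' is the image of F A \<open>\<rightarrow>\<close> F B), so the family is indexed by extensions:
  \<open>Q C A \<delta>\<close> is A', \<open>q C A \<delta>\<close> is the compatible deflation F A \<open>\<rightarrow>\<close> A', and \<open>e C A \<delta>\<close> is the value of
  the transformation at \<open>\<delta>\<close>. Naturality: each morphism (a,c) of extensions gives a morphism (k, F c)
  of the image extensions, where k is induced by F a along the deflations \<open>q\<close>.\<close>

definition right_exact_functor ::
  "('o, 'm, 'e) extcat \<Rightarrow> ('p, 'n, 'f) extcat \<Rightarrow> ('o, 'm, 'p, 'n) fct \<Rightarrow> bool" where
  "right_exact_functor K L F \<longleftrightarrow>
     additive_functor K L F \<and>
     (\<forall>f. compatible K f \<longrightarrow> compatible L (FM F f)) \<and>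
     (\<forall>f g. right_exact_seq K f g \<longrightarrow> right_exact_seq L (FM F f) (FM F g)) \<and>
     (\<exists>Q q e.
        (\<forall>C \<in> Obj K. \<forall>A \<in> Obj K. \<forall>\<delta> \<in> carrier (Ext K C A).
           Q C A \<delta> \<in> Obj L \<and>
           q C A \<delta> \<in> Hom L (FO F A) (Q C A \<delta>) \<and> deflation L (q C A \<delta>) \<and> compatible L (q C A \<delta>) \<and>
           e C A \<delta> \<in> carrier (Ext L (FO F C) (Q C A \<delta>)) \<and>
           (\<forall>(f, g) \<in> Real K C A \<delta>. \<exists>x \<in> Hom L (Q C A \<delta>) (FO F (Cod K f)).
              FM F f = x \<cdot>\<^bsub>L\<^esub> q C A \<delta> \<and> (x, FM F g) \<in> Real L (FO F C) (Q C A \<delta>) (e C A \<delta>))) \<and>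
        (\<forall>C A \<delta> C' A' \<delta>' a c. ext_morphism K C A \<delta> C' A' \<delta>' a c \<longrightarrow>
           (\<exists>k. ext_morphism L (FO F C) (Q C A \<delta>) (e C A \<delta>) (FO F C') (Q C' A' \<delta>') (e C' A' \<delta>') k (FM F c) \<and>
                k \<cdot>\<^bsub>L\<^esub> q C A \<delta> = q C' A' \<delta>' \<cdot>\<^bsub>L\<^esub> FM F a)))"

definition left_exact_functor ::
  "('o, 'm, 'e) extcat \<Rightarrow> ('p, 'n, 'f) extcat \<Rightarrow> ('o, 'm, 'p, 'n) fct \<Rightarrow> bool" where
  "left_exact_functor K L F \<longleftrightarrow> right_exact_functor (opp K) (opp L) F"

definition exact_functor ::
  "('o, 'm, 'e) extcat \<Rightarrow> ('p, 'n, 'f) extcat \<Rightarrow> ('o, 'm, 'p, 'n) fct \<Rightarrow> bool" where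
  "exact_functor K L F \<longleftrightarrow>
     additive_functor K L F \<and>
     (\<forall>f. compatible K f \<longrightarrow> compatible L (FM F f)) \<and>
     (\<exists>\<eta>.
        (\<forall>C \<in> Obj K. \<forall>A \<in> Obj K. \<eta> C A \<in> hom (Ext K C A) (Ext L (FO F C) (FO F A))) \<and>
        (\<forall>C A C' A'. \<forall>c \<in> Hom K C' C. \<forall>a \<in> Hom K A A'. \<forall>\<delta> \<in> carrier (Ext K C A).
           \<eta> C' A' (EAct K c a \<delta>) = EAct L (FM F c) (FM F a) (\<eta> C A \<delta>)) \<and>
        (\<forall>A C \<delta> x y. etriangle K A C \<delta> x y \<longrightarrow>
           etriangle L (FO F A) (FO F C) (\<eta> C A \<delta>) (FM F x) (FM F y)))"


section \<open>Recollements\<close>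

text \<open>The functors are listed in the order i^*, i_*, i^!, j_!, j^*, j_*.\<close>

definition recollement ::
  "('oa, 'ma, 'ea) extcat \<Rightarrow> ('ob, 'mb, 'eb) extcat \<Rightarrow> ('oc, 'mc, 'ec) extcat \<Rightarrow>
   ('ob, 'mb, 'oa, 'ma) fct \<Rightarrow> ('oa, 'ma, 'ob, 'mb) fct \<Rightarrow> ('ob, 'mb, 'oa, 'ma) fct \<Rightarrow>
   ('oc, 'mc, 'ob, 'mb) fct \<Rightarrow> ('ob, 'mb, 'oc, 'mc) fct \<Rightarrow> ('oc, 'mc, 'ob, 'mb) fct \<Rightarrow> bool" where
  "recollement \<A> \<B> \<C> i_ust i_lst i_ush j_lsh j_ust j_lst \<longleftrightarrow>
     exact_functor \<A> \<B> i_lst \<and> exact_functor \<B> \<C> j_ust \<and>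
     right_exact_functor \<B> \<A> i_ust \<and> right_exact_functor \<C> \<B> j_lsh \<and>
     left_exact_functor \<B> \<A> i_ush \<and> left_exact_functor \<C> \<B> j_lst \<and>
     image_subcat \<B> (FO i_lst) (Obj \<A>) = kernel_subcat \<B> \<C> j_ust \<and>
     fully_faithful \<A> \<B> i_lst \<and> fully_faithful \<C> \<B> j_lsh \<and> fully_faithful \<C> \<B> j_lst \<and>
     (\<exists>\<eta>1 \<epsilon>1 \<eta>2 \<epsilon>2 \<eta>3 \<epsilon>3 \<eta>4 \<epsilon>4.
        adjunction \<B> \<A> i_ust i_lst \<eta>1 \<epsilon>1 \<and> adjunction \<A> \<B> i_lst i_ush \<eta>2 \<epsilon>2 \<and>
        adjunction \<C> \<B> j_lsh j_ust \<eta>3 \<epsilon>3 \<and> adjunction \<B> \<C> j_ust j_lst \<eta>4 \<epsilon>4 \<and>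
        (\<forall>X \<in> Obj \<B>. \<exists>A \<in> Obj \<A>. \<exists>h. Cod \<B> h = FO i_lst A \<and>
           left_exact_seq4 \<B> (\<epsilon>2 X) (\<eta>4 X) h) \<and>
        (\<forall>X \<in> Obj \<B>. \<exists>A \<in> Obj \<A>. \<exists>h. Dom \<B> h = FO i_lst A \<and>
           right_exact_seq4 \<B> h (\<epsilon>3 X) (\<eta>1 X)))"

definition abelian_recollement ::
  "('oa, 'ma, 'za) precat_scheme \<Rightarrow> ('ob, 'mb, 'zb) precat_scheme \<Rightarrow> ('oc, 'mc, 'zc) precat_scheme \<Rightarrow>
   ('ob, 'mb, 'oa, 'ma) fct \<Rightarrow> ('oa, 'ma, 'ob, 'mb) fct \<Rightarrow> ('ob, 'mb, 'oa, 'ma) fct \<Rightarrow>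
   ('oc, 'mc, 'ob, 'mb) fct \<Rightarrow> ('ob, 'mb, 'oc, 'mc) fct \<Rightarrow> ('oc, 'mc, 'ob, 'mb) fct \<Rightarrow> bool" where
  "abelian_recollement \<A> \<B> \<C> i_ust i_lst i_ush j_lsh j_ust j_lst \<longleftrightarrow>
     abelian_category \<A> \<and> abelian_category \<B> \<and> abelian_category \<C> \<and>
     additive_functor \<B> \<A> i_ust \<and> additive_functor \<A> \<B> i_lst \<and> additive_functor \<B> \<A> i_ush \<and>
     additive_functor \<C> \<B> j_lsh \<and> additive_functor \<B> \<C> j_ust \<and> additive_functor \<C> \<B> j_lst \<and>
     (\<exists>\<eta> \<epsilon>. adjunction \<B> \<A> i_ust i_lst \<eta> \<epsilon>) \<and> (\<exists>\<eta> \<epsilon>. adjunction \<A> \<B> i_lst i_ush \<eta> \<epsilon>) \<and>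
     (\<exists>\<eta> \<epsilon>. adjunction \<C> \<B> j_lsh j_ust \<eta> \<epsilon>) \<and> (\<exists>\<eta> \<epsilon>. adjunction \<B> \<C> j_ust j_lst \<eta> \<epsilon>) \<and>
     image_subcat \<B> (FO i_lst) (Obj \<A>) = kernel_subcat \<B> \<C> j_ust \<and>
     fully_faithful \<A> \<B> i_lst \<and> fully_faithful \<C> \<B> j_lsh \<and> fully_faithful \<C> \<B> j_lst"


section \<open>Cluster tilting subcategories\<close>

definition iso_closed :: "('o, 'm, 'z) precat_scheme \<Rightarrow> 'o set \<Rightarrow> bool" where
  "iso_closed K T \<longleftrightarrow> T \<subseteq> Obj K \<and> (\<forall>X \<in> T. \<forall>Y \<in> Obj K. isomorphic K X Y \<longrightarrow> Y \<in> T)"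

definition right_approx :: "('o, 'm, 'z) precat_scheme \<Rightarrow> 'o set \<Rightarrow> 'm \<Rightarrow> bool" where
  "right_approx K T g \<longleftrightarrow> g \<in> Arr K \<and> Dom K g \<in> T \<and>
     (\<forall>X \<in> T. \<forall>f \<in> Hom K X (Cod K g). \<exists>u \<in> Hom K X (Dom K g). g \<cdot>\<^bsub>K\<^esub> u = f)"

definition left_approx :: "('o, 'm, 'z) precat_scheme \<Rightarrow> 'o set \<Rightarrow> 'm \<Rightarrow> bool" where
  "left_approx K T g \<longleftrightarrow> g \<in> Arr K \<and> Cod K g \<in> T \<and>
     (\<forall>X \<in> T. \<forall>f \<in> Hom K (Dom K g) X. \<exists>u \<in> Hom K (Cod K g) X. u \<cdot>\<^bsub>K\<^esub> g = f)"

definition strongly_contravariantly_finite :: "('o, 'm, 'e) extcat \<Rightarrow> 'o set \<Rightarrow> bool" where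
  "strongly_contravariantly_finite K T \<longleftrightarrow>
     (\<forall>C \<in> Obj K. \<exists>A \<delta> x g. etriangle K A C \<delta> x g \<and> right_approx K T g)"

definition strongly_covariantly_finite :: "('o, 'm, 'e) extcat \<Rightarrow> 'o set \<Rightarrow> bool" where
  "strongly_covariantly_finite K T \<longleftrightarrow>
     (\<forall>C \<in> Obj K. \<exists>L \<delta> f y. etriangle K C L \<delta> f y \<and> left_approx K T f)"

definition cluster_tilting :: "('o, 'm, 'e) extcat \<Rightarrow> 'o set \<Rightarrow> bool" where
  "cluster_tilting K T \<longleftrightarrow> iso_closed K T \<and>
     strongly_contravariantly_finite K T \<and> strongly_covariantly_finite K T \<and>
     (\<forall>X \<in> Obj K. X \<in> T \<longleftrightarrow> (\<forall>S \<in> T. carrier (Ext K X S) = {\<one>\<^bsub>Ext K X S\<^esub>})) \<and>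
     (\<forall>X \<in> Obj K. X \<in> T \<longleftrightarrow> (\<forall>S \<in> T. carrier (Ext K S X) = {\<one>\<^bsub>Ext K S X\<^esub>}))"


section \<open>Additive quotients\<close>

definition factoring :: "('o, 'm, 'z) precat_scheme \<Rightarrow> 'o set \<Rightarrow> 'o \<Rightarrow> 'o \<Rightarrow> 'm set" where
  "factoring K T X Y = {g \<cdot>\<^bsub>K\<^esub> f | f g S. S \<in> T \<and> f \<in> Hom K X S \<and> g \<in> Hom K S Y}"

text \<open>The class of \<open>f\<close> is the coset of \<open>f\<close> modulo the morphisms factoring through an object of \<open>T\<close>.\<close>

definition arr_class :: "('o, 'm, 'z) precat_scheme \<Rightarrow> 'o set \<Rightarrow> 'm \<Rightarrow> 'm set" where
  "arr_class K T f = {f \<oplus>\<^bsub>K\<^esub> h | h. h \<in> factoring K T (Dom K f) (Cod K f)}"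

definition arr_rep :: "'m set \<Rightarrow> 'm" where
  "arr_rep U = (SOME f. f \<in> U)"

definition quot_cat :: "('o, 'm, 'z) precat_scheme \<Rightarrow> 'o set \<Rightarrow> ('o, 'm set) precat" where
  "quot_cat K T = \<lparr>Obj = Obj K, Arr = arr_class K T ` Arr K,
     Dom = (\<lambda>U. Dom K (arr_rep U)), Cod = (\<lambda>U. Cod K (arr_rep U)),
     Ident = (\<lambda>X. arr_class K T (Ident K X)),
     Comp = (\<lambda>V U. arr_class K T (arr_rep V \<cdot>\<^bsub>K\<^esub> arr_rep U)),
     Add = (\<lambda>U V. arr_class K T (arr_rep U \<oplus>\<^bsub>K\<^esub> arr_rep V)),
     Zero = (\<lambda>X Y. arr_class K T (Zero K X Y))\<rparr>"

text \<open>The functor from K/S to L/T, for any S, induced by \<open>G\<close> from K to L: it sends the class of \<open>f\<close> to the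
  class of \<open>G f\<close>. It is well defined when \<open>G\<close> is additive and sends S into T.\<close>

definition induced_functor ::
  "('p, 'n, 'y) precat_scheme \<Rightarrow> 'p set \<Rightarrow> ('o, 'm, 'p, 'n) fct \<Rightarrow> ('o, 'm set, 'p, 'n set) fct" where
  "induced_functor L T G =
     \<lparr>FO = FO G, FM = (\<lambda>U. arr_class L T (FM G (arr_rep U)))\<rparr>"

end

theory Submission
  imports Defs
begin

text \<open>
  Write \<open>T\<close> for the cluster tilting subcategory. In \<open>B/T\<close> the first map of a triangle whose third term lies
  in \<open>T\<close> is epi, because maps from its domain to \<open>T\<close> extend. Pushing a triangle X \<open>\<rightarrow>\<close> S \<open>\<rightarrow>\<close> L with S, L in \<open>T\<close>
  out along f: X \<open>\<rightarrow>\<close> Y thus gives a cokernel of f. An epimorphism f is represented by the deflation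
  (f,s): X + S \<open>\<rightarrow>\<close> Y, where s: S \<open>\<rightarrow>\<close> Y is a deflation with S in \<open>T\<close>, and it is the cokernel of the fibre of
  that deflation, since by (ET4) an extension of Y by an object of \<open>T\<close> whose deflation is epi in \<open>B/T\<close> splits.

  Exactness of \<open>i^*\<close> and \<open>i^!\<close> turns the two 4-term sequences into triangles, and the adjunctions carry the
  vanishing of extensions between objects of \<open>T\<close> along the six functors, so that all of them preserve the
  subcategories and induce adjoint triples on the quotients. As \<open>i_*\<close>, \<open>j_!\<close> and \<open>j_*\<close> are fully faithful, the
  quotients of A and C inherit kernels and cokernels from \<open>B/T\<close> through these adjunctions. Hence there is
  no need to know that \<open>i^* T\<close> and \<open>j^* T\<close> are cluster tilting.
\<close>

section \<open>Additive categories and opposites\<close>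

text \<open>The closure hypotheses concern \<open>j_lst\<close> after \<open>j_ust\<close> and
  \<open>i_lst\<close> after \<open>i_ust\<close>; those for \<open>j_lsh\<close> and
  \<open>i_ush\<close> are derived through extension groups. Rigidity gives Ext(i_lst i_ust S', S) =
  0, adjunction with an exact functor turns this into Ext(i_ust S', i_ush S) = 0 and then into
  Ext(S', i_lst i_ush S) = 0, and the Ext-characterisation of \<T> applies. For \<open>j_lsh\<close>
  the start is Ext(j_ust S, j_ust S') = 0. The obstacle there is that \<open>j_lst\<close> is only
  left exact: inflations stay inflations, but the rest of a triangle may change, so a separate
  argument through the counit triangle of \<open>i_lst\<close> and \<open>i_ush\<close> takes the
  place of the adjunction argument. Full faithfulness and the kernel of \<open>j_ust\<close> cannot
  be read off on the quotients, which have fewer maps and more zero objects. The former is expressed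
  by invertible units and counits, whose classes stay invertible. For the latter, an object that
  vanishes in the quotient of \<C> is moved by the induced \<open>j_lst\<close> and
  \<open>j_lsh\<close> into the quotient of \<B>, where the zero objects are exactly the objects of
  \<T>, because \<T> is closed under retracts.\<close>

context category
begin

lemma Hom_Arr: "f \<in> Hom C X Y \<Longrightarrow> f \<in> Arr C"
  and Hom_Dom: "f \<in> Hom C X Y \<Longrightarrow> Dom C f = X"
  and Hom_Cod: "f \<in> Hom C X Y \<Longrightarrow> Cod C f = Y"
  by (auto simp: Hom_def)

lemma Arr_Hom: "f \<in> Arr C \<Longrightarrow> f \<in> Hom C (Dom C f) (Cod C f)"
  by (simp add: Hom_def)

lemma Hom_Obj_Dom: "f \<in> Hom C X Y \<Longrightarrow> X \<in> Obj C"
  and Hom_Obj_Cod: "f \<in> Hom C X Y \<Longrightarrow> Y \<in> Obj C"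
  using Dom_Obj Cod_Obj by (auto simp: Hom_def)

lemma isomorphism_iff:
  "f \<in> Hom C X Y \<Longrightarrow>
    is_isomorphism C f \<longleftrightarrow> (\<exists>g \<in> Hom C Y X. g \<cdot> f = Ident C X \<and> f \<cdot> g = Ident C Y)"
  by (auto simp: is_isomorphism_def Hom_def)

lemma isomorphismE:
  assumes "is_isomorphism C f" "f \<in> Hom C X Y"
  obtains g where "g \<in> Hom C Y X" "g \<cdot> f = Ident C X" "f \<cdot> g = Ident C Y" "is_isomorphism C g"
  using assms isomorphism_iff by blast

lemma isomorphismI:
  "\<lbrakk>f \<in> Hom C X Y; g \<in> Hom C Y X; g \<cdot> f = Ident C X; f \<cdot> g = Ident C Y\<rbrakk> \<Longrightarrow> is_isomorphism C f"
  using isomorphism_iff by blast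

lemma isomorphism_Ident: "X \<in> Obj C \<Longrightarrow> is_isomorphism C (Ident C X)"
  by (meson Comp_Ident_left Ident_Hom isomorphismI)

lemma isomorphicI: "\<lbrakk>f \<in> Hom C X Y; is_isomorphism C f\<rbrakk> \<Longrightarrow> isomorphic C X Y"
  by (auto simp: isomorphic_def)

lemma isomorphic_sym: "isomorphic C X Y \<Longrightarrow> isomorphic C Y X"
  by (metis isomorphic_def isomorphismE)

lemma epi_iff:
  "f \<in> Hom C X Y \<Longrightarrow> is_epi C f \<longleftrightarrow>
    (\<forall>W u v. u \<in> Hom C Y W \<longrightarrow> v \<in> Hom C Y W \<longrightarrow> u \<cdot> f = v \<cdot> f \<longrightarrow> u = v)"
  unfolding is_epi_def inj_on_def using Hom_Arr Hom_Cod Hom_Obj_Cod by (metis (no_types))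

lemma mono_iff:
  "f \<in> Hom C X Y \<Longrightarrow> is_mono C f \<longleftrightarrow>
    (\<forall>W u v. u \<in> Hom C W X \<longrightarrow> v \<in> Hom C W X \<longrightarrow> f \<cdot> u = f \<cdot> v \<longrightarrow> u = v)"
  unfolding is_mono_def inj_on_def using Hom_Arr Hom_Dom Hom_Obj_Dom by (metis (no_types))

end

text \<open>The record carries sums and zeros but no negatives. As hom sets are disjoint, the arrow
  alone determines the group in which to invert.\<close>

definition neg :: "('o, 'm, 'z) precat_scheme \<Rightarrow> 'm \<Rightarrow> 'm" where
  "neg C f = inv\<^bsub>HomG C (Dom C f) (Cod C f)\<^esub> f"

definition sub :: "('o, 'm, 'z) precat_scheme \<Rightarrow> 'm \<Rightarrow> 'm \<Rightarrow> 'm" (infixl "\<ominus>\<index>" 65) where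
  "f \<ominus>\<^bsub>C\<^esub> g = f \<oplus>\<^bsub>C\<^esub> neg C g"

section \<open>Differences, zero objects and biproducts\<close>

context additive_category
begin

lemma
  assumes "X \<in> Obj C" "Y \<in> Obj C"
  shows Zero_Hom: "Zero C X Y \<in> Hom C X Y"
    and HomG_closed: "\<And>f g. \<lbrakk>f \<in> Hom C X Y; g \<in> Hom C X Y\<rbrakk> \<Longrightarrow> f \<oplus> g \<in> Hom C X Y"
    and HomG_assoc: "\<And>f g h. \<lbrakk>f \<in> Hom C X Y; g \<in> Hom C X Y; h \<in> Hom C X Y\<rbrakk>
      \<Longrightarrow> f \<oplus> g \<oplus> h = f \<oplus> (g \<oplus> h)"
    and HomG_comm: "\<And>f g. \<lbrakk>f \<in> Hom C X Y; g \<in> Hom C X Y\<rbrakk> \<Longrightarrow> f \<oplus> g = g \<oplus> f"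
    and HomG_zero: "\<And>f. f \<in> Hom C X Y \<Longrightarrow> f \<oplus> Zero C X Y = f"
    and HomG_neg: "\<And>f. f \<in> Hom C X Y \<Longrightarrow> neg C f \<in> Hom C X Y \<and> f \<oplus> neg C f = Zero C X Y"
proof -
  interpret G: comm_group "HomG C X Y"
    using assms by (rule HomG_comm_group)
  show "Zero C X Y \<in> Hom C X Y" using G.one_closed by (simp add: HomG_def)
  show "\<And>f g. \<lbrakk>f \<in> Hom C X Y; g \<in> Hom C X Y\<rbrakk> \<Longrightarrow> f \<oplus> g \<in> Hom C X Y"
    using G.m_closed by (simp add: HomG_def)
  show "\<And>f g h. \<lbrakk>f \<in> Hom C X Y; g \<in> Hom C X Y; h \<in> Hom C X Y\<rbrakk> \<Longrightarrow> f \<oplus> g \<oplus> h = f \<oplus> (g \<oplus> h)"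
    using G.m_assoc by (simp add: HomG_def)
  show "\<And>f g. \<lbrakk>f \<in> Hom C X Y; g \<in> Hom C X Y\<rbrakk> \<Longrightarrow> f \<oplus> g = g \<oplus> f"
    using G.m_comm by (simp add: HomG_def)
  show "\<And>f. f \<in> Hom C X Y \<Longrightarrow> f \<oplus> Zero C X Y = f"
    using G.r_one by (simp add: HomG_def)
  show "neg C f \<in> Hom C X Y \<and> f \<oplus> neg C f = Zero C X Y" if "f \<in> Hom C X Y" for f
    using G.inv_closed[of f] G.r_inv[of f] that
    by (simp add: neg_def HomG_def Hom_Dom[OF that] Hom_Cod[OF that])
qed

lemma Add_Hom: "\<lbrakk>f \<in> Hom C X Y; g \<in> Hom C X Y\<rbrakk> \<Longrightarrow> f \<oplus> g \<in> Hom C X Y"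
  and Add_assoc: "\<lbrakk>f \<in> Hom C X Y; g \<in> Hom C X Y; h \<in> Hom C X Y\<rbrakk> \<Longrightarrow> f \<oplus> g \<oplus> h = f \<oplus> (g \<oplus> h)"
  and Add_commute: "\<lbrakk>f \<in> Hom C X Y; g \<in> Hom C X Y\<rbrakk> \<Longrightarrow> f \<oplus> g = g \<oplus> f"
  and Add_Zero: "f \<in> Hom C X Y \<Longrightarrow> f \<oplus> Zero C X Y = f"
  and neg_Hom: "f \<in> Hom C X Y \<Longrightarrow> neg C f \<in> Hom C X Y"
  and Add_neg: "f \<in> Hom C X Y \<Longrightarrow> f \<oplus> neg C f = Zero C X Y"
  using HomG_closed HomG_assoc HomG_comm HomG_zero HomG_neg Hom_Obj_Dom Hom_Obj_Cod
  by (metis (no_types))+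

lemma Zero_Add: "f \<in> Hom C X Y \<Longrightarrow> Zero C X Y \<oplus> f = f"
  by (metis Add_Zero Add_commute Hom_Obj_Cod Hom_Obj_Dom Zero_Hom)

lemma Add_cancel_left:
  assumes f: "f \<in> Hom C X Y" and g: "g \<in> Hom C X Y" and h: "h \<in> Hom C X Y" and eq: "f \<oplus> g = f \<oplus> h"
  shows "g = h"
proof -
  have "neg C f \<oplus> (f \<oplus> g) = g" if "g \<in> Hom C X Y" for g
    using Add_assoc[OF neg_Hom[OF f] f that] Add_neg[OF f] Add_commute[OF f neg_Hom[OF f]] Zero_Add[OF that]
    by simp
  then show ?thesis
    using g h eq by metis
qed

lemma Zero_unique: "\<lbrakk>f \<in> Hom C X Y; f \<oplus> f = f\<rbrakk> \<Longrightarrow> f = Zero C X Y"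
  by (metis Add_Zero Add_cancel_left Hom_Obj_Cod Hom_Obj_Dom Zero_Hom)

lemma neg_unique: "\<lbrakk>f \<in> Hom C X Y; g \<in> Hom C X Y; f \<oplus> g = Zero C X Y\<rbrakk> \<Longrightarrow> g = neg C f"
  by (metis Add_cancel_left Add_neg neg_Hom)

lemma Comp_Zero_right:
  assumes g: "g \<in> Hom C Y Z" and X: "X \<in> Obj C"
  shows "g \<cdot> Zero C X Y = Zero C X Z"
proof -
  have 0: "Zero C X Y \<in> Hom C X Y"
    using Zero_Hom[OF X Hom_Obj_Dom[OF g]] .
  show ?thesis
    using Zero_unique[OF Comp_Hom[OF 0 g]] Comp_Add_right[OF 0 0 g] Add_Zero[OF 0] by simp
qed

lemma Comp_Zero_left:
  assumes f: "f \<in> Hom C X Y" and Z: "Z \<in> Obj C"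
  shows "Zero C Y Z \<cdot> f = Zero C X Z"
proof -
  have 0: "Zero C Y Z \<in> Hom C Y Z"
    using Zero_Hom[OF Hom_Obj_Cod[OF f] Z] .
  show ?thesis
    using Zero_unique[OF Comp_Hom[OF f 0]] Comp_Add_left[OF f 0 0] Add_Zero[OF 0] by simp
qed

lemma Comp_neg_right:
  assumes f: "f \<in> Hom C X Y" and g: "g \<in> Hom C Y Z"
  shows "g \<cdot> neg C f = neg C (g \<cdot> f)"
  using neg_unique[OF Comp_Hom[OF f g] Comp_Hom[OF neg_Hom[OF f] g]]
    Comp_Add_right[OF f neg_Hom[OF f] g] Add_neg[OF f] Comp_Zero_right[OF g Hom_Obj_Dom[OF f]] by simp

lemma Comp_neg_left:
  assumes f: "f \<in> Hom C X Y" and g: "g \<in> Hom C Y Z"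
  shows "neg C g \<cdot> f = neg C (g \<cdot> f)"
  using neg_unique[OF Comp_Hom[OF f g] Comp_Hom[OF f neg_Hom[OF g]]]
    Comp_Add_left[OF f g neg_Hom[OF g]] Add_neg[OF g] Comp_Zero_left[OF f Hom_Obj_Cod[OF g]] by simp

lemma sub_Hom: "\<lbrakk>f \<in> Hom C X Y; g \<in> Hom C X Y\<rbrakk> \<Longrightarrow> f \<ominus> g \<in> Hom C X Y"
  by (simp add: sub_def Add_Hom neg_Hom)

lemma sub_self: "f \<in> Hom C X Y \<Longrightarrow> f \<ominus> f = Zero C X Y"
  by (simp add: sub_def Add_neg)

lemma sub_Add:
  assumes f: "f \<in> Hom C X Y" and g: "g \<in> Hom C X Y"
  shows "(f \<ominus> g) \<oplus> g = f"
  using Add_assoc[OF f neg_Hom[OF g] g] Add_commute[OF neg_Hom[OF g] g] Add_neg[OF g] Add_Zero[OF f]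
  by (simp add: sub_def)

lemma Add_sub: "\<lbrakk>f \<in> Hom C X Y; g \<in> Hom C X Y\<rbrakk> \<Longrightarrow> (f \<oplus> g) \<ominus> g = f"
  by (metis Add_Hom Add_cancel_left Add_commute sub_Add sub_Hom)

lemma sub_eq_Zero: "\<lbrakk>f \<in> Hom C X Y; g \<in> Hom C X Y; f \<ominus> g = Zero C X Y\<rbrakk> \<Longrightarrow> f = g"
  by (metis Zero_Add sub_Add)

lemma Comp_sub_right:
  "\<lbrakk>f \<in> Hom C X Y; f' \<in> Hom C X Y; g \<in> Hom C Y Z\<rbrakk> \<Longrightarrow> g \<cdot> (f \<ominus> f') = (g \<cdot> f) \<ominus> (g \<cdot> f')"
  by (simp add: sub_def Comp_Add_right Comp_neg_right neg_Hom)

lemma Comp_sub_left: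
  "\<lbrakk>f \<in> Hom C X Y; g \<in> Hom C Y Z; g' \<in> Hom C Y Z\<rbrakk> \<Longrightarrow> (g \<ominus> g') \<cdot> f = (g \<cdot> f) \<ominus> (g' \<cdot> f)"
  by (simp add: sub_def Comp_Add_left Comp_neg_left neg_Hom)

lemma zero_object_iff: "is_zero_object C Z \<longleftrightarrow> Z \<in> Obj C \<and> Ident C Z = Zero C Z Z"
proof
  assume "is_zero_object C Z"
  then show "Z \<in> Obj C \<and> Ident C Z = Zero C Z Z"
    unfolding is_zero_object_def using Ident_Hom Zero_Hom by metis
next
  assume Z: "Z \<in> Obj C \<and> Ident C Z = Zero C Z Z"
  have "f = Zero C X Z" if "f \<in> Hom C X Z" for f X
    by (metis Comp_Ident_left Comp_Zero_left Z that)
  moreover have "f = Zero C Z X" if "f \<in> Hom C Z X" for f X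
    by (metis Comp_Ident_right Comp_Zero_right Z that)
  ultimately show "is_zero_object C Z"
    unfolding is_zero_object_def using Z Zero_Hom by metis
qed

lemma zero_object_Hom_to: "\<lbrakk>is_zero_object C Z; f \<in> Hom C X Z\<rbrakk> \<Longrightarrow> f = Zero C X Z"
  by (metis Comp_Ident_left Comp_Zero_left zero_object_iff)

lemma zero_object_Hom_from: "\<lbrakk>is_zero_object C Z; f \<in> Hom C Z X\<rbrakk> \<Longrightarrow> f = Zero C Z X"
  by (metis Comp_Ident_right Comp_Zero_right zero_object_iff)

lemma Comp_zero_object:
  assumes "is_zero_object C Z" "f \<in> Hom C X Z" "g \<in> Hom C Z Y"
  shows "g \<cdot> f = Zero C X Y"
  by (metis Comp_Zero_right Hom_Obj_Dom assms zero_object_Hom_to)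

lemma zero_object_retract:
  assumes Z: "is_zero_object C Z" and f: "f \<in> Hom C X Z" and g: "g \<in> Hom C Z X"
    and "g \<cdot> f = Ident C X"
  shows "is_zero_object C X"
  using assms Comp_zero_object Hom_Obj_Dom zero_object_iff by metis

lemma zero_object_isomorphic:
  assumes "is_zero_object C Z" "isomorphic C X Z"
  shows "is_zero_object C X"
  using assms(2) unfolding isomorphic_def
  using zero_object_retract[OF assms(1)] isomorphismE by metis

lemma biproduct_D:
  assumes "biproduct C X Y S i1 i2 p1 p2"
  shows "i1 \<in> Hom C X S" "i2 \<in> Hom C Y S" "p1 \<in> Hom C S X" "p2 \<in> Hom C S Y"
    "p1 \<cdot> i1 = Ident C X" "p2 \<cdot> i2 = Ident C Y" "p1 \<cdot> i2 = Zero C Y X" "p2 \<cdot> i1 = Zero C X Y"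
    "(i1 \<cdot> p1) \<oplus> (i2 \<cdot> p2) = Ident C S"
  using assms unfolding biproduct_def by blast+

lemma biproduct_zero_right:
  assumes "X \<in> Obj C" "is_zero_object C Z"
  shows "biproduct C X Z X (Ident C X) (Zero C Z X) (Ident C X) (Zero C X Z)"
proof -
  have Z: "Z \<in> Obj C" "Ident C Z = Zero C Z Z"
    using assms(2) zero_object_iff by blast+
  note Hom = Ident_Hom[OF assms(1)] Zero_Hom[OF Z(1) assms(1)] Zero_Hom[OF assms(1) Z(1)] 
  show ?thesis
    unfolding biproduct_def using assms(1) Z Hom
    by (simp add: Comp_Ident_left[OF Hom(1)] Comp_Ident_left[OF Hom(2)] Comp_Ident_right[OF Hom(3)]
        Comp_Zero_left[OF Hom(2) Z(1)] Comp_Zero_left[OF Hom(3) assms(1)] Add_Zero)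
qed

lemma biproduct_commute:
  assumes "biproduct C X Y S i1 i2 p1 p2"
  shows "biproduct C Y X S i2 i1 p2 p1"
  using assms Add_commute Comp_Hom unfolding biproduct_def by metis

lemma biproduct_zero_left:
  assumes "X \<in> Obj C" "is_zero_object C Z"
  shows "biproduct C Z X X (Zero C Z X) (Ident C X) (Zero C X Z) (Ident C X)"
  using assms biproduct_commute biproduct_zero_right by blast

end

text \<open>A relation instead of an operation, so that it also covers \<open>opp\<close>, whose values are extriangulated
  structures, and the quotients of opposite categories.\<close>

definition opposite :: "('o, 'm, 'z) precat_scheme \<Rightarrow> ('o, 'm, 'y) precat_scheme \<Rightarrow> bool" where
  "opposite K L \<longleftrightarrow> Obj L = Obj K \<and> Arr L = Arr K \<and> Dom L = Cod K \<and> Cod L = Dom K \<and>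
     Ident L = Ident K \<and> Comp L = (\<lambda>g f. f \<cdot>\<^bsub>K\<^esub> g) \<and> Add L = Add K \<and> Zero L = (\<lambda>X Y. Zero K Y X)"

lemma opposite_simps:
  assumes "opposite K L"
  shows "Obj L = Obj K" "Arr L = Arr K" "Dom L = Cod K" "Cod L = Dom K" "Ident L = Ident K"
    "Comp L = (\<lambda>g f. f \<cdot>\<^bsub>K\<^esub> g)" "Add L = Add K" "Zero L = (\<lambda>X Y. Zero K Y X)"
    "Hom L = (\<lambda>X Y. Hom K Y X)"
  using assms by (auto simp: opposite_def Hom_def fun_eq_iff)

lemma opposite_opp: "opposite K (opp K)"
  by (simp add: opposite_def opp_def)

lemma category_opposite:
  assumes "opposite K L" "category K"
  shows "category L"
proof -
  interpret category K by fact
  show ?thesis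
    unfolding category_def opposite_simps[OF assms(1)]
    using Dom_Obj Cod_Obj Ident_Hom Comp_Hom Comp_Ident_right Comp_Ident_left Comp_assoc by auto
qed

lemma isomorphism_opposite:
  assumes "opposite K L"
  shows "is_isomorphism L f \<longleftrightarrow> is_isomorphism K f"
  unfolding is_isomorphism_def opposite_simps[OF assms] by auto

lemma isomorphic_opposite:
  assumes "opposite K L" "category K"
  shows "isomorphic L X Y \<longleftrightarrow> isomorphic K X Y"
  using category.isomorphic_sym[OF assms(2)] isomorphism_opposite[OF assms(1)] opposite_simps(9)[OF assms(1)]
  unfolding isomorphic_def by metis

lemma zero_object_opposite:
  assumes "opposite K L"
  shows "is_zero_object L Z \<longleftrightarrow> is_zero_object K Z"
  unfolding is_zero_object_def opposite_simps[OF assms] by blast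

lemma biproduct_opposite:
  assumes "opposite K L"
  shows "biproduct L X Y S i1 i2 p1 p2 \<longleftrightarrow> biproduct K X Y S p1 p2 i1 i2"
  unfolding biproduct_def opposite_simps[OF assms] by blast

lemma additive_category_opposite:
  assumes "opposite K L" "additive_category K"
  shows "additive_category L"
proof -
  interpret additive_category K by fact
  have *: "HomG L X Y = HomG K Y X" for X Y
    unfolding HomG_def opposite_simps[OF assms(1)] ..
  interpret L: category L
    using assms(1) category_axioms by (rule category_opposite)
  show ?thesis
  proof (intro additive_category.intro additive_category_axioms.intro L.category_axioms)
    show "\<exists>Z. is_zero_object L Z"
      using ex_zero_object zero_object_opposite[OF assms(1)] by blast
    show "\<exists>S i1 i2 p1 p2. biproduct L X Y S i1 i2 p1 p2" if "X \<in> Obj L" "Y \<in> Obj L" for X Y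
      using ex_biproduct[of X Y] that biproduct_opposite[OF assms(1)] opposite_simps(1)[OF assms(1)] by metis
  qed (auto simp: opposite_simps[OF assms(1)] * intro: HomG_comm_group Comp_Add_left Comp_Add_right)
qed

lemma mono_opposite:
  assumes "opposite K L"
  shows "is_mono L f \<longleftrightarrow> is_epi K f"
  unfolding is_mono_def is_epi_def opposite_simps[OF assms] ..

lemma epi_opposite:
  assumes "opposite K L"
  shows "is_epi L f \<longleftrightarrow> is_mono K f"
  unfolding is_mono_def is_epi_def opposite_simps[OF assms] ..

lemma kernel_opposite:
  assumes "opposite K L"
  shows "is_kernel L k f \<longleftrightarrow> is_cokernel K k f"
  unfolding is_kernel_def is_cokernel_def opposite_simps[OF assms] by auto

lemma cokernel_opposite:
  assumes "opposite K L"
  shows "is_cokernel L k f \<longleftrightarrow> is_kernel K k f"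
  unfolding is_kernel_def is_cokernel_def opposite_simps[OF assms] by auto

lemma is_functor_opposite:
  assumes "opposite C C'" "opposite D D'"
  shows "is_functor C' D' F \<longleftrightarrow> is_functor C D F"
  unfolding is_functor_def opposite_simps[OF assms(1)] opposite_simps[OF assms(2)]
  by (rule arg_cong2[where f = "(\<and>)"], blast, rule arg_cong2[where f = "(\<and>)"], blast, metis)

lemma additive_functor_opposite:
  assumes "opposite C C'" "opposite D D'"
  shows "additive_functor C' D' F \<longleftrightarrow> additive_functor C D F"
proof -
  have "HomG C' X Y = HomG C Y X" "HomG D' U V = HomG D V U" for X Y U V
    unfolding HomG_def opposite_simps[OF assms(1)] opposite_simps[OF assms(2)] by auto
  then show ?thesis
    unfolding additive_functor_def is_functor_opposite[OF assms] opposite_simps(1)[OF assms(1)] by auto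
qed

lemma fully_faithful_opposite:
  assumes "opposite C C'" "opposite D D'"
  shows "fully_faithful C' D' F \<longleftrightarrow> fully_faithful C D F"
  unfolding fully_faithful_def opposite_simps[OF assms(1)] opposite_simps[OF assms(2)] by blast

lemma adjunction_opposite:
  assumes "opposite C C'" "opposite D D'" "adjunction C D F G \<eta> \<epsilon>"
  shows "adjunction D' C' G F \<epsilon> \<eta>"
  using assms(3)
  unfolding adjunction_def is_functor_opposite[OF assms(1,2)] is_functor_opposite[OF assms(2,1)]
    opposite_simps[OF assms(1)] opposite_simps[OF assms(2)] by simp

section \<open>Exact sequences of an extriangulated category\<close>

lemma opp_simps [simp]:
  "Ext (opp K) = (\<lambda>C A. Ext K A C)" "EAct (opp K) = (\<lambda>c a. EAct K a c)"
  "Real (opp K) = (\<lambda>C A \<delta>. {(y, x). (x, y) \<in> Real K A C \<delta>})"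
  by (simp_all add: opp_def)

lemma opp_opp [simp]: "opp (opp K) = K"
  by (simp add: opp_def)

lemma push_opp [simp]: "push (opp K) = pull K"
  and pull_opp [simp]: "pull (opp K) = push K"
  by (simp_all add: push_def pull_def fun_eq_iff opposite_simps[OF opposite_opp])

lemma etriangle_opp [simp]: "etriangle (opp K) A C \<delta> x y \<longleftrightarrow> etriangle K C A \<delta> y x"
  by (auto simp: etriangle_def opposite_simps[OF opposite_opp])

section \<open>Extensions as a bifunctor, and lifting along triangles\<close>

context extriangulated_category
begin

lemma pull_closed:
  "\<lbrakk>c \<in> Hom K C' C; A \<in> Obj K; \<delta> \<in> carrier (Ext K C A)\<rbrakk> \<Longrightarrow> pull K A c \<delta> \<in> carrier (Ext K C' A)"
  unfolding pull_def using EAct_hom[OF _ Ident_Hom] by (rule hom_in_carrier)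

lemma push_closed:
  "\<lbrakk>a \<in> Hom K A A'; C \<in> Obj K; \<delta> \<in> carrier (Ext K C A)\<rbrakk> \<Longrightarrow> push K C a \<delta> \<in> carrier (Ext K C A')"
  unfolding push_def using EAct_hom[OF Ident_Hom] by (rule hom_in_carrier)

lemma pull_Comp:
  assumes "c \<in> Hom K C' C" "c' \<in> Hom K C'' C'" "A \<in> Obj K" "\<delta> \<in> carrier (Ext K C A)"
  shows "pull K A (c \<cdot> c') \<delta> = pull K A c' (pull K A c \<delta>)"
  using EAct_Comp[OF assms(1,2) Ident_Hom[OF assms(3)] Ident_Hom[OF assms(3)] assms(4)]
    Comp_Ident_left[OF Ident_Hom[OF assms(3)]]
  by (simp add: pull_def)

lemma push_Comp:
  assumes "a \<in> Hom K A A'" "a' \<in> Hom K A' A''" "C \<in> Obj K" "\<delta> \<in> carrier (Ext K C A)"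
  shows "push K C (a' \<cdot> a) \<delta> = push K C a' (push K C a \<delta>)"
  using EAct_Comp[OF Ident_Hom[OF assms(3)] Ident_Hom[OF assms(3)] assms(1,2,4)]
    Comp_Ident_left[OF Ident_Hom[OF assms(3)]]
  by (simp add: push_def)

lemma pull_push:
  assumes c: "c \<in> Hom K C' C" and a: "a \<in> Hom K A A'" and "\<delta> \<in> carrier (Ext K C A)"
  shows "pull K A' c (push K C a \<delta>) = push K C' a (pull K A c \<delta>)"
  unfolding pull_def push_def
  using EAct_Comp[OF Ident_Hom[OF Hom_Obj_Cod[OF c]] c a Ident_Hom[OF Hom_Obj_Cod[OF a]] assms(3)]
    EAct_Comp[OF c Ident_Hom[OF Hom_Obj_Dom[OF c]] Ident_Hom[OF Hom_Obj_Dom[OF a]] a assms(3)]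
    Comp_Ident_left[OF c] Comp_Ident_right[OF c] Comp_Ident_left[OF a] Comp_Ident_right[OF a]
  by simp

lemma pull_Ident: "\<lbrakk>C \<in> Obj K; A \<in> Obj K; \<delta> \<in> carrier (Ext K C A)\<rbrakk> \<Longrightarrow> pull K A (Ident K C) \<delta> = \<delta>"
  and push_Ident: "\<lbrakk>C \<in> Obj K; A \<in> Obj K; \<delta> \<in> carrier (Ext K C A)\<rbrakk> \<Longrightarrow> push K C (Ident K A) \<delta> = \<delta>"
  unfolding pull_def push_def by (rule EAct_Ident; assumption)+

lemma one_closed: "\<lbrakk>C \<in> Obj K; A \<in> Obj K\<rbrakk> \<Longrightarrow> \<one>\<^bsub>Ext K C A\<^esub> \<in> carrier (Ext K C A)"
  by (meson Ext_comm_group comm_group.axioms(2) group.is_monoid monoid.one_closed)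

lemma EAct_one:
  assumes "c \<in> Hom K C' C" "a \<in> Hom K A A'"
  shows "EAct K c a \<one>\<^bsub>Ext K C A\<^esub> = \<one>\<^bsub>Ext K C' A'\<^esub>"
  using EAct_hom[OF assms] Ext_comm_group Hom_Obj_Cod Hom_Obj_Dom assms
  by (meson comm_group.axioms(2) hom_one)

lemma pull_one: "\<lbrakk>c \<in> Hom K C' C; A \<in> Obj K\<rbrakk> \<Longrightarrow> pull K A c \<one>\<^bsub>Ext K C A\<^esub> = \<one>\<^bsub>Ext K C' A\<^esub>"
  unfolding pull_def by (rule EAct_one[OF _ Ident_Hom])

lemma push_one: "\<lbrakk>a \<in> Hom K A A'; C \<in> Obj K\<rbrakk> \<Longrightarrow> push K C a \<one>\<^bsub>Ext K C A\<^esub> = \<one>\<^bsub>Ext K C A'\<^esub>"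
  unfolding push_def by (rule EAct_one[OF Ident_Hom])

lemma Ext_idempotent:
  assumes "C \<in> Obj K" "A \<in> Obj K" "\<delta> \<in> carrier (Ext K C A)" "\<delta> = \<delta> \<otimes>\<^bsub>Ext K C A\<^esub> \<delta>"
  shows "\<delta> = \<one>\<^bsub>Ext K C A\<^esub>"
proof -
  interpret G: comm_group "Ext K C A"
    using assms(1,2) by (rule Ext_comm_group)
  show ?thesis
    using assms(3,4) G.l_cancel_one by metis
qed

text \<open>Since 0 + 0 = 0, the pushforward is idempotent in the group of extensions.\<close>

lemma push_Zero:
  assumes "A \<in> Obj K" "A' \<in> Obj K" "C \<in> Obj K" "\<delta> \<in> carrier (Ext K C A)"
  shows "push K C (Zero K A A') \<delta> = \<one>\<^bsub>Ext K C A'\<^esub>"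
  using Ext_idempotent[OF assms(3,2) push_closed[OF Zero_Hom[OF assms(1,2)] assms(3,4)]]
    EAct_Add_right[OF Ident_Hom[OF assms(3)] Zero_Hom[OF assms(1,2)] Zero_Hom[OF assms(1,2)] assms(4)]
    Add_Zero[OF Zero_Hom[OF assms(1,2)]]
  by (simp add: push_def)

lemma Ext_zero_right:
  "\<lbrakk>is_zero_object K A; C \<in> Obj K; \<delta> \<in> carrier (Ext K C A)\<rbrakk> \<Longrightarrow> \<delta> = \<one>\<^bsub>Ext K C A\<^esub>"
  by (metis push_Ident push_Zero zero_object_iff)

lemma Real_sequence:
  assumes "C \<in> Obj K" "A \<in> Obj K" "\<delta> \<in> carrier (Ext K C A)" "(x, y) \<in> Real K C A \<delta>"
  shows "is_sequence K A C x y"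
  using Real_class[OF assms(1-3)] assms(4) by (auto simp: seq_class_def)

lemma seq_class_self:
  assumes "is_sequence K A C x y"
  shows "(x, y) \<in> seq_class K A C x y"
proof -
  have x: "x \<in> Hom K A (Cod K x)" and y: "y \<in> Hom K (Cod K x) C"
    using assms by (auto simp: is_sequence_def Hom_def)
  show ?thesis
    unfolding seq_class_def
    using assms Ident_Hom isomorphism_Ident Hom_Obj_Cod[OF x] Comp_Ident_left[OF x] Comp_Ident_right[OF y]
    by blast
qed

lemma etriangleE:
  assumes "etriangle K A C \<delta> x y"
  obtains B where "x \<in> Hom K A B" "y \<in> Hom K B C" "A \<in> Obj K" "B \<in> Obj K" "C \<in> Obj K"
    "\<delta> \<in> carrier (Ext K C A)" "(x, y) \<in> Real K C A \<delta>"
proof (rule that[of "Cod K x"])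
  show x: "x \<in> Hom K A (Cod K x)" and "y \<in> Hom K (Cod K x) C"
    using assms Real_sequence[of C A \<delta> x y] by (auto simp: etriangle_def is_sequence_def Hom_def)
  show "Cod K x \<in> Obj K"
    using Hom_Obj_Cod[OF x] .
qed (use assms in \<open>auto simp: etriangle_def\<close>)

lemma etriangle_D:
  assumes "etriangle K A C \<delta> x y" "x \<in> Hom K A' B \<or> y \<in> Hom K B C'"
  shows "x \<in> Hom K A B" "y \<in> Hom K B C" "A \<in> Obj K" "B \<in> Obj K" "C \<in> Obj K" "\<delta> \<in> carrier (Ext K C A)"
    "(x, y) \<in> Real K C A \<delta>"
  using assms(2) etriangleE[OF assms(1)] Hom_Cod Hom_Dom by metis+

lemma etriangle_ex:
  "\<lbrakk>C \<in> Obj K; A \<in> Obj K; \<delta> \<in> carrier (Ext K C A)\<rbrakk> \<Longrightarrow> \<exists>x y. etriangle K A C \<delta> x y"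
  unfolding etriangle_def using Real_class seq_class_self by metis

lemma etriangle_split:
  assumes "biproduct K A C S i1 i2 p1 p2"
  shows "etriangle K A C \<one>\<^bsub>Ext K C A\<^esub> i1 p2"
proof -
  note b = biproduct_D[OF assms]
  have "is_sequence K A C i1 p2"
    using b(1,4) by (auto simp: is_sequence_def Hom_def)
  then show ?thesis
    unfolding etriangle_def using Real_zero[OF assms] seq_class_self one_closed b(1,4) Hom_Obj_Dom Hom_Obj_Cod
    by metis
qed

lemma ext_morphismI:
  "\<lbrakk>\<delta> \<in> carrier (Ext K C A); \<delta>' \<in> carrier (Ext K C' A'); a \<in> Hom K A A'; c \<in> Hom K C C';
    push K C a \<delta> = pull K A' c \<delta>'\<rbrakk> \<Longrightarrow> ext_morphism K C A \<delta> C' A' \<delta>' a c"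
  by (simp add: ext_morphism_def)

lemma ET3_rule:
  assumes "etriangle K A C \<delta> x y" "etriangle K A' C' \<delta>' x' y'"
    "x \<in> Hom K A B" "x' \<in> Hom K A' B'" "a \<in> Hom K A A'" "b \<in> Hom K B B'" "b \<cdot> x = x' \<cdot> a"
  obtains c where "c \<in> Hom K C C'" "c \<cdot> y = y' \<cdot> b" "push K C a \<delta> = pull K A' c \<delta>'"
proof -
  have "b \<in> Hom K (Cod K x) (Cod K x')"
    using assms Hom_Cod by metis
  then show ?thesis
    using ET3[unfolded ET3_def] assms that by metis
qed

lemma ET4_rule:
  assumes "etriangle K A D \<delta> f f'" "etriangle K B F \<delta>' g g'" "f \<in> Hom K A B" "g \<in> Hom K B C"
  obtains E h' d e \<delta>'' where "E \<in> Obj K" "h' \<in> Hom K C E" "d \<in> Hom K D E" "e \<in> Hom K E F"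
    "etriangle K A E \<delta>'' (g \<cdot> f) h'" "d \<cdot> f' = h' \<cdot> g" "e \<cdot> h' = g'"
    "etriangle K D F (push K F f' \<delta>') d e" "pull K A d \<delta>'' = \<delta>"
proof -
  have f: "Cod K f = B" and g: "Cod K g = C"
    using Hom_Cod assms(3,4) by auto
  have "\<exists>E \<in> Obj K. \<exists>h' \<in> Hom K (Cod K g) E. \<exists>d \<in> Hom K D E. \<exists>e \<in> Hom K E F.
      \<exists>\<delta>'' \<in> carrier (Ext K E A).
        etriangle K A E \<delta>'' (g \<cdot> f) h' \<and>
        d \<cdot> f' = h' \<cdot> g \<and> e \<cdot> h' = g' \<and>
        etriangle K D F (push K F f' \<delta>') d e \<and>
        pull K A d \<delta>'' = \<delta> \<and> push K E f \<delta>'' = pull K B e \<delta>'"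
    using ET4[unfolded ET4_def] assms(1,2) f by blast
  then show ?thesis
    unfolding g using that by blast
qed

text \<open>The hypothesis makes the identity of \<open>A\<close> and \<open>c\<close> a morphism
  from the split extension of \<open>W\<close> by \<open>A\<close> to \<delta>. The realization
  supplies a map from the biproduct to \<open>B\<close>, and its restriction to \<open>W\<close> is
  the lift.\<close>

lemma lift_through_deflation:
  assumes tri: "etriangle K A C \<delta> x y" and y: "y \<in> Hom K B C" and c: "c \<in> Hom K W C"
    and "pull K A c \<delta> = \<one>\<^bsub>Ext K W A\<^esub>"
  obtains b where "b \<in> Hom K W B" "y \<cdot> b = c"
proof -
  note t = etriangle_D[OF tri disjI2[OF y]] and W = Hom_Obj_Dom[OF c]
  obtain S i1 i2 p1 p2 where bip: "biproduct K A W S i1 i2 p1 p2"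
    using ex_biproduct[OF t(3) W] by blast
  note s = biproduct_D[OF bip]
  have "push K W (Ident K A) \<one>\<^bsub>Ext K W A\<^esub> = pull K A c \<delta>"
    using push_one[OF Ident_Hom[OF t(3)] W] assms(4) by simp
  then have "ext_morphism K W A \<one>\<^bsub>Ext K W A\<^esub> C A \<delta> (Ident K A) c"
    using ext_morphismI one_closed[OF W t(3)] t(6) Ident_Hom[OF t(3)] c by blast
  then have "\<exists>b \<in> Hom K (Cod K i1) (Cod K x). b \<cdot> i1 = x \<cdot> Ident K A \<and> y \<cdot> b = c \<cdot> p2"
    using Real_morphism t(7) etriangle_split[OF bip, unfolded etriangle_def] by blast
  then obtain b where b: "b \<in> Hom K S B" "y \<cdot> b = c \<cdot> p2"
    using Hom_Cod[OF s(1)] Hom_Cod[OF t(1)] by auto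
  have "y \<cdot> (b \<cdot> i2) = c \<cdot> (p2 \<cdot> i2)"
    using Comp_assoc[OF s(2) b(1) y] Comp_assoc[OF s(2,4) c] b(2) by simp
  then show ?thesis
    using that[OF Comp_Hom[OF s(2) b(1)]] s(6) Comp_Ident_right[OF c] by simp
qed

text \<open>By (ET3), \<open>x\<close> and the identity of \<open>B\<close> extend to a morphism
  into the split triangle B -> B -> 0, so the pushforward is a pullback of an extension of a zero
  object.\<close>

lemma push_inflation:
  assumes tri: "etriangle K A C \<delta> x y" and x: "x \<in> Hom K A B"
  shows "push K C x \<delta> = \<one>\<^bsub>Ext K C B\<^esub>"
proof -
  note t = etriangle_D[OF tri disjI1[OF x]]
  obtain Z where Z: "is_zero_object K Z"
    using ex_zero_object by blast
  then have ZO: "Z \<in> Obj K" using zero_object_iff by blast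
  obtain c where "c \<in> Hom K C Z" "push K C x \<delta> = pull K B c \<one>\<^bsub>Ext K Z B\<^esub>"
    using ET3_rule[OF tri etriangle_split[OF biproduct_zero_right[OF t(4) Z]] x Ident_Hom[OF t(4)] x
        Ident_Hom[OF t(4)]] by blast
  then show ?thesis
    using pull_one[OF _ t(4)] by metis
qed

text \<open>(ET3) applied to A -> A -> 0 and the given triangle factors the composite through a zero
  object.\<close>

lemma deflation_inflation_Zero:
  assumes tri: "etriangle K A C \<delta> x y" and x: "x \<in> Hom K A B"
  shows "y \<cdot> x = Zero K A C"
proof -
  note t = etriangle_D[OF tri disjI1[OF x]]
  obtain Z where Z: "is_zero_object K Z"
    using ex_zero_object by blast
  obtain c where "c \<in> Hom K Z C" "c \<cdot> Zero K A Z = y \<cdot> x"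
    using ET3_rule[OF etriangle_split[OF biproduct_zero_right[OF t(3) Z]] tri Ident_Hom[OF t(3)] x
        Ident_Hom[OF t(3)] x] by metis
  then show ?thesis
    using Comp_Zero_right[OF _ t(3)] by metis
qed

text \<open>A map that kills \<open>x\<close> gives a commuting square into the split triangle 0 ->
  W -> W, and (ET3) produces the map on third terms.\<close>

lemma factor_through_deflation:
  assumes tri: "etriangle K A C \<delta> x y" and x: "x \<in> Hom K A B" and w: "w \<in> Hom K B W"
    and "w \<cdot> x = Zero K A W"
  obtains w' where "w' \<in> Hom K C W" "w' \<cdot> y = w"
proof -
  note t = etriangle_D[OF tri disjI1[OF x]] and W = Hom_Obj_Cod[OF w]
  obtain Z where Z: "is_zero_object K Z"
    using ex_zero_object by blast
  then have ZO: "Z \<in> Obj K" using zero_object_iff by blast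
  have "w \<cdot> x = Zero K Z W \<cdot> Zero K A Z"
    using assms(4) Comp_Zero_right[OF Zero_Hom[OF ZO W] t(3)] by simp
  then obtain c where "c \<in> Hom K C W" "c \<cdot> y = Ident K W \<cdot> w"
    using ET3_rule[OF tri etriangle_split[OF biproduct_zero_left[OF W Z]] x Zero_Hom[OF ZO W]
        Zero_Hom[OF t(3) ZO] w] by metis
  then show ?thesis
    using that Comp_Ident_left[OF w] by metis
qed

end

text \<open>Reversal turns the isomorphism between the middle terms around, so its inverse is the
  witness in each direction.\<close>

lemma seq_class_opp:
  assumes "category K" "is_sequence K A C x y"
  shows "seq_class (opp K) C A y x = {(y', x'). (x', y') \<in> seq_class K A C x y}"
proof -
  interpret category K by fact
  note o = opposite_simps[OF opposite_opp[of K]]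
  have "(\<exists>b \<in> Hom K (Dom K y') (Dom K y). is_isomorphism K b \<and> y \<cdot>\<^bsub>K\<^esub> b = y' \<and> b \<cdot>\<^bsub>K\<^esub> x' = x) \<longleftrightarrow>
      (\<exists>b \<in> Hom K (Cod K x) (Cod K x'). is_isomorphism K b \<and> b \<cdot>\<^bsub>K\<^esub> x = x' \<and> y' \<cdot>\<^bsub>K\<^esub> b = y)"
    (is "?L \<longleftrightarrow> ?R") if "is_sequence K A C x' y'" for x' y'
  proof -
    define B B' where "B = Cod K x" and "B' = Cod K x'"
    have s: "x \<in> Hom K A B" "y \<in> Hom K B C" "x' \<in> Hom K A B'" "y' \<in> Hom K B' C"
      using assms(2) that by (auto simp: is_sequence_def Hom_def B_def B'_def)
    have BB: "Dom K y = B" "Dom K y' = B'" "Cod K x = B" "Cod K x' = B'"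
      using s by (auto simp: Hom_def)
    show ?thesis
    proof
      assume ?L
      then obtain b where b: "b \<in> Hom K B' B" "is_isomorphism K b" "y \<cdot>\<^bsub>K\<^esub> b = y'" "b \<cdot>\<^bsub>K\<^esub> x' = x"
        unfolding BB by blast
      then obtain g where g: "g \<in> Hom K B B'" "g \<cdot>\<^bsub>K\<^esub> b = Ident K B'" "b \<cdot>\<^bsub>K\<^esub> g = Ident K B" "is_isomorphism K g"
        using isomorphismE by blast
      have "g \<cdot>\<^bsub>K\<^esub> x = x'"
        using Comp_assoc[OF s(3) b(1) g(1)] g(2) Comp_Ident_left[OF s(3)] b(4) by simp
      moreover have "y' \<cdot>\<^bsub>K\<^esub> g = y"
        using Comp_assoc[OF g(1) b(1) s(2)] g(3) Comp_Ident_right[OF s(2)] b(3) by simp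
      ultimately show ?R
        unfolding BB using g by blast
    next
      assume ?R
      then obtain b where b: "b \<in> Hom K B B'" "is_isomorphism K b" "y' \<cdot>\<^bsub>K\<^esub> b = y" "b \<cdot>\<^bsub>K\<^esub> x = x'"
        unfolding BB by blast
      then obtain g where g: "g \<in> Hom K B' B" "g \<cdot>\<^bsub>K\<^esub> b = Ident K B" "b \<cdot>\<^bsub>K\<^esub> g = Ident K B'" "is_isomorphism K g"
        using isomorphismE by blast
      have "g \<cdot>\<^bsub>K\<^esub> x' = x"
        using Comp_assoc[OF s(1) b(1) g(1)] g(2) Comp_Ident_left[OF s(1)] b(4) by simp
      moreover have "y \<cdot>\<^bsub>K\<^esub> g = y'"
        using Comp_assoc[OF g(1) b(1) s(4)] g(3) Comp_Ident_right[OF s(4)] b(3) by simp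
      ultimately show ?L
        unfolding BB using g by blast
    qed
  qed
  moreover have "is_sequence (opp K) C A y' x' \<longleftrightarrow> is_sequence K A C x' y'" for x' y'
    by (auto simp: is_sequence_def o)
  ultimately show ?thesis
    unfolding seq_class_def o isomorphism_opposite[OF opposite_opp[of K]] by auto
qed

lemma direct_sum_arr_opp:
  assumes "category K" "p1 \<in> Hom K S X" "p2 \<in> Hom K S X'" "f \<in> Hom K X Y" "f' \<in> Hom K X' Y'"
    "i1 \<in> Hom K Y U" "i2 \<in> Hom K Y' U"
  shows "direct_sum_arr (opp K) i1 i2 p1 p2 f f' = direct_sum_arr K p1 p2 i1 i2 f f'"
proof -
  interpret category K by fact
  show ?thesis
    by (simp add: direct_sum_arr_def opposite_simps[OF opposite_opp]
        Comp_assoc[OF assms(2,4,6)] Comp_assoc[OF assms(3,5,7)])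
qed

text \<open>(ET3) and (ET4) come paired with their duals; the other axioms are self-dual up to the
  bracketing of composites and the direction of the middle isomorphism. All later dual statements
  rest on this.\<close>

lemma extriangulated_category_opp:
  assumes "extriangulated_category K"
  shows "extriangulated_category (opp K)"
proof -
  interpret extriangulated_category K by fact
  note o = opposite_simps[OF opposite_opp[of K]]
  interpret L: additive_category "opp K"
    using additive_category_opposite[OF opposite_opp additive_category_axioms] .
  show ?thesis
  proof (intro extriangulated_category.intro extriangulated_category_axioms.intro L.additive_category_axioms)
    show "ET3 (opp K)" "ET3 (opp (opp K))" "ET4 (opp K)" "ET4 (opp (opp K))"
      using ET3 ET3_op ET4 ET4_op by simp_all
    show "\<exists>x y. is_sequence (opp K) A C x y \<and> Real (opp K) C A \<delta> = seq_class (opp K) A C x y"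
      if d: "C \<in> Obj (opp K)" "A \<in> Obj (opp K)" "\<delta> \<in> carrier (Ext (opp K) C A)" for C A \<delta>
    proof -
      obtain x y where xy: "is_sequence K C A x y" "Real K A C \<delta> = seq_class K C A x y"
        using Real_class d unfolding o opp_simps by blast
      have "is_sequence (opp K) A C y x"
        using xy(1) by (auto simp: is_sequence_def o)
      then show ?thesis
        using seq_class_opp[OF category_axioms xy(1)] xy(2) unfolding opp_simps by metis
    qed
    show "\<exists>b \<in> Hom (opp K) (Cod (opp K) x) (Cod (opp K) x').
          b \<cdot>\<^bsub>opp K\<^esub> x = x' \<cdot>\<^bsub>opp K\<^esub> a \<and> y' \<cdot>\<^bsub>opp K\<^esub> b = c \<cdot>\<^bsub>opp K\<^esub> y"
      if "ext_morphism (opp K) C A \<delta> C' A' \<delta>' a c" "(x, y) \<in> Real (opp K) C A \<delta>" "(x', y') \<in> Real (opp K) C' A' \<delta>'"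
      for C A \<delta> C' A' \<delta>' a c x y x' y'
    proof -
      have m: "ext_morphism K A' C' \<delta>' A C \<delta> c a" and r: "(y, x) \<in> Real K A C \<delta>" "(y', x') \<in> Real K A' C' \<delta>'"
        using that by (auto simp: ext_morphism_def o)
      have s: "is_sequence K C A y x" "is_sequence K C' A' y' x'"
        using Real_sequence r m Hom_Obj_Dom Hom_Obj_Cod unfolding ext_morphism_def by metis+
      show ?thesis
        using Real_morphism[OF m r(2,1)] s unfolding o is_sequence_def by fastforce
    qed
    show "Real (opp K) C A \<one>\<^bsub>Ext (opp K) C A\<^esub> = seq_class (opp K) A C i1 p2"
      if "biproduct (opp K) A C S i1 i2 p1 p2" for A C S i1 i2 p1 p2
    proof -
      have bip: "biproduct K C A S p2 p1 i2 i1"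
        using L.biproduct_commute[OF that] by (simp add: biproduct_opposite[OF opposite_opp])
      have "is_sequence K C A p2 i1"
        using biproduct_D(1,4)[OF bip] by (auto simp: is_sequence_def Hom_def)
      then show ?thesis
        using Real_zero[OF bip] seq_class_opp[OF category_axioms] by simp
    qed
    show "Real (opp K) SC SA (EAct (opp K) pC iA \<delta> \<otimes>\<^bsub>Ext (opp K) SC SA\<^esub> EAct (opp K) pC' iA' \<delta>') =
          seq_class (opp K) SA SC (direct_sum_arr (opp K) pA pA' iB iB' x x')
            (direct_sum_arr (opp K) pB pB' iC iC' y y')"
      if t: "etriangle (opp K) A C \<delta> x y" "etriangle (opp K) A' C' \<delta>' x' y'"
        and b: "biproduct (opp K) A A' SA iA iA' pA pA'"
          "biproduct (opp K) (Cod (opp K) x) (Cod (opp K) x') SB iB iB' pB pB'"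
          "biproduct (opp K) C C' SC iC iC' pC pC'"
      for A C \<delta> x y A' C' \<delta>' x' y' SA iA iA' pA pA' SB iB iB' pB pB' SC iC iC' pC pC'
    proof -
      obtain B where B: "y \<in> Hom K C B" "x \<in> Hom K B A"
        using etriangleE[OF t(1)[unfolded etriangle_opp]] by metis
      obtain B' where B': "y' \<in> Hom K C' B'" "x' \<in> Hom K B' A'"
        using etriangleE[OF t(2)[unfolded etriangle_opp]] by metis
      have bip: "biproduct K C C' SC pC pC' iC iC'" "biproduct K (Cod K y) (Cod K y') SB pB pB' iB iB'"
        "biproduct K A A' SA pA pA' iA iA'"
        using b B B' Hom_Cod Hom_Dom unfolding biproduct_opposite[OF opposite_opp] o by metis+
      have c: "Cod K y = B" "Cod K y' = B'"
        using B B' Hom_Cod by auto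
      note d = bip(1)[THEN biproduct_D(1)] bip(1)[THEN biproduct_D(2)] bip(1)[THEN biproduct_D(3)]
        bip(1)[THEN biproduct_D(4)] bip(2)[THEN biproduct_D(1)] bip(2)[THEN biproduct_D(2)]
        bip(2)[THEN biproduct_D(3)] bip(2)[THEN biproduct_D(4)] bip(3)[THEN biproduct_D(1)]
        bip(3)[THEN biproduct_D(2)] bip(3)[THEN biproduct_D(3)] bip(3)[THEN biproduct_D(4)]
      note dd = d[unfolded c]
      have eq: "direct_sum_arr (opp K) pA pA' iB iB' x x' = direct_sum_arr K iB iB' pA pA' x x'"
        "direct_sum_arr (opp K) pB pB' iC iC' y y' = direct_sum_arr K iC iC' pB pB' y y'"
        using direct_sum_arr_opp[OF category_axioms] dd B B' by blast+
      have sumHom: "direct_sum_arr K iC iC' pB pB' y y' \<in> Hom K SC SB"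
        "direct_sum_arr K iB iB' pA pA' x x' \<in> Hom K SB SA"
        unfolding direct_sum_arr_def using dd B B' by (meson Add_Hom Comp_Hom)+
      have "is_sequence K SC SA (direct_sum_arr K iC iC' pB pB' y y') (direct_sum_arr K iB iB' pA pA' x x')"
        using sumHom by (auto simp: is_sequence_def Hom_def)
      from seq_class_opp[OF category_axioms this] show ?thesis
        using Real_sum[OF _ _ bip] t unfolding eq opp_simps etriangle_opp by auto
    qed
    show "EAct (opp K) c a \<in> hom (Ext (opp K) C A) (Ext (opp K) C' A')"
      if "c \<in> Hom (opp K) C' C" "a \<in> Hom (opp K) A A'" for c C' C a A A'
      using EAct_hom that unfolding o opp_simps by blast
    show "EAct (opp K) (c \<cdot>\<^bsub>opp K\<^esub> c') (a' \<cdot>\<^bsub>opp K\<^esub> a) \<delta> = EAct (opp K) c' a' (EAct (opp K) c a \<delta>)"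
      if "c \<in> Hom (opp K) C' C" "c' \<in> Hom (opp K) C'' C'" "a \<in> Hom (opp K) A A'" "a' \<in> Hom (opp K) A' A''"
        "\<delta> \<in> carrier (Ext (opp K) C A)" for c C' C c' C'' a A A' a' A'' \<delta>
      using EAct_Comp that unfolding o opp_simps by blast
  qed (use Ext_comm_group EAct_Ident EAct_Add_left EAct_Add_right in \<open>auto simp: o\<close>)
qed

context extriangulated_category
begin

lemma Ext_zero_left:
  "\<lbrakk>is_zero_object K C; A \<in> Obj K; \<delta> \<in> carrier (Ext K C A)\<rbrakk> \<Longrightarrow> \<delta> = \<one>\<^bsub>Ext K C A\<^esub>"
  using extriangulated_category.Ext_zero_right[OF extriangulated_category_opp[OF extriangulated_category_axioms]]
  by (simp add: zero_object_opposite[OF opposite_opp] opposite_simps[OF opposite_opp])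

lemma extend_along_inflation:
  assumes "etriangle K A C \<delta> x y" "x \<in> Hom K A B" "a \<in> Hom K A W" "push K C a \<delta> = \<one>\<^bsub>Ext K C W\<^esub>"
  obtains b where "b \<in> Hom K B W" "b \<cdot> x = a"
  using extriangulated_category.lift_through_deflation
    [OF extriangulated_category_opp[OF extriangulated_category_axioms], of C A \<delta> y x B a W] assms
  by (auto simp: opposite_simps[OF opposite_opp])

lemma pull_deflation:
  assumes "etriangle K A C \<delta> x y" "y \<in> Hom K B C"
  shows "pull K A y \<delta> = \<one>\<^bsub>Ext K B A\<^esub>"
  using extriangulated_category.push_inflation
    [OF extriangulated_category_opp[OF extriangulated_category_axioms], of C A \<delta> y x B] assms
  by (auto simp: opposite_simps[OF opposite_opp])

lemma pull_Comp_deflation: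
  assumes tri: "etriangle K A C \<delta> x y" and y: "y \<in> Hom K B C" and b: "b \<in> Hom K W B"
  shows "pull K A (y \<cdot> b) \<delta> = \<one>\<^bsub>Ext K W A\<^esub>"
proof -
  note t = etriangle_D[OF tri disjI2[OF y]]
  show ?thesis
    using pull_Comp[OF y b t(3,6)] pull_deflation[OF tri y] pull_one[OF b t(3)] by simp
qed

text \<open>(ET4) says that inflations compose; this is the same fact read in the opposite
  structure.\<close>

lemma deflation_Comp:
  assumes "etriangle K D A \<delta> x y" "etriangle K F B \<delta>' x' y'" "y \<in> Hom K B A"
  shows "\<exists>E \<delta>'' x''. etriangle K E A \<delta>'' x'' (y \<cdot> y')"
proof -
  note o = opposite_simps[OF opposite_opp[of K]]
  obtain C where "y' \<in> Hom K C B"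
    using assms(2) etriangleE by blast
  then show ?thesis
    using extriangulated_category.ET4_rule[OF extriangulated_category_opp[OF extriangulated_category_axioms],
        of A D \<delta> y x B F \<delta>' y' x' C thesis for thesis] assms unfolding o etriangle_opp by metis
qed

text \<open>The unipotent automorphism of the biproduct with off-diagonal entry \<open>f\<close>
  moves the given decomposition to this one. It exhibits the map (f,1) to \<open>Y\<close> as a
  split deflation.\<close>

lemma biproduct_shear:
  assumes bip: "biproduct K X Y W j1 j2 q1 q2" and f: "f \<in> Hom K X Y"
  shows "biproduct K X Y W (j1 \<ominus> j2 \<cdot> f) j2 q1 ((f \<cdot> q1) \<oplus> q2)"
proof -
  note b = biproduct_D[OF bip]
  note jf = Comp_Hom[OF f b(2)] and fq = Comp_Hom[OF b(3) f]
  note j = sub_Hom[OF b(1) jf] and q = Add_Hom[OF fq b(4)]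
  have X: "X \<in> Obj K" and Y: "Y \<in> Obj K"
    using f Hom_Obj_Dom Hom_Obj_Cod by auto
  have 1: "q1 \<cdot> (j1 \<ominus> j2 \<cdot> f) = Ident K X"
    using Comp_sub_right[OF b(1) jf b(3)] Comp_assoc[OF f b(2,3)] b(5,7) Comp_Zero_left[OF f X]
      sub_Add[OF Ident_Hom[OF X] Zero_Hom[OF X X]] Add_Zero[OF sub_Hom[OF Ident_Hom[OF X] Zero_Hom[OF X X]]]
    by simp
  have 2: "((f \<cdot> q1) \<oplus> q2) \<cdot> j2 = Ident K Y"
    using Comp_Add_left[OF b(2) fq b(4)] Comp_assoc[OF b(2,3) f] b(6,7) Comp_Zero_right[OF f Y]
      Zero_Add[OF Ident_Hom[OF Y]] by simp
  have j1: "((f \<cdot> q1) \<oplus> q2) \<cdot> j1 = f"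
    using Comp_Add_left[OF b(1) fq b(4)] Comp_assoc[OF b(1,3) f] b(5,8) Comp_Ident_right[OF f]
      Add_Zero[OF f] by simp
  have 3: "((f \<cdot> q1) \<oplus> q2) \<cdot> (j1 \<ominus> j2 \<cdot> f) = Zero K X Y"
    using Comp_sub_right[OF b(1) jf q] j1 Comp_assoc[OF f b(2) q] 2 Comp_Ident_left[OF f] sub_self[OF f]
    by simp
  have jfq: "j2 \<cdot> (f \<cdot> q1) \<in> Hom K W W"
    using Comp_Hom[OF fq b(2)] .
  note jq = Comp_Hom[OF b(3,1)] Comp_Hom[OF b(4,2)]
  have "(j1 \<ominus> j2 \<cdot> f) \<cdot> q1 \<oplus> j2 \<cdot> ((f \<cdot> q1) \<oplus> q2)
      = (j1 \<cdot> q1 \<ominus> j2 \<cdot> (f \<cdot> q1)) \<oplus> (j2 \<cdot> (f \<cdot> q1) \<oplus> j2 \<cdot> q2)"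
    using Comp_sub_left[OF b(3,1) jf] Comp_assoc[OF b(3) f b(2)] Comp_Add_right[OF fq b(4,2)] by simp
  also have "\<dots> = Ident K W"
    using Add_assoc[OF sub_Hom[OF jq(1) jfq] jfq jq(2)] sub_Add[OF jq(1) jfq] b(9) by simp
  finally show ?thesis
    unfolding biproduct_def using b(2,3,7) 1 2 3 j q by simp
qed

text \<open>The map (f,s) is the composite of the deflation 1 + s with a split deflation.\<close>

lemma deflation_copair:
  assumes tri: "etriangle K A Y \<rho> i s" and s: "s \<in> Hom K S Y" and f: "f \<in> Hom K X Y"
    and bip: "biproduct K X S V i1 i2 p1 p2"
  shows "\<exists>M \<tau> m. etriangle K M Y \<tau> m ((f \<cdot> p1) \<oplus> (s \<cdot> p2))"
proof -
  note t = etriangle_D[OF tri disjI2[OF s]] and b = biproduct_D[OF bip]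
  have X: "X \<in> Obj K" using Hom_Obj_Dom[OF f] .
  obtain Z where Z: "is_zero_object K Z"
    using ex_zero_object by blast
  then have ZO: "Z \<in> Obj K" using zero_object_iff by blast
  obtain W j1 j2 q1 q2 where bipW: "biproduct K X Y W j1 j2 q1 q2"
    using ex_biproduct[OF X t(5)] by blast
  note w = biproduct_D[OF bipW]
  define u where "u = (j1 \<cdot> p1) \<oplus> (j2 \<cdot> (s \<cdot> p2))"
  note sp = Comp_Hom[OF b(4) s]
  note j1p = Comp_Hom[OF b(3) w(1)] and j2sp = Comp_Hom[OF sp w(2)]
  have u: "u \<in> Hom K V W"
    unfolding u_def using Add_Hom[OF j1p j2sp] .
  have "biproduct K (Cod K (Zero K Z X)) (Cod K i) V i1 i2 p1 p2"
    using bip Hom_Cod[OF Zero_Hom[OF ZO X]] Hom_Cod[OF t(1)] by simp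
  \<comment> \<open>The sum of the split triangle 0 -> X -> X and the given one; \<open>A\<close>
    itself serves as the biproduct of the zero object and \<open>A\<close>.\<close>
  from Real_sum[OF etriangle_split[OF biproduct_zero_left[OF X Z]] tri biproduct_zero_left[OF t(3) Z] this bipW]
  have R: "Real K W A (EAct K q1 (Zero K Z A) \<one>\<^bsub>Ext K X Z\<^esub> \<otimes>\<^bsub>Ext K W A\<^esub> EAct K q2 (Ident K A) \<rho>) =
      seq_class K A W (direct_sum_arr K (Zero K A Z) (Ident K A) i1 i2 (Zero K Z X) i) u"
    (is "Real K W A ?\<omega> = seq_class K A W ?m u")
    using Comp_Ident_right[OF w(1)] Comp_assoc[OF b(4) s w(2)] by (simp add: direct_sum_arr_def u_def)
  have m: "?m \<in> Hom K A V"
    unfolding direct_sum_arr_def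
    using Add_Hom[OF Comp_Hom[OF Zero_Hom[OF t(3) ZO] Comp_Hom[OF Zero_Hom[OF ZO X] b(1)]]
        Comp_Hom[OF Ident_Hom[OF t(3)] Comp_Hom[OF t(1) b(2)]]] .
  have "?\<omega> \<in> carrier (Ext K W A)"
  proof -
    interpret G: comm_group "Ext K W A"
      using Ext_comm_group Hom_Obj_Cod[OF w(1)] t(3) by blast
    show ?thesis
      using G.m_closed hom_in_carrier[OF EAct_hom[OF w(3) Zero_Hom[OF ZO t(3)]] one_closed[OF X ZO]]
        hom_in_carrier[OF EAct_hom[OF w(4) Ident_Hom[OF t(3)]] t(6)] by blast
  qed
  moreover have "is_sequence K A W ?m u"
    using m u by (auto simp: is_sequence_def Hom_def)
  ultimately have tu: "etriangle K A W ?\<omega> ?m u"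
    unfolding etriangle_def using R seq_class_self Hom_Obj_Cod[OF w(1)] t(3) by metis
  have v: "(f \<cdot> q1) \<oplus> q2 \<in> Hom K W Y"
    using Add_Hom[OF Comp_Hom[OF w(3) f] w(4)] .
  have "q1 \<cdot> u = p1"
    unfolding u_def using Comp_Add_right[OF j1p j2sp w(3)] Comp_assoc[OF b(3) w(1,3)] Comp_assoc[OF sp w(2,3)]
      w(5,7) Comp_Ident_left[OF b(3)] Comp_Zero_left[OF sp X] Add_Zero[OF b(3)] by simp
  moreover have "q2 \<cdot> u = s \<cdot> p2"
    unfolding u_def using Comp_Add_right[OF j1p j2sp w(4)] Comp_assoc[OF b(3) w(1,4)] Comp_assoc[OF sp w(2,4)]
      w(6,8) Comp_Ident_left[OF sp] Comp_Zero_left[OF b(3) t(5)] Zero_Add[OF sp] by simp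
  ultimately have "((f \<cdot> q1) \<oplus> q2) \<cdot> u = (f \<cdot> p1) \<oplus> (s \<cdot> p2)"
    using Comp_Add_left[OF u Comp_Hom[OF w(3) f] w(4)] Comp_assoc[OF u w(3) f] by simp
  then show ?thesis
    using deflation_Comp[OF etriangle_split[OF biproduct_shear[OF bipW f]] tu v] by simp
qed

end

section \<open>Additive quotients\<close>

text \<open>A member of \<open>T\<close> provides zero maps among the factoring maps, and biproducts
  inside \<open>T\<close> provide their sums, so the factoring maps form an ideal. Images of such a
  subcategory under additive functors again satisfy these conditions.\<close>

locale additive_quotient = additive_category K for K :: "('o, 'm, 'z) precat_scheme" (structure) +
  fixes T :: "'o set"
  assumes T_Obj: "S \<in> T \<Longrightarrow> S \<in> Obj K"
    and T_nonempty: "T \<noteq> {}"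
    and T_sum: "\<lbrakk>S \<in> T; S' \<in> T\<rbrakk> \<Longrightarrow> \<exists>U i1 i2 p1 p2. U \<in> T \<and> biproduct K S S' U i1 i2 p1 p2"
begin

abbreviation Q :: "('o, 'm set) precat" where "Q \<equiv> quot_cat K T"
abbreviation fac :: "'o \<Rightarrow> 'o \<Rightarrow> 'm set" where "fac \<equiv> factoring K T"
abbreviation cls :: "'m \<Rightarrow> 'm set" where "cls \<equiv> arr_class K T"

lemma facI: "\<lbrakk>S \<in> T; f \<in> Hom K X S; g \<in> Hom K S Y\<rbrakk> \<Longrightarrow> g \<cdot> f \<in> fac X Y"
  by (auto simp: factoring_def)

lemma facE:
  assumes "h \<in> fac X Y"
  obtains S f g where "S \<in> T" "f \<in> Hom K X S" "g \<in> Hom K S Y" "h = g \<cdot> f"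
  using assms by (auto simp: factoring_def)

lemma fac_Hom: "h \<in> fac X Y \<Longrightarrow> h \<in> Hom K X Y"
  by (auto simp: factoring_def intro: Comp_Hom)

lemma fac_Comp_left:
  assumes "h \<in> fac X Y" and k: "k \<in> Hom K Y Z"
  shows "k \<cdot> h \<in> fac X Z"
proof -
  obtain S f g where h: "S \<in> T" "f \<in> Hom K X S" "g \<in> Hom K S Y" "h = g \<cdot> f"
    using assms(1) facE by metis
  show ?thesis
    using facI[OF h(1,2) Comp_Hom[OF h(3) k]] Comp_assoc[OF h(2,3) k] h(4) by simp
qed

lemma fac_Comp_right:
  assumes k: "k \<in> Hom K X Y" and "h \<in> fac Y Z"
  shows "h \<cdot> k \<in> fac X Z"
proof -
  obtain S f g where h: "S \<in> T" "f \<in> Hom K Y S" "g \<in> Hom K S Z" "h = g \<cdot> f"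
    using assms(2) facE by metis
  show ?thesis
    using facI[OF h(1) Comp_Hom[OF k h(2)] h(3)] Comp_assoc[OF k h(2,3)] h(4) by simp
qed

lemma fac_to: "\<lbrakk>f \<in> Hom K X S; S \<in> T\<rbrakk> \<Longrightarrow> f \<in> fac X S"
  by (metis Comp_Ident_left Ident_Hom T_Obj facI)

lemma fac_Zero: "\<lbrakk>X \<in> Obj K; Y \<in> Obj K\<rbrakk> \<Longrightarrow> Zero K X Y \<in> fac X Y"
  by (metis Comp_Zero_left T_Obj T_nonempty Zero_Hom ex_in_conv facI)

text \<open>The sum of two maps through \<open>S\<close> and \<open>S'\<close> is a row after a
  column through their biproduct.\<close>

lemma fac_Add:
  assumes "h \<in> fac X Y" "h' \<in> fac X Y"
  shows "h \<oplus> h' \<in> fac X Y"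
proof -
  obtain S f g where h: "S \<in> T" "f \<in> Hom K X S" "g \<in> Hom K S Y" "h = g \<cdot> f"
    using assms(1) facE by metis
  obtain S' f' g' where h': "S' \<in> T" "f' \<in> Hom K X S'" "g' \<in> Hom K S' Y" "h' = g' \<cdot> f'"
    using assms(2) facE by metis
  obtain U i1 i2 p1 p2 where U: "U \<in> T" "biproduct K S S' U i1 i2 p1 p2"
    using T_sum[OF h(1) h'(1)] by blast
  note b = biproduct_D[OF U(2)]
  note if1 = Comp_Hom[OF h(2) b(1)] and if2 = Comp_Hom[OF h'(2) b(2)]
    and gp1 = Comp_Hom[OF b(3) h(3)] and gp2 = Comp_Hom[OF b(4) h'(3)]
  let ?u = "(i1 \<cdot> f) \<oplus> (i2 \<cdot> f')" and ?v = "(g \<cdot> p1) \<oplus> (g' \<cdot> p2)"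
  have u: "?u \<in> Hom K X U" and v: "?v \<in> Hom K U Y"
    using Add_Hom if1 if2 gp1 gp2 by blast+
  have "p1 \<cdot> ?u = f"
    using Comp_Add_right[OF if1 if2 b(3)] Comp_assoc[OF h(2) b(1,3)] Comp_assoc[OF h'(2) b(2,3)] b(5,7)
      Comp_Ident_left[OF h(2)] Comp_Zero_left[OF h'(2) Hom_Obj_Cod[OF h(2)]] Add_Zero[OF h(2)] by simp
  moreover have "p2 \<cdot> ?u = f'"
    using Comp_Add_right[OF if1 if2 b(4)] Comp_assoc[OF h(2) b(1,4)] Comp_assoc[OF h'(2) b(2,4)] b(6,8)
      Comp_Ident_left[OF h'(2)] Comp_Zero_left[OF h(2) Hom_Obj_Cod[OF h'(2)]] Zero_Add[OF h'(2)] by simp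
  ultimately have "?v \<cdot> ?u = h \<oplus> h'"
    using Comp_Add_left[OF u gp1 gp2] Comp_assoc[OF u b(3) h(3)] Comp_assoc[OF u b(4) h'(3)] h(4) h'(4) by simp
  then show ?thesis
    using facI[OF U(1) u v] by simp
qed

lemma fac_neg: "h \<in> fac X Y \<Longrightarrow> neg K h \<in> fac X Y"
  by (metis Comp_neg_left facE facI neg_Hom)

lemma mem_cls_iff: "f \<in> Hom K X Y \<Longrightarrow> u \<in> cls f \<longleftrightarrow> (\<exists>h \<in> fac X Y. u = f \<oplus> h)"
  unfolding arr_class_def using Hom_Dom Hom_Cod by blast

lemma self_mem_cls: "f \<in> Hom K X Y \<Longrightarrow> f \<in> cls f"
  unfolding mem_cls_iff by (metis Add_Zero Hom_Obj_Cod Hom_Obj_Dom fac_Zero)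

lemma cls_eq_iff:
  assumes f: "f \<in> Hom K X Y" and g: "g \<in> Hom K X Y"
  shows "cls f = cls g \<longleftrightarrow> f \<ominus> g \<in> fac X Y"
proof
  assume eq: "cls f = cls g"
  obtain h where h: "h \<in> fac X Y" "f = g \<oplus> h"
    using self_mem_cls[OF f] unfolding eq mem_cls_iff[OF g] by blast
  then show "f \<ominus> g \<in> fac X Y"
    using Add_commute[OF g fac_Hom[OF h(1)]] Add_sub[OF fac_Hom[OF h(1)] g] by simp
next
  have sub: "cls f \<subseteq> cls g" if f: "f \<in> Hom K X Y" and g: "g \<in> Hom K X Y" and h: "f \<ominus> g \<in> fac X Y" for f g
  proof
    fix u assume "u \<in> cls f"
    then obtain h' where h': "h' \<in> fac X Y" "u = f \<oplus> h'"
      unfolding mem_cls_iff[OF f] by blast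
    have "f = g \<oplus> (f \<ominus> g)"
      using sub_Add[OF f g] Add_commute[OF g sub_Hom[OF f g]] by simp
    then have "u = g \<oplus> ((f \<ominus> g) \<oplus> h')"
      using h'(2) Add_assoc[OF g sub_Hom[OF f g] fac_Hom[OF h'(1)]] by simp
    then show "u \<in> cls g"
      unfolding mem_cls_iff[OF g] using fac_Add[OF h h'(1)] by blast
  qed
  assume h: "f \<ominus> g \<in> fac X Y"
  have "neg K (f \<ominus> g) = g \<ominus> f"
    by (rule neg_unique[OF sub_Hom[OF f g] sub_Hom[OF g f], symmetric])
      (metis Add_assoc[OF sub_Hom[OF f g] g neg_Hom[OF f]] sub_Add[OF f g] Add_neg[OF f] sub_def)
  then show "cls f = cls g"
    using sub[OF f g h] sub[OF g f] fac_neg[OF h] by auto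
qed

lemma cls_eqI: "\<lbrakk>f \<in> Hom K X Y; g \<in> Hom K X Y; f \<ominus> g \<in> fac X Y\<rbrakk> \<Longrightarrow> cls f = cls g"
  using cls_eq_iff by blast

text \<open>The choice is made from a nonempty coset, so the representative differs from
  \<open>f\<close> by a factoring map. As the quotient computes with representatives, all its laws
  pass through this.\<close>

lemma arr_rep_cls:
  assumes f: "f \<in> Hom K X Y"
  shows "arr_rep (cls f) \<in> Hom K X Y" "cls (arr_rep (cls f)) = cls f"
proof -
  have "arr_rep (cls f) \<in> cls f"
    unfolding arr_rep_def using self_mem_cls[OF f] by (rule someI)
  then obtain h where h: "h \<in> fac X Y" "arr_rep (cls f) = f \<oplus> h"
    unfolding mem_cls_iff[OF f] by blast
  show *: "arr_rep (cls f) \<in> Hom K X Y"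
    using h Add_Hom[OF f fac_Hom] by simp
  have "arr_rep (cls f) \<ominus> f = h"
    using h(2) Add_commute[OF f fac_Hom[OF h(1)]] Add_sub[OF fac_Hom[OF h(1)] f] by simp
  then show "cls (arr_rep (cls f)) = cls f"
    using cls_eqI[OF * f] h(1) by simp
qed

lemma Q_Obj [simp]: "Obj Q = Obj K"
  and Q_Ident [simp]: "Ident Q X = cls (Ident K X)"
  and Q_Zero [simp]: "Zero Q X Y = cls (Zero K X Y)"
  by (simp_all add: quot_cat_def)

lemma Q_Dom: "f \<in> Hom K X Y \<Longrightarrow> Dom Q (cls f) = X"
  and Q_Cod: "f \<in> Hom K X Y \<Longrightarrow> Cod Q (cls f) = Y"
  using Hom_Dom[OF arr_rep_cls(1)] Hom_Cod[OF arr_rep_cls(1)] by (simp_all add: quot_cat_def)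

lemma Q_Hom: "f \<in> Hom K X Y \<Longrightarrow> cls f \<in> Hom Q X Y"
  unfolding Hom_def[of Q] using Q_Dom Q_Cod Hom_Arr by (auto simp: quot_cat_def)

lemma Q_HomE:
  assumes "U \<in> Hom Q X Y"
  obtains f where "f \<in> Hom K X Y" "U = cls f"
proof -
  obtain f where f: "f \<in> Arr K" "U = cls f"
    using assms by (auto simp: Hom_def quot_cat_def)
  then show ?thesis
    using that Q_Dom Q_Cod Arr_Hom assms unfolding Hom_def[of Q] by fastforce
qed

lemma Q_ArrE:
  assumes "U \<in> Arr Q"
  obtains X Y f where "f \<in> Hom K X Y" "U = cls f"
  using assms Arr_Hom by (auto simp: quot_cat_def)

text \<open>Replacing one chosen representative at a time changes the composite by a factoring map,
  because these form an ideal.\<close>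

lemma Q_Comp:
  assumes f: "f \<in> Hom K X Y" and g: "g \<in> Hom K Y Z"
  shows "cls g \<cdot>\<^bsub>Q\<^esub> cls f = cls (g \<cdot> f)"
proof -
  let ?f = "arr_rep (cls f)" and ?g = "arr_rep (cls g)"
  note rf = arr_rep_cls[OF f] and rg = arr_rep_cls[OF g]
  have hf: "?f \<ominus> f \<in> fac X Y" and hg: "?g \<ominus> g \<in> fac Y Z"
    using cls_eq_iff[OF rf(1) f] cls_eq_iff[OF rg(1) g] rf(2) rg(2) by blast+
  note gf = Comp_Hom[OF rf(1) rg(1)] Comp_Hom[OF rf(1) g] Comp_Hom[OF f g]
  have "cls (?g \<cdot> ?f) = cls (g \<cdot> ?f)"
    using cls_eqI[OF gf(1,2)] fac_Comp_right[OF rf(1) hg] Comp_sub_left[OF rf(1) rg(1) g] by simp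
  also have "\<dots> = cls (g \<cdot> f)"
    using cls_eqI[OF gf(2,3)] fac_Comp_left[OF hf g] Comp_sub_right[OF rf(1) f g] by simp
  finally show ?thesis
    by (simp add: quot_cat_def)
qed

lemma cls_Add:
  assumes f: "f \<in> Hom K X Y" "f' \<in> Hom K X Y" "f \<ominus> f' \<in> fac X Y" and g: "g \<in> Hom K X Y"
  shows "cls (f \<oplus> g) = cls (f' \<oplus> g)"
proof -
  let ?h = "f \<ominus> f'"
  note h = fac_Hom[OF f(3)]
  have "f \<oplus> g = ?h \<oplus> (f' \<oplus> g)"
    using sub_Add[OF f(1,2)] Add_assoc[OF h f(2) g] by simp
  then have "(f \<oplus> g) \<ominus> (f' \<oplus> g) = ?h"
    using Add_sub[OF h Add_Hom[OF f(2) g]] by simp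
  then show ?thesis
    using cls_eqI[OF Add_Hom[OF f(1) g] Add_Hom[OF f(2) g]] f(3) by simp
qed

lemma Q_Add:
  assumes f: "f \<in> Hom K X Y" and g: "g \<in> Hom K X Y"
  shows "cls f \<oplus>\<^bsub>Q\<^esub> cls g = cls (f \<oplus> g)"
proof -
  let ?f = "arr_rep (cls f)" and ?g = "arr_rep (cls g)"
  note rf = arr_rep_cls[OF f] and rg = arr_rep_cls[OF g]
  have hf: "?f \<ominus> f \<in> fac X Y" and hg: "?g \<ominus> g \<in> fac X Y"
    using cls_eq_iff[OF rf(1) f] cls_eq_iff[OF rg(1) g] rf(2) rg(2) by blast+
  have "cls (?f \<oplus> ?g) = cls (f \<oplus> g)"
    using cls_Add[OF rf(1) f hf rg(1)] cls_Add[OF rg(1) g hg f] Add_commute[OF f g] Add_commute[OF f rg(1)]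
    by simp
  then show ?thesis
    by (simp add: quot_cat_def)
qed

lemma cls_zero_iff: "f \<in> Hom K X Y \<Longrightarrow> cls f = Zero Q X Y \<longleftrightarrow> f \<in> fac X Y"
proof -
  assume f: "f \<in> Hom K X Y"
  note 0 = Zero_Hom[OF Hom_Obj_Dom[OF f] Hom_Obj_Cod[OF f]]
  have "f \<ominus> Zero K X Y = f"
    using Add_Zero[OF sub_Hom[OF f 0]] sub_Add[OF f 0] by simp
  then show ?thesis
    using cls_eq_iff[OF f 0] by simp
qed

lemma Q_zero_object:
  assumes Z: "is_zero_object K Z"
  shows "is_zero_object Q Z"
  unfolding is_zero_object_def Q_Obj
proof (intro conjI ballI)
  show ZO: "Z \<in> Obj K"
    using Z zero_object_iff by blast
  fix X assume X: "X \<in> Obj K"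
  show "\<exists>!U. U \<in> Hom Q X Z"
  proof
    show "cls (Zero K X Z) \<in> Hom Q X Z"
      using Q_Hom[OF Zero_Hom[OF X ZO]] .
    show "U = cls (Zero K X Z)" if "U \<in> Hom Q X Z" for U
      by (rule Q_HomE[OF that]) (metis zero_object_Hom_to[OF Z])
  qed
  show "\<exists>!U. U \<in> Hom Q Z X"
  proof
    show "cls (Zero K Z X) \<in> Hom Q Z X"
      using Q_Hom[OF Zero_Hom[OF ZO X]] .
    show "U = cls (Zero K Z X)" if "U \<in> Hom Q Z X" for U
      by (rule Q_HomE[OF that]) (metis zero_object_Hom_from[OF Z])
  qed
qed

lemma Q_biproduct:
  assumes "biproduct K X Y S i1 i2 p1 p2"
  shows "biproduct Q X Y S (cls i1) (cls i2) (cls p1) (cls p2)"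
proof -
  note b = biproduct_D[OF assms]
  show ?thesis
    unfolding biproduct_def
    using b Q_Hom Q_Comp[OF b(1,3)] Q_Comp[OF b(2,4)] Q_Comp[OF b(2,3)] Q_Comp[OF b(1,4)]
      Q_Comp[OF b(3,1)] Q_Comp[OF b(4,2)] Q_Add[OF Comp_Hom[OF b(3,1)] Comp_Hom[OF b(4,2)]] by simp
qed

lemma category_Q: "category Q"
proof
  show "Dom Q U \<in> Obj Q" "Cod Q U \<in> Obj Q" if "U \<in> Arr Q" for U
    by (rule Q_ArrE[OF that], simp add: Q_Dom Q_Cod Hom_Obj_Dom Hom_Obj_Cod)+
  show "Ident Q X \<in> Hom Q X X" if "X \<in> Obj Q" for X
    using Q_Hom[OF Ident_Hom] that by simp
  show "V \<cdot>\<^bsub>Q\<^esub> U \<in> Hom Q X Z" if U: "U \<in> Hom Q X Y" and V: "V \<in> Hom Q Y Z" for U V X Y Z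
  proof -
    obtain f where f: "f \<in> Hom K X Y" "U = cls f" using U Q_HomE by blast
    obtain g where g: "g \<in> Hom K Y Z" "V = cls g" using V Q_HomE by blast
    show ?thesis
      using Q_Comp[OF f(1) g(1)] Q_Hom[OF Comp_Hom[OF f(1) g(1)]] f(2) g(2) by simp
  qed
  show "U \<cdot>\<^bsub>Q\<^esub> Ident Q X = U" "Ident Q Y \<cdot>\<^bsub>Q\<^esub> U = U" if U: "U \<in> Hom Q X Y" for U X Y
  proof -
    obtain f where f: "f \<in> Hom K X Y" "U = cls f" using U Q_HomE by blast
    show "U \<cdot>\<^bsub>Q\<^esub> Ident Q X = U" "Ident Q Y \<cdot>\<^bsub>Q\<^esub> U = U"
      using f Q_Comp[OF f(1) Ident_Hom] Q_Comp[OF Ident_Hom f(1)] Hom_Obj_Dom Hom_Obj_Cod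
        Comp_Ident_left[OF f(1)] Comp_Ident_right[OF f(1)] by simp_all
  qed
  show "(W \<cdot>\<^bsub>Q\<^esub> V) \<cdot>\<^bsub>Q\<^esub> U = W \<cdot>\<^bsub>Q\<^esub> (V \<cdot>\<^bsub>Q\<^esub> U)"
    if U: "U \<in> Hom Q X Y" and V: "V \<in> Hom Q Y Z" and W: "W \<in> Hom Q Z Z'" for U V W X Y Z Z'
  proof -
    obtain f where f: "f \<in> Hom K X Y" "U = cls f" using U Q_HomE by blast
    obtain g where g: "g \<in> Hom K Y Z" "V = cls g" using V Q_HomE by blast
    obtain h where h: "h \<in> Hom K Z Z'" "W = cls h" using W Q_HomE by blast
    show ?thesis
      unfolding f(2) g(2) h(2)
      using Q_Comp[OF f(1) g(1)] Q_Comp[OF g(1) h(1)] Q_Comp[OF Comp_Hom[OF f(1) g(1)] h(1)]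
        Q_Comp[OF f(1) Comp_Hom[OF g(1) h(1)]] Comp_assoc[OF f(1) g(1) h(1)] by simp
  qed
qed

lemma additive_category_Q: "additive_category Q"
proof (intro additive_category.intro additive_category_axioms.intro category_Q)
  show "comm_group (HomG Q X Y)" if X: "X \<in> Obj Q" and Y: "Y \<in> Obj Q" for X Y
  proof (rule comm_groupI; unfold HomG_def monoid.simps partial_object.simps)
    note XY = X[unfolded Q_Obj] Y[unfolded Q_Obj]
    show "U \<oplus>\<^bsub>Q\<^esub> V \<in> Hom Q X Y" if "U \<in> Hom Q X Y" "V \<in> Hom Q X Y" for U V
      by (rule Q_HomE[OF that(1)], rule Q_HomE[OF that(2)]) (simp add: Q_Add Q_Hom Add_Hom)
    show "Zero Q X Y \<in> Hom Q X Y"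
      using Q_Hom[OF Zero_Hom[OF XY]] by simp
    show "U \<oplus>\<^bsub>Q\<^esub> V \<oplus>\<^bsub>Q\<^esub> W = U \<oplus>\<^bsub>Q\<^esub> (V \<oplus>\<^bsub>Q\<^esub> W)"
      if U: "U \<in> Hom Q X Y" and V: "V \<in> Hom Q X Y" and W: "W \<in> Hom Q X Y" for U V W
    proof -
      obtain f where f: "f \<in> Hom K X Y" "U = cls f" using U Q_HomE by blast
      obtain g where g: "g \<in> Hom K X Y" "V = cls g" using V Q_HomE by blast
      obtain h where h: "h \<in> Hom K X Y" "W = cls h" using W Q_HomE by blast
      show ?thesis
        unfolding f(2) g(2) h(2)
        using Q_Add[OF f(1) g(1)] Q_Add[OF g(1) h(1)] Q_Add[OF Add_Hom[OF f(1) g(1)] h(1)]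
          Q_Add[OF f(1) Add_Hom[OF g(1) h(1)]] Add_assoc[OF f(1) g(1) h(1)] by simp
    qed
    show "U \<oplus>\<^bsub>Q\<^esub> V = V \<oplus>\<^bsub>Q\<^esub> U" if U: "U \<in> Hom Q X Y" and V: "V \<in> Hom Q X Y" for U V
    proof -
      obtain f where f: "f \<in> Hom K X Y" "U = cls f" using U Q_HomE by blast
      obtain g where g: "g \<in> Hom K X Y" "V = cls g" using V Q_HomE by blast
      show ?thesis
        unfolding f(2) g(2) Q_Add[OF f(1) g(1)] Q_Add[OF g(1) f(1)] using Add_commute[OF f(1) g(1)] by simp
    qed
    show "Zero Q X Y \<oplus>\<^bsub>Q\<^esub> U = U" if U: "U \<in> Hom Q X Y" for U
    proof -
      obtain f where f: "f \<in> Hom K X Y" "U = cls f" using U Q_HomE by blast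
      show ?thesis
        unfolding f(2) Q_Zero Q_Add[OF Zero_Hom[OF XY] f(1)] using Zero_Add[OF f(1)] by simp
    qed
    show "\<exists>V \<in> Hom Q X Y. V \<oplus>\<^bsub>Q\<^esub> U = Zero Q X Y" if U: "U \<in> Hom Q X Y" for U
    proof -
      obtain f where f: "f \<in> Hom K X Y" "U = cls f" using U Q_HomE by blast
      show ?thesis
        unfolding f(2) Q_Zero
        using Q_Add[OF neg_Hom[OF f(1)] f(1)] Add_neg[OF f(1)] Add_commute[OF f(1) neg_Hom[OF f(1)]]
          Q_Hom[OF neg_Hom[OF f(1)]] by metis
    qed
  qed
  show "W \<cdot>\<^bsub>Q\<^esub> (U \<oplus>\<^bsub>Q\<^esub> V) = W \<cdot>\<^bsub>Q\<^esub> U \<oplus>\<^bsub>Q\<^esub> W \<cdot>\<^bsub>Q\<^esub> V"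
    if U: "U \<in> Hom Q X Y" and V: "V \<in> Hom Q X Y" and W: "W \<in> Hom Q Y Z" for U V W X Y Z
  proof -
    obtain f where f: "f \<in> Hom K X Y" "U = cls f" using U Q_HomE by blast
    obtain g where g: "g \<in> Hom K X Y" "V = cls g" using V Q_HomE by blast
    obtain h where h: "h \<in> Hom K Y Z" "W = cls h" using W Q_HomE by blast
    show ?thesis
      unfolding f(2) g(2) h(2) Q_Add[OF f(1) g(1)] Q_Comp[OF Add_Hom[OF f(1) g(1)] h(1)]
        Q_Comp[OF f(1) h(1)] Q_Comp[OF g(1) h(1)] Q_Add[OF Comp_Hom[OF f(1) h(1)] Comp_Hom[OF g(1) h(1)]]
        Comp_Add_right[OF f(1) g(1) h(1)] ..
  qed
  show "(U \<oplus>\<^bsub>Q\<^esub> V) \<cdot>\<^bsub>Q\<^esub> W = U \<cdot>\<^bsub>Q\<^esub> W \<oplus>\<^bsub>Q\<^esub> V \<cdot>\<^bsub>Q\<^esub> W"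
    if W: "W \<in> Hom Q X Y" and U: "U \<in> Hom Q Y Z" and V: "V \<in> Hom Q Y Z" for U V W X Y Z
  proof -
    obtain f where f: "f \<in> Hom K Y Z" "U = cls f" using U Q_HomE by blast
    obtain g where g: "g \<in> Hom K Y Z" "V = cls g" using V Q_HomE by blast
    obtain h where h: "h \<in> Hom K X Y" "W = cls h" using W Q_HomE by blast
    show ?thesis
      unfolding f(2) g(2) h(2) Q_Add[OF f(1) g(1)] Q_Comp[OF h(1) Add_Hom[OF f(1) g(1)]]
        Q_Comp[OF h(1) f(1)] Q_Comp[OF h(1) g(1)] Q_Add[OF Comp_Hom[OF h(1) f(1)] Comp_Hom[OF h(1) g(1)]]
        Comp_Add_left[OF h(1) f(1) g(1)] ..
  qed
  show "\<exists>Z. is_zero_object Q Z"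
    using ex_zero_object Q_zero_object by blast
  show "\<exists>S i1 i2 p1 p2. biproduct Q X Y S i1 i2 p1 p2" if "X \<in> Obj Q" "Y \<in> Obj Q" for X Y
    using ex_biproduct that Q_biproduct unfolding Q_Obj by metis
qed

sublocale Q: additive_category Q
  by (rule additive_category_Q)

lemma Q_isomorphism:
  assumes f: "f \<in> Hom K X Y" and "is_isomorphism K f"
  shows "is_isomorphism Q (cls f)"
proof -
  obtain g where g: "g \<in> Hom K Y X" "g \<cdot> f = Ident K X" "f \<cdot> g = Ident K Y"
    using assms isomorphismE by blast
  show ?thesis
    by (rule Q.isomorphismI[OF Q_Hom[OF f] Q_Hom[OF g(1)]])
      (simp_all add: Q_Comp[OF f g(1)] Q_Comp[OF g(1) f] g)
qed

text \<open>In an additive category cancellation may be tested against zero by taking differences,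
  and a class is zero exactly when its arrow factors through \<open>T\<close>.\<close>

lemma Q_epi_iff:
  assumes f: "f \<in> Hom K X Y"
  shows "is_epi Q (cls f) \<longleftrightarrow> (\<forall>W w. w \<in> Hom K Y W \<longrightarrow> w \<cdot> f \<in> fac X W \<longrightarrow> w \<in> fac Y W)"
proof
  assume e: "is_epi Q (cls f)"
  show "\<forall>W w. w \<in> Hom K Y W \<longrightarrow> w \<cdot> f \<in> fac X W \<longrightarrow> w \<in> fac Y W"
  proof (intro allI impI)
    fix W w assume w: "w \<in> Hom K Y W" and "w \<cdot> f \<in> fac X W"
    note 0 = Zero_Hom[OF Hom_Obj_Cod[OF f] Hom_Obj_Cod[OF w]]
    have "cls w \<cdot>\<^bsub>Q\<^esub> cls f = cls (Zero K Y W) \<cdot>\<^bsub>Q\<^esub> cls f"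
      using \<open>w \<cdot> f \<in> fac X W\<close> Q_Comp[OF f w] Q_Comp[OF f 0] cls_zero_iff[OF Comp_Hom[OF f w]]
        Comp_Zero_left[OF f Hom_Obj_Cod[OF w]] by simp
    then have "cls w = cls (Zero K Y W)"
      using e Q.epi_iff[OF Q_Hom[OF f]] Q_Hom[OF w] Q_Hom[OF 0] by blast
    then show "w \<in> fac Y W"
      using cls_zero_iff[OF w] by simp
  qed
next
  assume e: "\<forall>W w. w \<in> Hom K Y W \<longrightarrow> w \<cdot> f \<in> fac X W \<longrightarrow> w \<in> fac Y W"
  show "is_epi Q (cls f)"
    unfolding Q.epi_iff[OF Q_Hom[OF f]]
  proof (intro allI impI)
    fix W U V assume U: "U \<in> Hom Q Y W" and V: "V \<in> Hom Q Y W" and eq: "U \<cdot>\<^bsub>Q\<^esub> cls f = V \<cdot>\<^bsub>Q\<^esub> cls f"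
    obtain u where u: "u \<in> Hom K Y W" "U = cls u" using U Q_HomE by blast
    obtain v where v: "v \<in> Hom K Y W" "V = cls v" using V Q_HomE by blast
    have "(u \<ominus> v) \<cdot> f \<in> fac X W"
      using eq u v Q_Comp[OF f u(1)] Q_Comp[OF f v(1)] cls_eq_iff[OF Comp_Hom[OF f u(1)] Comp_Hom[OF f v(1)]]
        Comp_sub_left[OF f u(1) v(1)] by simp
    then show "U = V"
      using e sub_Hom[OF u(1) v(1)] cls_eqI[OF u(1) v(1)] u(2) v(2) by blast
  qed
qed

text \<open>Uniqueness of the induced map is the epi assumption, so only a factorization up to maps
  through \<open>T\<close> remains to be supplied.\<close>

lemma Q_cokernelI:
  assumes f: "f \<in> Hom K X Y" and g: "g \<in> Hom K Y Z" and gf: "g \<cdot> f \<in> fac X Z"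
    and epi: "is_epi Q (cls g)"
    and ex: "\<And>W w. \<lbrakk>w \<in> Hom K Y W; w \<cdot> f \<in> fac X W\<rbrakk> \<Longrightarrow> \<exists>w' \<in> Hom K Z W. w \<ominus> w' \<cdot> g \<in> fac Y W"
  shows "is_cokernel Q (cls g) (cls f)"
proof -
  note Qf = Q_Hom[OF f] and Qg = Q_Hom[OF g]
  have d: "Dom Q (cls f) = X" "Cod Q (cls f) = Y" "Dom Q (cls g) = Y" "Cod Q (cls g) = Z"
    using f g Q_Dom Q_Cod by auto
  show ?thesis
    unfolding is_cokernel_def d
  proof (intro conjI ballI impI)
    show "cls g \<in> Arr Q" "cls f \<in> Arr Q" "Y = Y"
      using Qf Qg Q.Hom_Arr by auto
    show "cls g \<cdot>\<^bsub>Q\<^esub> cls f = Zero Q X Z"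
      using Q_Comp[OF f g] cls_zero_iff[OF Comp_Hom[OF f g]] gf by simp
    fix U assume "U \<in> Arr Q" and U: "Dom Q U = Y \<and> U \<cdot>\<^bsub>Q\<^esub> cls f = Zero Q X (Cod Q U)"
    then obtain W where W: "U \<in> Hom Q Y W" "Cod Q U = W"
      using Q.Arr_Hom by metis
    obtain w where w: "w \<in> Hom K Y W" "U = cls w" using W(1) Q_HomE by blast
    have "w \<cdot> f \<in> fac X W"
      using U Q_Comp[OF f w(1)] cls_zero_iff[OF Comp_Hom[OF f w(1)]] w(2) W(2) by simp
    then obtain w' where w': "w' \<in> Hom K Z W" "w \<ominus> w' \<cdot> g \<in> fac Y W"
      using ex w(1) by blast
    have "cls w' \<cdot>\<^bsub>Q\<^esub> cls g = U"
      using Q_Comp[OF g w'(1)] cls_eqI[OF w(1) Comp_Hom[OF g w'(1)] w'(2)] w(2) by simp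
    then show "\<exists>!V. V \<in> Hom Q Z (Cod Q U) \<and> V \<cdot>\<^bsub>Q\<^esub> cls g = U"
      using Q_Hom[OF w'(1)] epi[unfolded Q.epi_iff[OF Qg]] W(2) by metis
  qed
qed

end

text \<open>Factoring through an object of \<open>T\<close> is a self-dual condition, so both
  quotients have literally the same classes.\<close>

lemma quot_cat_opposite:
  assumes "opposite K L"
  shows "opposite (quot_cat K T) (quot_cat L T)"
proof -
  note o = opposite_simps[OF assms]
  have "factoring L T X Y = factoring K T Y X" for X Y
    unfolding factoring_def o by blast
  then have "arr_class L T = arr_class K T"
    by (simp add: arr_class_def fun_eq_iff o)
  then show ?thesis
    by (simp add: opposite_def quot_cat_def o)
qed

section \<open>The quotient by a cluster tilting subcategory\<close>

context extriangulated_category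
begin

lemma ET3_op_rule:
  assumes "etriangle K A C \<delta> x y" "etriangle K A' C' \<delta>' x' y'"
    "y \<in> Hom K B C" "y' \<in> Hom K B' C'" "c \<in> Hom K C C'" "b \<in> Hom K B B'" "y' \<cdot> b = c \<cdot> y"
  obtains a where "a \<in> Hom K A A'" "x' \<cdot> a = b \<cdot> x" "push K C a \<delta> = pull K A' c \<delta>'"
  using extriangulated_category.ET3_rule[OF extriangulated_category_opp[OF extriangulated_category_axioms],
      of C' A' \<delta>' y' x' C A \<delta> y x B' B c b] assms
  unfolding opposite_simps[OF opposite_opp] etriangle_opp push_opp pull_opp by metis

text \<open>Pulling back along \<open>r\<close> and then along \<open>s\<close> is the identity, so
  pullback along \<open>r\<close> has trivial kernel.\<close>

lemma pull_injective_retract: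
  assumes "\<delta> \<in> carrier (Ext K X A)" "s \<in> Hom K X S" "r \<in> Hom K S X" "r \<cdot> s = Ident K X" "A \<in> Obj K"
    "pull K A r \<delta> = \<one>\<^bsub>Ext K S A\<^esub>"
  shows "\<delta> = \<one>\<^bsub>Ext K X A\<^esub>"
  using pull_Comp[OF assms(3,2,5,1)] pull_one[OF assms(2,5)] pull_Ident[OF Hom_Obj_Dom[OF assms(2)] assms(5,1)]
    assms(4,6) by simp

lemma pull_Add_one:
  assumes "c \<in> Hom K C' C" "c' \<in> Hom K C' C" "A \<in> Obj K" "\<delta> \<in> carrier (Ext K C A)"
    "pull K A c \<delta> = \<one>\<^bsub>Ext K C' A\<^esub>" "pull K A c' \<delta> = \<one>\<^bsub>Ext K C' A\<^esub>"
  shows "pull K A (c \<oplus> c') \<delta> = \<one>\<^bsub>Ext K C' A\<^esub>"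
proof -
  interpret G: comm_group "Ext K C' A"
    using Ext_comm_group Hom_Obj_Dom assms(1,3) by blast
  show ?thesis
    using EAct_Add_left[OF assms(1,2) Ident_Hom[OF assms(3)] assms(4)] assms(5,6) by (simp add: pull_def)
qed

end

locale cluster_tilting_subcategory = extriangulated_category K
  for K :: "('o, 'm, 'e) extcat" (structure) and T :: "'o set" +
  assumes cluster_tilting: "cluster_tilting K T"
begin

lemma cluster_tilting_Obj: "S \<in> T \<Longrightarrow> S \<in> Obj K"
  using cluster_tilting by (auto simp: cluster_tilting_def iso_closed_def)

lemma isomorphic_in_T: "\<lbrakk>S \<in> T; isomorphic K S X; X \<in> Obj K\<rbrakk> \<Longrightarrow> X \<in> T"
  using cluster_tilting by (auto simp: cluster_tilting_def iso_closed_def)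

lemma rigid: "\<lbrakk>S \<in> T; S' \<in> T; \<delta> \<in> carrier (Ext K S S')\<rbrakk> \<Longrightarrow> \<delta> = \<one>\<^bsub>Ext K S S'\<^esub>"
  using cluster_tilting cluster_tilting_Obj unfolding cluster_tilting_def by blast

lemma in_T_if_Ext_from:
  assumes "X \<in> Obj K" "\<And>S \<delta>. \<lbrakk>S \<in> T; \<delta> \<in> carrier (Ext K X S)\<rbrakk> \<Longrightarrow> \<delta> = \<one>\<^bsub>Ext K X S\<^esub>"
  shows "X \<in> T"
proof -
  have "carrier (Ext K X S) = {\<one>\<^bsub>Ext K X S\<^esub>}" if "S \<in> T" for S
    using assms(2)[OF that] one_closed[OF assms(1) cluster_tilting_Obj[OF that]] by blast
  then show ?thesis
    using cluster_tilting assms(1) unfolding cluster_tilting_def by blast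
qed

lemma in_T_if_Ext_to:
  assumes "X \<in> Obj K" "\<And>S \<delta>. \<lbrakk>S \<in> T; \<delta> \<in> carrier (Ext K S X)\<rbrakk> \<Longrightarrow> \<delta> = \<one>\<^bsub>Ext K S X\<^esub>"
  shows "X \<in> T"
proof -
  have "carrier (Ext K S X) = {\<one>\<^bsub>Ext K S X\<^esub>}" if "S \<in> T" for S
    using assms(2)[OF that] one_closed[OF cluster_tilting_Obj[OF that] assms(1)] by blast
  then show ?thesis
    using cluster_tilting assms(1) unfolding cluster_tilting_def by blast
qed

text \<open>Pullback along \<open>r\<close> embeds the extensions of \<open>X\<close> into those of
  \<open>S\<close>, which vanish against \<open>T\<close>.\<close>

lemma retract_in_T:
  assumes "S \<in> T" "s \<in> Hom K X S" "r \<in> Hom K S X" "r \<cdot> s = Ident K X"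
  shows "X \<in> T"
proof (rule in_T_if_Ext_from)
  show "X \<in> Obj K" using Hom_Obj_Dom[OF assms(2)] .
  fix S' \<delta> assume S': "S' \<in> T" and d: "\<delta> \<in> carrier (Ext K X S')"
  note O = cluster_tilting_Obj[OF S']
  show "\<delta> = \<one>\<^bsub>Ext K X S'\<^esub>"
    using pull_injective_retract[OF d assms(2-4) O] rigid[OF assms(1) S' pull_closed[OF assms(3) O d]] by blast
qed

lemma zero_in_T: "is_zero_object K Z \<Longrightarrow> Z \<in> T"
  using in_T_if_Ext_from Ext_zero_left cluster_tilting_Obj zero_object_iff by metis

text \<open>An extension of \<open>U\<close> is the sum of its pullbacks along the two idempotents,
  and each of these passes through an extension between objects of \<open>T\<close>.\<close>

lemma biproduct_in_T:
  assumes "S \<in> T" "S' \<in> T" "biproduct K S S' U i1 i2 p1 p2"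
  shows "U \<in> T"
proof (rule in_T_if_Ext_from)
  note b = biproduct_D[OF assms(3)]
  show U: "U \<in> Obj K" using Hom_Obj_Cod[OF b(1)] .
  fix W \<delta> assume W: "W \<in> T" and d: "\<delta> \<in> carrier (Ext K U W)"
  note O = cluster_tilting_Obj[OF W]
  have "pull K W (i1 \<cdot> p1) \<delta> = \<one>\<^bsub>Ext K U W\<^esub>"
    using pull_Comp[OF b(1,3) O d] rigid[OF assms(1) W pull_closed[OF b(1) O d]] pull_one[OF b(3) O] by simp
  moreover have "pull K W (i2 \<cdot> p2) \<delta> = \<one>\<^bsub>Ext K U W\<^esub>"
    using pull_Comp[OF b(2,4) O d] rigid[OF assms(2) W pull_closed[OF b(2) O d]] pull_one[OF b(4) O] by simp
  ultimately show "\<delta> = \<one>\<^bsub>Ext K U W\<^esub>"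
    using pull_Add_one[OF Comp_Hom[OF b(3,1)] Comp_Hom[OF b(4,2)] O d] b(9) pull_Ident[OF U O d] by simp
qed

sublocale additive_quotient K T
proof
  show "T \<noteq> {}"
    using ex_zero_object zero_in_T by blast
  show "\<exists>U i1 i2 p1 p2. U \<in> T \<and> biproduct K S S' U i1 i2 p1 p2" if "S \<in> T" "S' \<in> T" for S S'
    using ex_biproduct biproduct_in_T that cluster_tilting_Obj by metis
qed (rule cluster_tilting_Obj)

text \<open>A factorization of the identity presents \<open>X\<close> as a retract of an object of
  \<open>T\<close>. This is why no further objects of the quotient become zero.\<close>

lemma Ident_fac_iff:
  assumes "X \<in> Obj K"
  shows "Ident K X \<in> fac X X \<longleftrightarrow> X \<in> T"
  using facE retract_in_T fac_to Ident_Hom[OF assms] by metis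

lemma Q_zero_iff: "is_zero_object Q X \<longleftrightarrow> X \<in> T"
proof (cases "X \<in> Obj K")
  case True
  then show ?thesis
    using Q.zero_object_iff cls_zero_iff[OF Ident_Hom] Ident_fac_iff by simp
qed (auto simp: is_zero_object_def dest: cluster_tilting_Obj)

text \<open>If \<open>w\<close> after \<open>x\<close> equals \<open>c\<close> after
  \<open>a\<close> through \<open>T\<close>, then \<open>a\<close> extends along \<open>x\<close> to
  some \<open>b\<close>. The remainder of \<open>w\<close> after subtracting \<open>c\<close> after
  \<open>b\<close> kills \<open>x\<close>, hence factors through \<open>C\<close>, which lies in
  \<open>T\<close> too.\<close>

lemma Q_epi_inflation:
  assumes tri: "etriangle K A C \<delta> x y" and x: "x \<in> Hom K A B" and C: "C \<in> T"
  shows "is_epi Q (cls x)"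
  unfolding Q_epi_iff[OF x]
proof (intro allI impI)
  note t = etriangle_D[OF tri disjI1[OF x]]
  fix W w assume w: "w \<in> Hom K B W" and "w \<cdot> x \<in> fac A W"
  then obtain S a c where a: "S \<in> T" "a \<in> Hom K A S" "c \<in> Hom K S W" "w \<cdot> x = c \<cdot> a"
    using facE by metis
  have "push K C a \<delta> = \<one>\<^bsub>Ext K C S\<^esub>"
    using rigid[OF C a(1) push_closed[OF a(2) t(5,6)]] .
  then obtain b where b: "b \<in> Hom K B S" "b \<cdot> x = a"
    using extend_along_inflation[OF tri x a(2)] by metis
  note cb = Comp_Hom[OF b(1) a(3)]
  have "(w \<ominus> c \<cdot> b) \<cdot> x = Zero K A W"
    using Comp_sub_left[OF x w cb] Comp_assoc[OF x b(1) a(3)] b(2) a(4) sub_self[OF Comp_Hom[OF x w]] by simp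
  then obtain w' where w': "w' \<in> Hom K C W" "w' \<cdot> y = w \<ominus> c \<cdot> b"
    using factor_through_deflation[OF tri x sub_Hom[OF w cb]] by metis
  then have "(w \<ominus> c \<cdot> b) \<oplus> c \<cdot> b \<in> fac B W"
    using fac_Add facI[OF C t(2) w'(1)] facI[OF a(1) b(1) a(3)] by simp
  then show "w \<in> fac B W"
    using sub_Add[OF w cb] by simp
qed

text \<open>A Wakamatsu-type argument puts the third term of an approximation triangle into
  \<open>T\<close>: every extension of \<open>L\<close> by an object of \<open>T\<close> is a
  pushforward of \<delta> along a map that factors through the approximation, and pushing \<delta>
  along \<open>u\<close> kills it.\<close>

lemma ex_left_T_triangle:
  assumes "X \<in> Obj K"
  obtains L \<delta> u y S where "etriangle K X L \<delta> u y" "u \<in> Hom K X S" "S \<in> T" "L \<in> T"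
proof -
  obtain L \<delta> u y where tri: "etriangle K X L \<delta> u y" and la: "left_approx K T u"
    using cluster_tilting assms unfolding cluster_tilting_def strongly_covariantly_finite_def by blast
  obtain S where u: "u \<in> Hom K X S"
    using etriangleE[OF tri] by metis
  have S: "S \<in> T" and approx: "\<And>S' f. \<lbrakk>S' \<in> T; f \<in> Hom K X S'\<rbrakk> \<Longrightarrow> \<exists>c \<in> Hom K S S'. c \<cdot> u = f"
    using la unfolding left_approx_def Hom_Cod[OF u] Hom_Dom[OF u] by blast+
  note t = etriangle_D[OF tri disjI1[OF u]]
  have "L \<in> T"
  proof (rule in_T_if_Ext_from[OF t(5)])
    fix S' \<omega> assume S': "S' \<in> T" and d: "\<omega> \<in> carrier (Ext K L S')"
    note O = cluster_tilting_Obj[OF S']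
    obtain j r where jr: "etriangle K S' L \<omega> j r"
      using etriangle_ex[OF t(5) O d] by blast
    obtain N where r: "r \<in> Hom K N L"
      using jr etriangleE by metis
    obtain b where b: "b \<in> Hom K S N" "r \<cdot> b = y"
      using lift_through_deflation[OF jr r t(2)] rigid[OF S S' pull_closed[OF t(2) O d]] by metis
    \<comment> \<open>The lift \<open>b\<close> covers the identity of \<open>L\<close>, so the dual
      of (ET3) completes it to a morphism of triangles, which expresses \<omega> as the pushforward
      of \<delta> along \<open>a\<close>.\<close>
    obtain a where a: "a \<in> Hom K X S'" "push K L a \<delta> = pull K S' (Ident K L) \<omega>"
      using ET3_op_rule[OF tri jr t(2) r Ident_Hom[OF t(5)] b(1)] b(2) Comp_Ident_left[OF t(2)] by metis
    obtain c where c: "c \<in> Hom K S S'" "c \<cdot> u = a"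
      using approx[OF S' a(1)] by blast
    have "push K L a \<delta> = \<one>\<^bsub>Ext K L S'\<^esub>"
      using push_Comp[OF u c(1) t(5,6)] push_inflation[OF tri u] push_one[OF c(1) t(5)] c(2) by simp
    then show "\<omega> = \<one>\<^bsub>Ext K L S'\<^esub>"
      using a(2) pull_Ident[OF t(5) O d] by simp
  qed
  then show ?thesis
    using that tri u S by blast
qed

lemma Q_ex_cokernel:
  assumes f: "f \<in> Hom K X Y"
  shows "\<exists>g. is_cokernel Q g (cls f)"
proof -
  obtain L \<delta> u y S where tri: "etriangle K X L \<delta> u y" and u: "u \<in> Hom K X S" and S: "S \<in> T" "L \<in> T"
    using ex_left_T_triangle[OF Hom_Obj_Dom[OF f]] .
  note t = etriangle_D[OF tri disjI1[OF u]]
  let ?\<omega> = "push K L f \<delta>"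
  note Y = Hom_Obj_Cod[OF f] and d = push_closed[OF f t(5,6)]
  obtain g q where gq: "etriangle K Y L ?\<omega> g q"
    using etriangle_ex[OF t(5) Y d] by blast
  obtain M where g: "g \<in> Hom K Y M"
    using gq etriangleE by metis
  note r = etriangle_D[OF gq disjI1[OF g]]
  \<comment> \<open>The pushout morphism is realized by a map \<open>m\<close> from
    \<open>S\<close>, and \<open>g\<close> after \<open>f\<close> is \<open>m\<close> after
    \<open>u\<close>, hence zero in the quotient.\<close>
  have "ext_morphism K L X \<delta> L Y ?\<omega> f (Ident K L)"
    using ext_morphismI[OF t(6) d f Ident_Hom[OF t(5)]] pull_Ident[OF t(5) Y d] by simp
  then have "\<exists>m \<in> Hom K (Cod K u) (Cod K g). m \<cdot> u = g \<cdot> f \<and> q \<cdot> m = Ident K L \<cdot> y"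
    using Real_morphism t(7) r(7) by blast
  then obtain m where "m \<in> Hom K S M" "m \<cdot> u = g \<cdot> f"
    using Hom_Cod[OF u] Hom_Cod[OF g] by auto
  then have gf: "g \<cdot> f \<in> fac X M"
    using facI[OF S(1) u] by metis
  have "is_cokernel Q (cls g) (cls f)"
  proof (rule Q_cokernelI[OF f g gf Q_epi_inflation[OF gq g S(2)]])
    fix W w assume w: "w \<in> Hom K Y W" and "w \<cdot> f \<in> fac X W"
    then obtain S' a c where a: "S' \<in> T" "a \<in> Hom K X S'" "c \<in> Hom K S' W" "w \<cdot> f = c \<cdot> a"
      using facE by metis
    \<comment> \<open>Pushing \<delta> along \<open>w\<close> after \<open>f\<close> is the same as
      pushing it along \<open>c\<close> after \<open>a\<close>, and already the pushforward along
      \<open>a\<close> is an extension between objects of \<open>T\<close>.\<close>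
    have "push K L w ?\<omega> = \<one>\<^bsub>Ext K L W\<^esub>"
      using push_Comp[OF f w t(5,6)] push_Comp[OF a(2,3) t(5,6)] a(4)
        rigid[OF S(2) a(1) push_closed[OF a(2) t(5,6)]] push_one[OF a(3) t(5)] by simp
    then obtain w' where w': "w' \<in> Hom K M W" "w' \<cdot> g = w"
      using extend_along_inflation[OF gq g w] by metis
    then show "\<exists>w' \<in> Hom K M W. w \<ominus> w' \<cdot> g \<in> fac Y W"
      using sub_self[OF w] fac_Zero[OF Y Hom_Obj_Cod[OF w]] by metis
  qed
  then show ?thesis by blast
qed

text \<open>For an inflation \<open>u\<close> from the middle term N to an object of T, (ET4) provides an object E with an
  extension restricting to \<open>\<delta>\<close>. As \<open>r\<close> is epi, E is a zero object of the quotient, hence lies in T,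
  so that the extension on E splits.\<close>

lemma split_if_Q_epi:
  assumes tri: "etriangle K S Y \<delta> j r" and r: "r \<in> Hom K N Y" and S: "S \<in> T"
    and epi: "is_epi Q (cls r)"
  shows "\<delta> = \<one>\<^bsub>Ext K Y S\<^esub>"
proof -
  note t = etriangle_D[OF tri disjI2[OF r]]
  obtain L \<nu> u v S' where tri': "etriangle K N L \<nu> u v" and u: "u \<in> Hom K N S'" and S': "S' \<in> T" "L \<in> T"
    using ex_left_T_triangle[OF t(4)] .
  obtain E h' d e \<delta>'' where E: "E \<in> Obj K" "h' \<in> Hom K S' E" "d \<in> Hom K Y E" "e \<in> Hom K E L"
    "etriangle K S E \<delta>'' (u \<cdot> j) h'" "d \<cdot> r = h' \<cdot> u"
    "etriangle K Y L (push K L r \<nu>) d e" "pull K S d \<delta>'' = \<delta>"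
    using ET4_rule[OF tri tri' t(1) u] by metis
  \<comment> \<open>The composite of \<open>d\<close> with the epi \<open>r\<close> is
    \<open>h'\<close> after \<open>u\<close>, which passes through the object \<open>S'\<close> of
    \<open>T\<close>.\<close>
  have "d \<in> fac Y E"
    using epi[unfolded Q_epi_iff[OF r]] E(3,6) facI[OF S'(1) u E(2)] by metis
  \<comment> \<open>As an inflation with third term \<open>L\<close> in \<open>T\<close>, the arrow
    \<open>d\<close> is also epi in the quotient; a zero map that is epi has zero target.\<close>
  then have "Ident K E \<in> fac E E"
    using Q_epi_inflation[OF E(7,3) S'(2), unfolded Q_epi_iff[OF E(3)]] Ident_Hom[OF E(1)] Comp_Ident_left[OF E(3)]
    by metis
  then have "E \<in> T"
    using Ident_fac_iff[OF E(1)] by blast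
  then have "\<delta>'' = \<one>\<^bsub>Ext K E S\<^esub>"
    using rigid[OF _ S] E(5) etriangleE by metis
  then show ?thesis
    using E(8) pull_one[OF E(3) t(3)] by simp
qed

text \<open>The arrow with cokernel \<open>f\<close> is the component in \<open>X\<close> of the
  fibre \<open>m\<close> of (f,s). If \<open>w\<close> composed with it equals \<open>c\<close>
  after \<open>a\<close> through \<open>T\<close>, everything depends on extending \<open>a\<close>
  along \<open>m\<close> to some \<open>a'\<close>: then \<open>w\<close> after \<open>p1\<close>
  minus \<open>c\<close> after \<open>a'\<close> kills \<open>m\<close> and descends to
  \<open>Y\<close>.\<close>

lemma Q_epi_is_cokernel:
  assumes f: "f \<in> Hom K X Y" and epi: "is_epi Q (cls f)"
  shows "\<exists>k. is_cokernel Q (cls f) k"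
proof -
  have X: "X \<in> Obj K" and Y: "Y \<in> Obj K"
    using f Hom_Obj_Dom Hom_Obj_Cod by auto
  obtain A \<rho> i s where tri: "etriangle K A Y \<rho> i s" and ra: "right_approx K T s"
    using cluster_tilting Y unfolding cluster_tilting_def strongly_contravariantly_finite_def by blast
  obtain S where s: "s \<in> Hom K S Y"
    using etriangleE[OF tri] by metis
  have S: "S \<in> T"
    using ra unfolding right_approx_def Hom_Dom[OF s] by blast
  obtain V i1 i2 p1 p2 where bip: "biproduct K X S V i1 i2 p1 p2"
    using ex_biproduct[OF X cluster_tilting_Obj[OF S]] by blast
  note b = biproduct_D[OF bip]
  let ?F = "(f \<cdot> p1) \<oplus> (s \<cdot> p2)"
  note fp = Comp_Hom[OF b(3) f] and sp = Comp_Hom[OF b(4) s]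
  have F: "?F \<in> Hom K V Y"
    using Add_Hom[OF fp sp] .
  obtain M \<tau> m where M: "etriangle K M Y \<tau> m ?F"
    using deflation_copair[OF tri s f bip] by blast
  note t = etriangle_D[OF M disjI2[OF F]]
  note k = Comp_Hom[OF t(1) b(3)]
  note spm = Comp_Hom[OF t(1) sp]
  have Fi: "?F \<cdot> i1 = f"
    using Comp_Add_left[OF b(1) fp sp] Comp_assoc[OF b(1,3) f] Comp_assoc[OF b(1,4) s] b(5,8)
      Comp_Ident_right[OF f] Comp_Zero_right[OF s X] Add_Zero[OF f] by simp
  have "is_cokernel Q (cls f) (cls (p1 \<cdot> m))"
  proof (rule Q_cokernelI[OF k f _ epi])
    \<comment> \<open>The two components of the zero composite are negatives of each other, and the
      one through \<open>s\<close> passes through the object \<open>S\<close> of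
      \<open>T\<close>.\<close>
    have "(s \<cdot> p2) \<cdot> m \<oplus> f \<cdot> (p1 \<cdot> m) = Zero K M Y"
      using deflation_inflation_Zero[OF M t(1)] Comp_Add_left[OF t(1) fp sp] Comp_assoc[OF t(1) b(3) f]
        Add_commute[OF spm Comp_Hom[OF k f]] by simp
    then have "f \<cdot> (p1 \<cdot> m) = neg K ((s \<cdot> p2) \<cdot> m)"
      using neg_unique[OF spm Comp_Hom[OF k f]] by simp
    then show "f \<cdot> (p1 \<cdot> m) \<in> fac M Y"
      using fac_neg[OF fac_Comp_right[OF t(1) facI[OF S b(4) s]]] by simp
    fix W w assume w: "w \<in> Hom K X W" and "w \<cdot> (p1 \<cdot> m) \<in> fac M W"
    then obtain S' a c where a: "S' \<in> T" "a \<in> Hom K M S'" "c \<in> Hom K S' W" "w \<cdot> (p1 \<cdot> m) = c \<cdot> a"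
      using facE by metis
    note O = cluster_tilting_Obj[OF a(1)]
    \<comment> \<open>This extension is the obstruction to extending \<open>a\<close> along
      \<open>m\<close>.\<close>
    let ?\<omega> = "push K Y a \<tau>"
    note d = push_closed[OF a(2) Y t(6)]
    obtain j r where jr: "etriangle K S' Y ?\<omega> j r"
      using etriangle_ex[OF Y O d] by blast
    obtain N where r: "r \<in> Hom K N Y"
      using jr etriangleE by metis
    have "pull K S' ?F ?\<omega> = \<one>\<^bsub>Ext K V S'\<^esub>"
      using pull_push[OF F a(2) t(6)] pull_deflation[OF M F] push_one[OF a(2) Hom_Obj_Dom[OF F]] by simp
    then obtain b' where b': "b' \<in> Hom K V N" "r \<cdot> b' = ?F"
      using lift_through_deflation[OF jr r F] by metis
    have ri: "r \<cdot> (b' \<cdot> i1) = f"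
      using Comp_assoc[OF b(1) b'(1) r] b'(2) Fi by simp
    note bi = Comp_Hom[OF b(1) b'(1)]
    \<comment> \<open>The pullback of the obstruction along the deflation \<open>?F\<close> is
      trivial, so \<open>?F\<close>, and with it \<open>f\<close>, factors through \<open>r\<close>;
      thus \<open>r\<close> is epi because \<open>f\<close> is.\<close>
    have "is_epi Q (cls r)"
      unfolding Q_epi_iff[OF r]
    proof (intro allI impI)
      fix U z assume z: "z \<in> Hom K Y U" and "z \<cdot> r \<in> fac N U"
      then have "z \<cdot> f \<in> fac X U"
        using fac_Comp_right[OF bi] Comp_assoc[OF bi r z] ri by metis
      then show "z \<in> fac Y U"
        using epi[unfolded Q_epi_iff[OF f]] z by blast
    qed
    then have "?\<omega> = \<one>\<^bsub>Ext K Y S'\<^esub>"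
      using split_if_Q_epi[OF jr r a(1)] by blast
    then obtain a' where a': "a' \<in> Hom K V S'" "a' \<cdot> m = a"
      using extend_along_inflation[OF M t(1) a(2)] by metis
    note wp = Comp_Hom[OF b(3) w] and ca = Comp_Hom[OF a'(1) a(3)]
    have "(w \<cdot> p1 \<ominus> c \<cdot> a') \<cdot> m = Zero K M W"
      using Comp_sub_left[OF t(1) wp ca] Comp_assoc[OF t(1) b(3) w] Comp_assoc[OF t(1) a'(1) a(3)] a'(2) a(4)
        sub_self[OF Comp_Hom[OF k w]] by simp
    then obtain w' where w': "w' \<in> Hom K Y W" "w' \<cdot> ?F = w \<cdot> p1 \<ominus> c \<cdot> a'"
      using factor_through_deflation[OF M t(1) sub_Hom[OF wp ca]] by metis
    let ?h = "(c \<cdot> a') \<cdot> i1"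
    note ha = Comp_Hom[OF b(1) ca]
    \<comment> \<open>Restriction along \<open>i1\<close> turns \<open>?F\<close> into
      \<open>f\<close> and leaves an error term through \<open>T\<close>.\<close>
    have "w' \<cdot> f = w \<ominus> ?h"
      using Comp_assoc[OF b(1) F w'(1)] Fi w'(2) Comp_sub_left[OF b(1) wp ca] Comp_assoc[OF b(1,3) w] b(5)
        Comp_Ident_right[OF w] by simp
    then have "w = ?h \<oplus> w' \<cdot> f"
      using sub_Add[OF w ha] Add_commute[OF sub_Hom[OF w ha] ha] by simp
    then have "w \<ominus> w' \<cdot> f = ?h"
      using Add_sub[OF ha Comp_Hom[OF f w'(1)]] by metis
    then show "\<exists>w' \<in> Hom K Y W. w \<ominus> w' \<cdot> f \<in> fac X W"
      using w'(1) fac_Comp_right[OF b(1) facI[OF a(1) a'(1) a(3)]] by metis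
  qed
  then show ?thesis by blast
qed

end

text \<open>Left and right approximations change places, and so do the two Ext-characterisations of
  \<open>T\<close>.\<close>

lemma cluster_tilting_subcategory_opp:
  assumes "cluster_tilting_subcategory K T"
  shows "cluster_tilting_subcategory (opp K) T"
proof -
  interpret cluster_tilting_subcategory K T by fact
  note o = opposite_simps[OF opposite_opp[of K]]
  have "right_approx (opp K) T g \<longleftrightarrow> left_approx K T g" "left_approx (opp K) T g \<longleftrightarrow> right_approx K T g" for g
    unfolding right_approx_def left_approx_def o by blast+
  then have "cluster_tilting (opp K) T"
    using cluster_tilting
    unfolding cluster_tilting_def strongly_contravariantly_finite_def strongly_covariantly_finite_def
      iso_closed_def isomorphic_opposite[OF opposite_opp category_axioms] o etriangle_opp opp_simps
    by blast
  then show ?thesis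
    using extriangulated_category_opp[OF extriangulated_category_axioms]
    by (simp add: cluster_tilting_subcategory_def cluster_tilting_subcategory_axioms_def)
qed

lemma (in cluster_tilting_subcategory) Q_mono_deflation:
  assumes "etriangle K A C \<delta> x y" "y \<in> Hom K B C" "A \<in> T"
  shows "is_mono Q (cls y)"
proof -
  interpret L: cluster_tilting_subcategory "opp K" T
    using cluster_tilting_subcategory_opp[OF cluster_tilting_subcategory_axioms] .
  have "arr_class (opp K) T y = cls y"
    by (simp add: arr_class_def factoring_def opposite_simps[OF opposite_opp])
      (metis (no_types, opaque_lifting))
  then show ?thesis
    using L.Q_epi_inflation[of C A \<delta> y x B] assms mono_opposite[OF quot_cat_opposite[OF opposite_opp[of K]]]
      epi_opposite[OF quot_cat_opposite[OF opposite_opp[of K]]]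
    by (simp add: opposite_simps[OF opposite_opp])
qed

text \<open>Kernels and normality of monos are the cokernel results for the opposite structure, read
  back through the opposite quotient.\<close>

theorem (in cluster_tilting_subcategory) abelian_category_Q: "abelian_category Q"
proof -
  interpret L: cluster_tilting_subcategory "opp K" T
    using cluster_tilting_subcategory_opp[OF cluster_tilting_subcategory_axioms] .
  note opQ = quot_cat_opposite[OF opposite_opp[of K], of T]
  show ?thesis
  proof (intro abelian_category.intro abelian_category_axioms.intro additive_category_Q)
    show "\<exists>q. is_cokernel Q q U" if "U \<in> Arr Q" for U
      using that Q_ArrE Q_ex_cokernel by metis
    show "\<exists>k. is_cokernel Q U k" if "is_epi Q U" for U
      using that Q_ArrE Q_epi_is_cokernel unfolding is_epi_def by (metis that)
    show "\<exists>k. is_kernel Q k U" if "U \<in> Arr Q" for U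
      using that L.Q_ArrE L.Q_ex_cokernel cokernel_opposite[OF opQ] opposite_simps(2)[OF opQ] by metis
    show "\<exists>k. is_kernel Q U k" if "is_mono Q U" for U
      using that L.Q_ArrE L.Q_epi_is_cokernel cokernel_opposite[OF opQ] epi_opposite[OF opQ]
        opposite_simps(2)[OF opQ] unfolding is_mono_def by metis
  qed
qed

section \<open>Functors and adjunctions\<close>

text \<open>The quotients carry no extensions, so \<open>opp\<close> does not apply to them; this is
  the opposite of the underlying additive structure alone.\<close>

definition opposite_cat :: "('o, 'm, 'z) precat_scheme \<Rightarrow> ('o, 'm) precat" where
  "opposite_cat K = \<lparr>Obj = Obj K, Arr = Arr K, Dom = Cod K, Cod = Dom K, Ident = Ident K,
     Comp = (\<lambda>g f. f \<cdot>\<^bsub>K\<^esub> g), Add = Add K, Zero = (\<lambda>X Y. Zero K Y X)\<rparr>"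

lemma opposite_cat: "opposite K (opposite_cat K)"
  by (simp add: opposite_def opposite_cat_def)

lemma functor_Obj: "\<lbrakk>is_functor C D F; X \<in> Obj C\<rbrakk> \<Longrightarrow> FO F X \<in> Obj D"
  and functor_Ident: "\<lbrakk>is_functor C D F; X \<in> Obj C\<rbrakk> \<Longrightarrow> FM F (Ident C X) = Ident D (FO F X)"
  and functor_Hom: "\<lbrakk>is_functor C D F; f \<in> Hom C X Y\<rbrakk> \<Longrightarrow> FM F f \<in> Hom D (FO F X) (FO F Y)"
  and functor_Comp: "\<lbrakk>is_functor C D F; f \<in> Hom C X Y; g \<in> Hom C Y Z\<rbrakk>
    \<Longrightarrow> FM F (g \<cdot>\<^bsub>C\<^esub> f) = FM F g \<cdot>\<^bsub>D\<^esub> FM F f"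
  by (auto simp: is_functor_def Hom_def)

lemma functor_isomorphism:
  assumes F: "is_functor C D F" and "category C" "category D" and f: "f \<in> Hom C X Y" "is_isomorphism C f"
  shows "is_isomorphism D (FM F f)"
proof -
  interpret C: category C by fact
  interpret D: category D by fact
  obtain g where g: "g \<in> Hom C Y X" "g \<cdot>\<^bsub>C\<^esub> f = Ident C X" "f \<cdot>\<^bsub>C\<^esub> g = Ident C Y"
    using C.isomorphismE f by blast
  show ?thesis
    by (rule D.isomorphismI[OF functor_Hom[OF F f(1)] functor_Hom[OF F g(1)]])
      (simp_all flip: functor_Comp[OF F f(1) g(1)] functor_Comp[OF F g(1) f(1)]
        add: g functor_Ident[OF F] C.Hom_Obj_Dom[OF f(1)] C.Hom_Obj_Cod[OF f(1)])
qed

lemma functor_isomorphic: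
  assumes "is_functor C D F" "category C" "category D" "isomorphic C X Y"
  shows "isomorphic D (FO F X) (FO F Y)"
  using assms functor_isomorphism functor_Hom unfolding isomorphic_def by metis

locale additive_functor_between = C: additive_category C + D: additive_category D
  for C :: "('o, 'm, 'z) precat_scheme" and D :: "('p, 'n, 'y) precat_scheme" +
  fixes F :: "('o, 'm, 'p, 'n) fct"
  assumes additive: "additive_functor C D F"
begin

lemma F_functor: "is_functor C D F"
  using additive by (simp add: additive_functor_def)

lemmas F_Obj = functor_Obj[OF F_functor]
  and F_Ident = functor_Ident[OF F_functor]
  and F_Hom = functor_Hom[OF F_functor]
  and F_Comp = functor_Comp[OF F_functor]

lemma F_Add:
  assumes "f \<in> Hom C X Y" "g \<in> Hom C X Y"
  shows "FM F (f \<oplus>\<^bsub>C\<^esub> g) = FM F f \<oplus>\<^bsub>D\<^esub> FM F g"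
proof -
  have "FM F \<in> hom (HomG C X Y) (HomG D (FO F X) (FO F Y))"
    using additive C.Hom_Obj_Dom[OF assms(1)] C.Hom_Obj_Cod[OF assms(1)] by (simp add: additive_functor_def)
  then show ?thesis
    using assms by (simp add: hom_def HomG_def)
qed

lemma F_Zero:
  assumes "X \<in> Obj C" "Y \<in> Obj C"
  shows "FM F (Zero C X Y) = Zero D (FO F X) (FO F Y)"
proof -
  note 0 = C.Zero_Hom[OF assms]
  show ?thesis
    using F_Add[OF 0 0] C.Add_Zero[OF 0] D.Zero_unique[OF F_Hom[OF 0]] by simp
qed

lemma F_sub:
  assumes f: "f \<in> Hom C X Y" and g: "g \<in> Hom C X Y"
  shows "FM F (f \<ominus>\<^bsub>C\<^esub> g) = FM F f \<ominus>\<^bsub>D\<^esub> FM F g"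
  using F_Add[OF C.sub_Hom[OF f g] g] C.sub_Add[OF f g]
    D.Add_sub[OF F_Hom[OF C.sub_Hom[OF f g]] F_Hom[OF g]] by simp

lemma F_zero_object: "is_zero_object C Z \<Longrightarrow> is_zero_object D (FO F Z)"
  using F_Ident F_Zero F_Obj C.zero_object_iff D.zero_object_iff by metis

lemma F_biproduct:
  assumes "biproduct C X Y S i1 i2 p1 p2"
  shows "biproduct D (FO F X) (FO F Y) (FO F S) (FM F i1) (FM F i2) (FM F p1) (FM F p2)"
proof -
  note b = C.biproduct_D[OF assms]
  have O: "X \<in> Obj C" "Y \<in> Obj C" "S \<in> Obj C"
    using b(1,2) C.Hom_Obj_Dom C.Hom_Obj_Cod by auto
  show ?thesis
    unfolding biproduct_def
    using F_Hom[OF b(1)] F_Hom[OF b(2)] F_Hom[OF b(3)] F_Hom[OF b(4)]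
      F_Comp[OF b(1,3)] F_Comp[OF b(2,4)] F_Comp[OF b(2,3)] F_Comp[OF b(1,4)] F_Comp[OF b(3,1)] F_Comp[OF b(4,2)]
      F_Add[OF C.Comp_Hom[OF b(3,1)] C.Comp_Hom[OF b(4,2)]] b(5-9) F_Ident O F_Zero
    by metis
qed

end

locale adjoint_pair = C: category C + D: category D
  for C :: "('o, 'm, 'z) precat_scheme" and D :: "('p, 'n, 'y) precat_scheme" +
  fixes F :: "('o, 'm, 'p, 'n) fct" and G :: "('p, 'n, 'o, 'm) fct" and \<eta> \<epsilon>
  assumes adjunction: "adjunction C D F G \<eta> \<epsilon>"
begin

lemma F_functor: "is_functor C D F" and G_functor: "is_functor D C G"
  using adjunction by (auto simp: adjunction_def)

lemmas F_Obj = functor_Obj[OF F_functor] and G_Obj = functor_Obj[OF G_functor]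
  and F_Ident = functor_Ident[OF F_functor]
  and F_Hom = functor_Hom[OF F_functor] and G_Hom = functor_Hom[OF G_functor]
  and F_Comp = functor_Comp[OF F_functor] and G_Comp = functor_Comp[OF G_functor]

lemma unit_Hom: "X \<in> Obj C \<Longrightarrow> \<eta> X \<in> Hom C X (FO G (FO F X))"
  and counit_Hom: "Y \<in> Obj D \<Longrightarrow> \<epsilon> Y \<in> Hom D (FO F (FO G Y)) Y"
  and counit_F_unit: "X \<in> Obj C \<Longrightarrow> \<epsilon> (FO F X) \<cdot>\<^bsub>D\<^esub> FM F (\<eta> X) = Ident D (FO F X)"
  and G_counit_unit: "Y \<in> Obj D \<Longrightarrow> FM G (\<epsilon> Y) \<cdot>\<^bsub>C\<^esub> \<eta> (FO G Y) = Ident C (FO G Y)"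
  using adjunction by (auto simp: adjunction_def)

lemma unit_natural: "f \<in> Hom C X Y \<Longrightarrow> \<eta> Y \<cdot>\<^bsub>C\<^esub> f = FM G (FM F f) \<cdot>\<^bsub>C\<^esub> \<eta> X"
  and counit_natural: "g \<in> Hom D U V \<Longrightarrow> \<epsilon> V \<cdot>\<^bsub>D\<^esub> FM F (FM G g) = g \<cdot>\<^bsub>D\<^esub> \<epsilon> U"
  using adjunction by (auto simp: adjunction_def Hom_def)

text \<open>Naturality of the unit followed by a triangle identity. Together with the next lemma
  this is the hom-set bijection of the adjunction.\<close>

lemma transpose_transpose_left:
  assumes f: "f \<in> Hom C X (FO G Y)" and Y: "Y \<in> Obj D"
  shows "FM G (\<epsilon> Y \<cdot>\<^bsub>D\<^esub> FM F f) \<cdot>\<^bsub>C\<^esub> \<eta> X = f"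
proof -
  note X = C.Hom_Obj_Dom[OF f] and Ff = F_Hom[OF f] and e = counit_Hom[OF Y]
  have "FM G (\<epsilon> Y \<cdot>\<^bsub>D\<^esub> FM F f) \<cdot>\<^bsub>C\<^esub> \<eta> X = FM G (\<epsilon> Y) \<cdot>\<^bsub>C\<^esub> (\<eta> (FO G Y) \<cdot>\<^bsub>C\<^esub> f)"
    using G_Comp[OF Ff e] C.Comp_assoc[OF unit_Hom[OF X] G_Hom[OF Ff] G_Hom[OF e]] unit_natural[OF f] by simp
  also have "\<dots> = f"
    using C.Comp_assoc[OF f unit_Hom[OF G_Obj[OF Y]] G_Hom[OF e]] G_counit_unit[OF Y] C.Comp_Ident_left[OF f]
    by simp
  finally show ?thesis .
qed

lemma transpose_transpose_right:
  assumes g: "g \<in> Hom D (FO F X) Y" and X: "X \<in> Obj C"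
  shows "\<epsilon> Y \<cdot>\<^bsub>D\<^esub> FM F (FM G g \<cdot>\<^bsub>C\<^esub> \<eta> X) = g"
proof -
  note Y = D.Hom_Obj_Cod[OF g] and Gg = G_Hom[OF g] and e = unit_Hom[OF X]
  have "\<epsilon> Y \<cdot>\<^bsub>D\<^esub> FM F (FM G g \<cdot>\<^bsub>C\<^esub> \<eta> X) = (g \<cdot>\<^bsub>D\<^esub> \<epsilon> (FO F X)) \<cdot>\<^bsub>D\<^esub> FM F (\<eta> X)"
    using F_Comp[OF e Gg] D.Comp_assoc[OF F_Hom[OF e] F_Hom[OF Gg] counit_Hom[OF Y]] counit_natural[OF g] by simp
  also have "\<dots> = g"
    using D.Comp_assoc[OF F_Hom[OF e] counit_Hom[OF F_Obj[OF X]] g] counit_F_unit[OF X] D.Comp_Ident_right[OF g]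
    by simp
  finally show ?thesis .
qed

lemma transpose_left_Hom:
  "\<lbrakk>f \<in> Hom C X (FO G Y); Y \<in> Obj D\<rbrakk> \<Longrightarrow> \<epsilon> Y \<cdot>\<^bsub>D\<^esub> FM F f \<in> Hom D (FO F X) Y"
  using D.Comp_Hom[OF F_Hom counit_Hom] .

lemma transpose_right_Hom:
  "\<lbrakk>g \<in> Hom D (FO F X) Y; X \<in> Obj C\<rbrakk> \<Longrightarrow> FM G g \<cdot>\<^bsub>C\<^esub> \<eta> X \<in> Hom C X (FO G Y)"
  using C.Comp_Hom[OF unit_Hom G_Hom] .

text \<open>Fullness writes the counit at \<open>F X\<close> as the image of some \<open>s\<close>,
  and faithfulness and the triangle identities make \<open>s\<close> inverse to the unit.\<close>

lemma unit_isomorphism: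
  assumes ff: "fully_faithful C D F" and X: "X \<in> Obj C"
  shows "is_isomorphism C (\<eta> X)"
proof -
  let ?GF = "FO G (FO F X)"
  note FX = F_Obj[OF X] and e = unit_Hom[OF X]
  note GFX = G_Obj[OF FX]
  note inj = ff[unfolded fully_faithful_def, rule_format, THEN bij_betw_imp_inj_on, THEN inj_onD]
  have "\<epsilon> (FO F X) \<in> FM F ` Hom C ?GF X"
    using ff GFX X counit_Hom[OF FX] unfolding fully_faithful_def bij_betw_def by blast
  then obtain s where s: "s \<in> Hom C ?GF X" "FM F s = \<epsilon> (FO F X)"
    by auto
  have "FM F (s \<cdot>\<^bsub>C\<^esub> \<eta> X) = FM F (Ident C X)"
    using F_Comp[OF e s(1)] s(2) counit_F_unit[OF X] F_Ident[OF X] by simp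
  then have "s \<cdot>\<^bsub>C\<^esub> \<eta> X = Ident C X"
    using inj[OF X X] C.Comp_Hom[OF e s(1)] C.Ident_Hom[OF X] by blast
  moreover have "\<eta> X \<cdot>\<^bsub>C\<^esub> s = Ident C ?GF"
    using unit_natural[OF s(1)] s(2) G_counit_unit[OF FX] by simp
  ultimately show ?thesis
    using C.isomorphismI[OF e s(1)] by blast
qed

text \<open>Invertibility of the unit passes to quotient categories, so this converse recovers full
  faithfulness of the induced functors.\<close>

lemma fully_faithful_left:
  assumes iso: "\<And>X. X \<in> Obj C \<Longrightarrow> is_isomorphism C (\<eta> X)"
  shows "fully_faithful C D F"
  unfolding fully_faithful_def
proof (intro ballI)
  fix X Y assume X: "X \<in> Obj C" and Y: "Y \<in> Obj C"
  note eX = unit_Hom[OF X] and eY = unit_Hom[OF Y]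
  obtain s where s: "s \<in> Hom C (FO G (FO F Y)) Y" "s \<cdot>\<^bsub>C\<^esub> \<eta> Y = Ident C Y" "\<eta> Y \<cdot>\<^bsub>C\<^esub> s = Ident C (FO G (FO F Y))"
    using C.isomorphismE[OF iso[OF Y] eY] by metis
  show "bij_betw (FM F) (Hom C X Y) (Hom D (FO F X) (FO F Y))"
  proof (rule bij_betw_byWitness[where f' = "\<lambda>g. s \<cdot>\<^bsub>C\<^esub> (FM G g \<cdot>\<^bsub>C\<^esub> \<eta> X)"])
    show "\<forall>f \<in> Hom C X Y. s \<cdot>\<^bsub>C\<^esub> (FM G (FM F f) \<cdot>\<^bsub>C\<^esub> \<eta> X) = f"
    proof
      fix f assume f: "f \<in> Hom C X Y"
      show "s \<cdot>\<^bsub>C\<^esub> (FM G (FM F f) \<cdot>\<^bsub>C\<^esub> \<eta> X) = f"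
        using unit_natural[OF f] C.Comp_assoc[OF f eY s(1)] s(2) C.Comp_Ident_left[OF f] by simp
    qed
    show "\<forall>g \<in> Hom D (FO F X) (FO F Y). FM F (s \<cdot>\<^bsub>C\<^esub> (FM G g \<cdot>\<^bsub>C\<^esub> \<eta> X)) = g"
    proof
      fix g assume g: "g \<in> Hom D (FO F X) (FO F Y)"
      note h = transpose_right_Hom[OF g X]
      note sh = C.Comp_Hom[OF h s(1)]
      have "\<eta> Y \<cdot>\<^bsub>C\<^esub> (s \<cdot>\<^bsub>C\<^esub> (FM G g \<cdot>\<^bsub>C\<^esub> \<eta> X)) = FM G g \<cdot>\<^bsub>C\<^esub> \<eta> X"
        using C.Comp_assoc[OF h s(1) eY] s(3) C.Comp_Ident_left[OF h] by simp
      then show "FM F (s \<cdot>\<^bsub>C\<^esub> (FM G g \<cdot>\<^bsub>C\<^esub> \<eta> X)) = g"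
        using unit_natural[OF sh] transpose_transpose_right[OF F_Hom[OF sh] X] transpose_transpose_right[OF g X]
        by simp
    qed
    show "FM F ` Hom C X Y \<subseteq> Hom D (FO F X) (FO F Y)"
      using F_Hom by blast
    show "(\<lambda>g. s \<cdot>\<^bsub>C\<^esub> (FM G g \<cdot>\<^bsub>C\<^esub> \<eta> X)) ` Hom D (FO F X) (FO F Y) \<subseteq> Hom C X Y"
      using C.Comp_Hom[OF transpose_right_Hom[OF _ X] s(1)] by blast
  qed
qed

text \<open>Two maps into \<open>G U\<close> with equal composites have transposes with equal
  composites with \<open>k\<close>, and transposition is injective.\<close>

lemma G_mono:
  assumes k: "k \<in> Hom D U V" and mono: "is_mono D k"
  shows "is_mono C (FM G k)"
  unfolding C.mono_iff[OF G_Hom[OF k]]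
proof (intro allI impI)
  fix W u v assume u: "u \<in> Hom C W (FO G U)" and v: "v \<in> Hom C W (FO G U)"
    and eq: "FM G k \<cdot>\<^bsub>C\<^esub> u = FM G k \<cdot>\<^bsub>C\<^esub> v"
  note U = D.Hom_Obj_Dom[OF k] and V = D.Hom_Obj_Cod[OF k]
  have *: "k \<cdot>\<^bsub>D\<^esub> (\<epsilon> U \<cdot>\<^bsub>D\<^esub> FM F u) = \<epsilon> V \<cdot>\<^bsub>D\<^esub> FM F (FM G k \<cdot>\<^bsub>C\<^esub> u)" if u: "u \<in> Hom C W (FO G U)" for u
    using F_Comp[OF u G_Hom[OF k]] D.Comp_assoc[OF F_Hom[OF u] F_Hom[OF G_Hom[OF k]] counit_Hom[OF V]]
      counit_natural[OF k] D.Comp_assoc[OF F_Hom[OF u] counit_Hom[OF U] k] by simp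
  then have "\<epsilon> U \<cdot>\<^bsub>D\<^esub> FM F u = \<epsilon> U \<cdot>\<^bsub>D\<^esub> FM F v"
    using mono[unfolded D.mono_iff[OF k]] transpose_left_Hom[OF u U] transpose_left_Hom[OF v U] u v eq by metis
  then show "u = v"
    using transpose_transpose_left[OF u U] transpose_transpose_left[OF v U] by metis
qed

lemma opposite_adjoint_pair: "adjoint_pair (opposite_cat D) (opposite_cat C) G F \<epsilon> \<eta>"
  using adjunction_opposite[OF opposite_cat opposite_cat adjunction]
    category_opposite[OF opposite_cat C.category_axioms] category_opposite[OF opposite_cat D.category_axioms]
  by (simp add: adjoint_pair_def adjoint_pair_axioms_def)

lemma counit_isomorphism:
  assumes "fully_faithful D C G" "Y \<in> Obj D"
  shows "is_isomorphism D (\<epsilon> Y)"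
  using adjoint_pair.unit_isomorphism[OF opposite_adjoint_pair] assms
  unfolding fully_faithful_opposite[OF opposite_cat opposite_cat] isomorphism_opposite[OF opposite_cat]
    opposite_simps(1)[OF opposite_cat] by blast

lemma fully_faithful_right:
  assumes "\<And>Y. Y \<in> Obj D \<Longrightarrow> is_isomorphism D (\<epsilon> Y)"
  shows "fully_faithful D C G"
  using adjoint_pair.fully_faithful_left[OF opposite_adjoint_pair] assms
  unfolding fully_faithful_opposite[OF opposite_cat opposite_cat] isomorphism_opposite[OF opposite_cat]
    opposite_simps(1)[OF opposite_cat] by blast

lemma F_epi:
  assumes "k \<in> Hom C U V" "is_epi C k"
  shows "is_epi D (FM F k)"
  using adjoint_pair.G_mono[OF opposite_adjoint_pair, of k V U] assms
  unfolding mono_opposite[OF opposite_cat] opposite_simps(9)[OF opposite_cat] by blast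

end

section \<open>Abelian categories reflected by adjoints\<close>

context additive_category
begin

text \<open>Trades unique existence for existence and a mono condition, the form in which adjoints
  transport kernels.\<close>

lemma kernel_iff:
  assumes k: "k \<in> Hom C Z X" and f: "f \<in> Hom C X Y"
  shows "is_kernel C k f \<longleftrightarrow> f \<cdot> k = Zero C Z Y \<and> is_mono C k \<and>
    (\<forall>W g. g \<in> Hom C W X \<longrightarrow> f \<cdot> g = Zero C W Y \<longrightarrow> (\<exists>u \<in> Hom C W Z. k \<cdot> u = g))"
    (is "?L \<longleftrightarrow> ?R")
proof
  note d = Hom_Dom[OF k] Hom_Cod[OF k] Hom_Dom[OF f] Hom_Cod[OF f]
  assume L: ?L
  have fk: "f \<cdot> k = Zero C Z Y"
    using L unfolding is_kernel_def d by blast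
  have ex1: "\<exists>!u. u \<in> Hom C W Z \<and> k \<cdot> u = g" if "g \<in> Hom C W X" "f \<cdot> g = Zero C W Y" for W g
    using L that unfolding is_kernel_def d by (metis Hom_Arr Hom_Cod Hom_Dom)
  have "is_mono C k"
    unfolding mono_iff[OF k]
  proof (intro allI impI)
    fix W u v assume u: "u \<in> Hom C W Z" and v: "v \<in> Hom C W Z" and eq: "k \<cdot> u = k \<cdot> v"
    have "f \<cdot> (k \<cdot> u) = Zero C W Y"
      using Comp_assoc[OF u k f] fk Comp_Zero_left[OF u Hom_Obj_Cod[OF f]] by simp
    then show "u = v"
      using ex1[OF Comp_Hom[OF u k]] u v eq by metis
  qed
  then show ?R
    using fk ex1 by blast
next
  note d = Hom_Dom[OF k] Hom_Cod[OF k] Hom_Dom[OF f] Hom_Cod[OF f]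
  assume R: ?R
  show ?L
    unfolding is_kernel_def d
  proof (intro conjI ballI impI)
    fix g assume g: "g \<in> Arr C" and "Cod C g = X \<and> f \<cdot> g = Zero C (Dom C g) Y"
    then have g': "g \<in> Hom C (Dom C g) X" "f \<cdot> g = Zero C (Dom C g) Y"
      by (auto simp: Hom_def)
    then obtain u where "u \<in> Hom C (Dom C g) Z" "k \<cdot> u = g"
      using R by metis
    then show "\<exists>!u. u \<in> Hom C (Dom C g) Z \<and> k \<cdot> u = g"
      using R[unfolded mono_iff[OF k]] by metis
  qed (use R Hom_Arr[OF k] Hom_Arr[OF f] in auto)
qed

lemma isomorphism_mono:
  assumes "f \<in> Hom C X Y" "is_isomorphism C f"
  shows "is_mono C f"
  unfolding mono_iff[OF assms(1)]
  using isomorphismE[OF assms(2,1)] Comp_assoc[OF _ assms(1)] Comp_Ident_left by metis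

lemma mono_Comp:
  assumes f: "f \<in> Hom C X Y" "is_mono C f" and g: "g \<in> Hom C Y Z" "is_mono C g"
  shows "is_mono C (g \<cdot> f)"
  unfolding mono_iff[OF Comp_Hom[OF f(1) g(1)]]
proof (intro allI impI)
  fix W u v assume u: "u \<in> Hom C W X" and v: "v \<in> Hom C W X" and "g \<cdot> f \<cdot> u = g \<cdot> f \<cdot> v"
  then have "g \<cdot> (f \<cdot> u) = g \<cdot> (f \<cdot> v)"
    using Comp_assoc[OF u f(1) g(1)] Comp_assoc[OF v f(1) g(1)] by simp
  then show "u = v"
    using f(2)[unfolded mono_iff[OF f(1)]] g(2)[unfolded mono_iff[OF g(1)]] u v Comp_Hom[OF u f(1)] Comp_Hom[OF v f(1)]
    by metis
qed

text \<open>Serves to bring a kernel of the image of \<open>f\<close> under a composite functor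
  isomorphic to the identity back to \<open>f\<close> itself.\<close>

lemma kernel_isomorphism_arrow:
  assumes a: "a \<in> Hom C X' X" "is_isomorphism C a" and b: "b \<in> Hom C Y' Y" "is_isomorphism C b"
    and f': "f' \<in> Hom C X' Y'" and f: "f \<in> Hom C X Y" and sq: "b \<cdot> f' = f \<cdot> a"
    and k: "k \<in> Hom C Z X'" and ker: "is_kernel C k f'"
  shows "is_kernel C (a \<cdot> k) f"
proof -
  obtain a' where a': "a' \<in> Hom C X X'" "a' \<cdot> a = Ident C X'" "a \<cdot> a' = Ident C X"
    using isomorphismE[OF a(2,1)] by metis
  note K = ker[unfolded kernel_iff[OF k f']]
  note ak = Comp_Hom[OF k a(1)]
  show ?thesis
    unfolding kernel_iff[OF ak f]
  proof (intro conjI allI impI)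
    have "f \<cdot> (a \<cdot> k) = b \<cdot> (f' \<cdot> k)"
      using Comp_assoc[OF k a(1) f] Comp_assoc[OF k f' b(1)] sq by simp
    then show "f \<cdot> (a \<cdot> k) = Zero C Z Y"
      using K Comp_Zero_right[OF b(1) Hom_Obj_Dom[OF k]] by simp
    show "is_mono C (a \<cdot> k)"
      using mono_Comp[OF k _ a(1) isomorphism_mono[OF a]] K by blast
    fix W g assume g: "g \<in> Hom C W X" and fg: "f \<cdot> g = Zero C W Y"
    note a'g = Comp_Hom[OF g a'(1)]
    have aa: "a \<cdot> (a' \<cdot> g) = g"
      using Comp_assoc[OF g a'(1) a(1)] a'(3) Comp_Ident_left[OF g] by simp
    then have "b \<cdot> (f' \<cdot> (a' \<cdot> g)) = b \<cdot> Zero C W Y'"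
      using Comp_assoc[OF a'g f' b(1)] sq Comp_assoc[OF a'g a(1) f] fg
        Comp_Zero_right[OF b(1) Hom_Obj_Dom[OF g]] by simp
    then have "f' \<cdot> (a' \<cdot> g) = Zero C W Y'"
      using isomorphism_mono[OF b, unfolded mono_iff[OF b(1)]] Comp_Hom[OF a'g f']
        Zero_Hom[OF Hom_Obj_Dom[OF g] Hom_Obj_Dom[OF b(1)]] by blast
    then obtain u where "u \<in> Hom C W Z" "k \<cdot> u = a' \<cdot> g"
      using K a'g by blast
    then show "\<exists>u \<in> Hom C W Z. a \<cdot> k \<cdot> u = g"
      using Comp_assoc[OF _ k a(1)] aa by metis
  qed
qed

text \<open>If \<open>k'\<close> is a kernel of \<open>g\<close>, then \<open>k\<close> is a kernel
  of \<open>g\<close> conjugated by the inverse \<open>b'\<close>. This transports normality of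
  monos along an isomorphism of arrows.\<close>

lemma kernel_isomorphism_kernel:
  assumes a: "a \<in> Hom C X' X" "is_isomorphism C a" and b: "b \<in> Hom C Y' Y" "is_isomorphism C b"
    and k': "k' \<in> Hom C X' Y'" and k: "k \<in> Hom C X Y" and sq: "b \<cdot> k' = k \<cdot> a"
    and g: "g \<in> Hom C Y' W" and ker: "is_kernel C k' g"
  shows "\<exists>g. is_kernel C k g"
proof -
  obtain a' where a': "a' \<in> Hom C X X'" "a' \<cdot> a = Ident C X'" "a \<cdot> a' = Ident C X" "is_isomorphism C a'"
    using isomorphismE[OF a(2,1)] by metis
  obtain b' where b': "b' \<in> Hom C Y Y'" "b' \<cdot> b = Ident C Y'" "b \<cdot> b' = Ident C Y" "is_isomorphism C b'"
    using isomorphismE[OF b(2,1)] by metis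
  have kk: "k = b \<cdot> k' \<cdot> a'"
    using sq Comp_assoc[OF a'(1) a(1) k] a'(3) Comp_Ident_right[OF k] by simp
  have "is_kernel C (b \<cdot> k') (g \<cdot> b')"
  proof (rule kernel_isomorphism_arrow[OF b _ _ g _ _ k' ker])
    show "Ident C W \<in> Hom C W W" "is_isomorphism C (Ident C W)" "g \<cdot> b' \<in> Hom C Y W"
      using Ident_Hom isomorphism_Ident Hom_Obj_Cod[OF g] Comp_Hom[OF b'(1) g] by auto
    show "Ident C W \<cdot> g = g \<cdot> b' \<cdot> b"
      using Comp_assoc[OF b(1) b'(1) g] b'(2) Comp_Ident_left[OF g] Comp_Ident_right[OF g] by simp
  qed
  note K = this[unfolded kernel_iff[OF Comp_Hom[OF k' b(1)] Comp_Hom[OF b'(1) g]]]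
  note bk = Comp_Hom[OF k' b(1)] and gb = Comp_Hom[OF b'(1) g]
  have "is_kernel C k (g \<cdot> b')"
    unfolding kernel_iff[OF k gb]
  proof (intro conjI allI impI)
    show "g \<cdot> b' \<cdot> k = Zero C X W"
      unfolding kk using Comp_assoc[OF a'(1) bk gb] K Comp_Zero_left[OF a'(1) Hom_Obj_Cod[OF g]] by simp
    show "is_mono C k"
      unfolding kk using mono_Comp[OF a'(1) isomorphism_mono[OF a'(1,4)] bk] K by blast
    fix V h assume h: "h \<in> Hom C V Y" and "g \<cdot> b' \<cdot> h = Zero C V W"
    then obtain u where u: "u \<in> Hom C V X'" "b \<cdot> k' \<cdot> u = h"
      using K by blast
    then have "k \<cdot> (a \<cdot> u) = h"
      using Comp_assoc[OF u(1) a(1) k] sq by simp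
    then show "\<exists>u \<in> Hom C V X. k \<cdot> u = h"
      using Comp_Hom[OF u(1) a(1)] by blast
  qed
  then show ?thesis by blast
qed

end

text \<open>A test map into \<open>G X\<close> is transposed, factored through the kernel in
  \<open>D\<close>, and the factor is transposed back.\<close>

lemma (in adjoint_pair) G_kernel:
  assumes "additive_category C" "additive_category D" "additive_functor C D F" "additive_functor D C G"
    and k: "k \<in> Hom D Z X" and f: "f \<in> Hom D X Y" and ker: "is_kernel D k f"
  shows "is_kernel C (FM G k) (FM G f)"
proof -
  interpret F: additive_functor_between C D F
    using assms by (simp add: additive_functor_between_def additive_functor_between_axioms_def)
  interpret G: additive_functor_between D C G
    using assms by (simp add: additive_functor_between_def additive_functor_between_axioms_def)
  note K = ker[unfolded F.D.kernel_iff[OF k f]]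
  show ?thesis
    unfolding F.C.kernel_iff[OF G_Hom[OF k] G_Hom[OF f]]
  proof (intro conjI allI impI)
    show "FM G f \<cdot>\<^bsub>C\<^esub> FM G k = Zero C (FO G Z) (FO G Y)"
      using G_Comp[OF k f] K G.F_Zero D.Hom_Obj_Dom[OF k] D.Hom_Obj_Cod[OF f] by simp
    show "is_mono C (FM G k)"
      using G_mono[OF k] K by blast
    fix W g assume g: "g \<in> Hom C W (FO G X)" and fg: "FM G f \<cdot>\<^bsub>C\<^esub> g = Zero C W (FO G Y)"
    note X = D.Hom_Obj_Dom[OF f] and Y = D.Hom_Obj_Cod[OF f] and W = C.Hom_Obj_Dom[OF g]
    let ?h = "\<epsilon> X \<cdot>\<^bsub>D\<^esub> FM F g"
    note h = transpose_left_Hom[OF g X]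
    have "f \<cdot>\<^bsub>D\<^esub> ?h = \<epsilon> Y \<cdot>\<^bsub>D\<^esub> FM F (FM G f \<cdot>\<^bsub>C\<^esub> g)"
      using F_Comp[OF g G_Hom[OF f]] D.Comp_assoc[OF F_Hom[OF g] F_Hom[OF G_Hom[OF f]] counit_Hom[OF Y]]
        counit_natural[OF f] D.Comp_assoc[OF F_Hom[OF g] counit_Hom[OF X] f] by simp
    also have "\<dots> = Zero D (FO F W) Y"
      using fg F.F_Zero[OF W G_Obj[OF Y]] F.D.Comp_Zero_right[OF counit_Hom[OF Y] F_Obj[OF W]] by simp
    finally obtain u where u: "u \<in> Hom D (FO F W) Z" "k \<cdot>\<^bsub>D\<^esub> u = ?h"
      using K h by blast
    have "FM G k \<cdot>\<^bsub>C\<^esub> (FM G u \<cdot>\<^bsub>C\<^esub> \<eta> W) = g"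
      using C.Comp_assoc[OF unit_Hom[OF W] G_Hom[OF u(1)] G_Hom[OF k]] G_Comp[OF u(1) k] u(2)
        transpose_transpose_left[OF g X] by simp
    then show "\<exists>u \<in> Hom C W (FO G Z). FM G k \<cdot>\<^bsub>C\<^esub> u = g"
      using transpose_right_Hom[OF u(1) W] by blast
  qed
qed

text \<open>Every arrow \<open>f\<close> of \<open>D\<close> is isomorphic to
  \<open>S (R f)\<close>. A kernel of \<open>R f\<close> in \<open>B\<close> is carried by the right
  adjoint \<open>S\<close> to a kernel of \<open>S (R f)\<close>; and if \<open>f\<close> is mono,
  so is \<open>R f\<close>, which is then a kernel in \<open>B\<close> and remains one under
  \<open>S\<close>.\<close>

lemma kernels_via_right_adjoints:
  assumes D: "additive_category D" and B: "additive_category B"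
    and kernels: "\<And>f. f \<in> Arr B \<Longrightarrow> \<exists>k. is_kernel B k f"
    and mono_kernels: "\<And>f. is_mono B f \<Longrightarrow> \<exists>g. is_kernel B f g"
    and adjR: "adjunction B D L R \<eta> \<epsilon>" and adjS: "adjunction D B L' S \<eta>' \<epsilon>'"
    and add: "additive_functor B D S" "additive_functor D B L'"
    and iso: "\<And>f X Y. f \<in> Hom D X Y \<Longrightarrow> \<exists>a b. a \<in> Hom D (FO S (FO R X)) X \<and> is_isomorphism D a \<and>
      b \<in> Hom D (FO S (FO R Y)) Y \<and> is_isomorphism D b \<and> b \<cdot>\<^bsub>D\<^esub> FM S (FM R f) = f \<cdot>\<^bsub>D\<^esub> a"
  shows "f \<in> Arr D \<Longrightarrow> \<exists>k. is_kernel D k f" and "is_mono D f \<Longrightarrow> \<exists>g. is_kernel D f g"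
proof -
  interpret D: additive_category D by fact
  interpret B: additive_category B by fact
  interpret R: adjoint_pair B D L R \<eta> \<epsilon>
    by unfold_locales fact
  interpret S: adjoint_pair D B L' S \<eta>' \<epsilon>'
    by unfold_locales fact
  show "\<exists>k. is_kernel D k f" if "f \<in> Arr D"
  proof -
    obtain X Y where f: "f \<in> Hom D X Y"
      using D.Arr_Hom[OF \<open>f \<in> Arr D\<close>] by blast
    obtain a b where ab: "a \<in> Hom D (FO S (FO R X)) X" "is_isomorphism D a"
      "b \<in> Hom D (FO S (FO R Y)) Y" "is_isomorphism D b" "b \<cdot>\<^bsub>D\<^esub> FM S (FM R f) = f \<cdot>\<^bsub>D\<^esub> a"
      using iso[OF f] by blast
    note Rf = R.G_Hom[OF f]
    obtain k where k: "is_kernel B k (FM R f)"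
      using kernels B.Hom_Arr[OF Rf] by blast
    then have kH: "k \<in> Hom B (Dom B k) (FO R X)"
      using B.Hom_Dom[OF Rf] by (auto simp: is_kernel_def Hom_def)
    have "is_kernel D (FM S k) (FM S (FM R f))"
      using S.G_kernel[OF D B add(2,1) kH Rf k] .
    then show ?thesis
      using D.kernel_isomorphism_arrow[OF ab(1-4) S.G_Hom[OF Rf] f ab(5) S.G_Hom[OF kH]] by blast
  qed
  show "\<exists>g. is_kernel D f g" if mono: "is_mono D f"
  proof -
    have "f \<in> Arr D" using mono by (simp add: is_mono_def)
    then obtain X Y where f: "f \<in> Hom D X Y"
      using D.Arr_Hom by blast
    obtain a b where ab: "a \<in> Hom D (FO S (FO R X)) X" "is_isomorphism D a"
      "b \<in> Hom D (FO S (FO R Y)) Y" "is_isomorphism D b" "b \<cdot>\<^bsub>D\<^esub> FM S (FM R f) = f \<cdot>\<^bsub>D\<^esub> a"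
      using iso[OF f] by blast
    note Rf = R.G_Hom[OF f]
    obtain g where g: "is_kernel B (FM R f) g"
      using mono_kernels R.G_mono[OF f mono] by blast
    then have gH: "g \<in> Hom B (FO R Y) (Cod B g)"
      using B.Hom_Cod[OF Rf] by (auto simp: is_kernel_def Hom_def)
    have "is_kernel D (FM S (FM R f)) (FM S g)"
      using S.G_kernel[OF D B add(2,1) Rf gH g] .
    then show ?thesis
      using D.kernel_isomorphism_kernel[OF ab(1-4) S.G_Hom[OF Rf] f ab(5) S.G_Hom[OF gH]] by blast
  qed
qed

text \<open>A mono is the kernel of some \<open>g\<close>; if it is epi as well, then
  \<open>g\<close> is zero, so the identity of \<open>Y\<close> factors through
  \<open>f\<close>.\<close>

lemma (in abelian_category) mono_epi_isomorphism:
  assumes f: "f \<in> Hom C X Y" and "is_mono C f" "is_epi C f"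
  shows "is_isomorphism C f"
proof -
  obtain g where g: "is_kernel C f g"
    using mono_is_kernel assms(2) by blast
  then obtain Z where gH: "g \<in> Hom C Y Z"
    using Hom_Cod[OF f] by (auto simp: is_kernel_def Hom_def)
  note K = g[unfolded kernel_iff[OF f gH]]
  have Y: "Y \<in> Obj C" and Z: "Z \<in> Obj C"
    using gH Hom_Obj_Dom Hom_Obj_Cod by auto
  have "g \<cdot> f = Zero C Y Z \<cdot> f"
    using K Comp_Zero_left[OF f Z] by simp
  then have "g = Zero C Y Z"
    using assms(3)[unfolded epi_iff[OF f]] gH Zero_Hom[OF Y Z] by blast
  then obtain u where u: "u \<in> Hom C Y X" "f \<cdot> u = Ident C Y"
    using K Ident_Hom[OF Y] Comp_Ident_right[OF gH] by metis
  have "f \<cdot> (u \<cdot> f) = f \<cdot> Ident C X"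
    using Comp_assoc[OF f u(1) f] u(2) Comp_Ident_left[OF f] Comp_Ident_right[OF f] by simp
  then have "u \<cdot> f = Ident C X"
    using assms(2)[unfolded mono_iff[OF f]] Comp_Hom[OF f u(1)] Ident_Hom[OF Hom_Obj_Dom[OF f]] by blast
  then show ?thesis
    using isomorphismI[OF f u(1)] u(2) by blast
qed

context adjoint_pair
begin

lemma unit_square:
  assumes iso: "\<And>X. X \<in> Obj C \<Longrightarrow> is_isomorphism C (\<eta> X)" and f: "f \<in> Hom C X Y"
  shows "\<exists>a b. a \<in> Hom C X (FO G (FO F X)) \<and> is_isomorphism C a \<and>
    b \<in> Hom C Y (FO G (FO F Y)) \<and> is_isomorphism C b \<and> FM G (FM F f) \<cdot>\<^bsub>C\<^esub> a = b \<cdot>\<^bsub>C\<^esub> f"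
  using unit_Hom iso unit_natural[OF f] C.Hom_Obj_Dom[OF f] C.Hom_Obj_Cod[OF f] by metis

lemma unit_inverse_square:
  assumes iso: "\<And>X. X \<in> Obj C \<Longrightarrow> is_isomorphism C (\<eta> X)" and f: "f \<in> Hom C X Y"
  shows "\<exists>a b. a \<in> Hom C (FO G (FO F X)) X \<and> is_isomorphism C a \<and>
    b \<in> Hom C (FO G (FO F Y)) Y \<and> is_isomorphism C b \<and> b \<cdot>\<^bsub>C\<^esub> FM G (FM F f) = f \<cdot>\<^bsub>C\<^esub> a"
proof -
  note X = C.Hom_Obj_Dom[OF f] and Y = C.Hom_Obj_Cod[OF f]
  obtain a where a: "a \<in> Hom C (FO G (FO F X)) X" "\<eta> X \<cdot>\<^bsub>C\<^esub> a = Ident C (FO G (FO F X))" "is_isomorphism C a"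
    using C.isomorphismE[OF iso[OF X] unit_Hom[OF X]] by metis
  obtain b where b: "b \<in> Hom C (FO G (FO F Y)) Y" "b \<cdot>\<^bsub>C\<^esub> \<eta> Y = Ident C Y" "is_isomorphism C b"
    using C.isomorphismE[OF iso[OF Y] unit_Hom[OF Y]] by metis
  note g = G_Hom[OF F_Hom[OF f]]
  have "b \<cdot>\<^bsub>C\<^esub> FM G (FM F f) = b \<cdot>\<^bsub>C\<^esub> (FM G (FM F f) \<cdot>\<^bsub>C\<^esub> \<eta> X \<cdot>\<^bsub>C\<^esub> a)"
    using C.Comp_assoc[OF a(1) unit_Hom[OF X] g] a(2) C.Comp_Ident_right[OF g] by simp
  also have "\<dots> = b \<cdot>\<^bsub>C\<^esub> (\<eta> Y \<cdot>\<^bsub>C\<^esub> (f \<cdot>\<^bsub>C\<^esub> a))"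
    using unit_natural[OF f] C.Comp_assoc[OF a(1) f unit_Hom[OF Y]] by simp
  also have "\<dots> = f \<cdot>\<^bsub>C\<^esub> a"
    using C.Comp_assoc[OF C.Comp_Hom[OF a(1) f] unit_Hom[OF Y] b(1)] b(2)
      C.Comp_Ident_left[OF C.Comp_Hom[OF a(1) f]] by simp
  finally show ?thesis
    using a b by blast
qed

lemma counit_square:
  assumes iso: "\<And>Y. Y \<in> Obj D \<Longrightarrow> is_isomorphism D (\<epsilon> Y)" and f: "f \<in> Hom D X Y"
  shows "\<exists>a b. a \<in> Hom D (FO F (FO G X)) X \<and> is_isomorphism D a \<and>
    b \<in> Hom D (FO F (FO G Y)) Y \<and> is_isomorphism D b \<and> b \<cdot>\<^bsub>D\<^esub> FM F (FM G f) = f \<cdot>\<^bsub>D\<^esub> a"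
  using counit_Hom iso counit_natural[OF f] D.Hom_Obj_Dom[OF f] D.Hom_Obj_Cod[OF f] by metis

lemma counit_inverse_square:
  assumes iso: "\<And>Y. Y \<in> Obj D \<Longrightarrow> is_isomorphism D (\<epsilon> Y)" and f: "f \<in> Hom D X Y"
  shows "\<exists>a b. a \<in> Hom D X (FO F (FO G X)) \<and> is_isomorphism D a \<and>
    b \<in> Hom D Y (FO F (FO G Y)) \<and> is_isomorphism D b \<and> FM F (FM G f) \<cdot>\<^bsub>D\<^esub> a = b \<cdot>\<^bsub>D\<^esub> f"
  using adjoint_pair.unit_inverse_square[OF opposite_adjoint_pair, of f Y X] iso f
  unfolding isomorphism_opposite[OF opposite_cat] opposite_simps[OF opposite_cat] by metis

end

text \<open>Kernels come from right adjoints \<open>R1\<close>, \<open>S1\<close> with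
  \<open>S1\<close> after \<open>R1\<close> isomorphic to the identity, and cokernels from left
  adjoints \<open>R2\<close>, \<open>S2\<close> by the same argument in the opposite categories. The
  two pairs may share functors.\<close>

lemma abelian_category_via_adjoints:
  assumes D: "additive_category D" and B: "abelian_category B"
    and adj: "adjunction B D L1 R1 \<eta>1 \<epsilon>1" "adjunction D B M1 S1 \<eta>1' \<epsilon>1'"
      "adjunction D B R2 L2 \<eta>2 \<epsilon>2" "adjunction B D S2 M2 \<eta>2' \<epsilon>2'"
    and add: "additive_functor B D S1" "additive_functor D B M1"
      "additive_functor B D S2" "additive_functor D B M2"
    and square1: "\<And>f X Y. f \<in> Hom D X Y \<Longrightarrow> \<exists>a b. a \<in> Hom D (FO S1 (FO R1 X)) X \<and> is_isomorphism D a \<and>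
      b \<in> Hom D (FO S1 (FO R1 Y)) Y \<and> is_isomorphism D b \<and> b \<cdot>\<^bsub>D\<^esub> FM S1 (FM R1 f) = f \<cdot>\<^bsub>D\<^esub> a"
    and square2: "\<And>f X Y. f \<in> Hom D X Y \<Longrightarrow> \<exists>a b. a \<in> Hom D X (FO S2 (FO R2 X)) \<and> is_isomorphism D a \<and>
      b \<in> Hom D Y (FO S2 (FO R2 Y)) \<and> is_isomorphism D b \<and> FM S2 (FM R2 f) \<cdot>\<^bsub>D\<^esub> a = b \<cdot>\<^bsub>D\<^esub> f"
  shows "abelian_category D"
proof -
  interpret B: abelian_category B by fact
  note oD = opposite_cat[of D] and oB = opposite_cat[of B]
  note K1 = kernels_via_right_adjoints[OF D B.additive_category_axioms B.ex_kernel B.mono_is_kernel adj(1,2)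
      add(1,2) square1]
  have square2': "\<exists>a b. a \<in> Hom (opposite_cat D) (FO S2 (FO R2 X)) X \<and> is_isomorphism (opposite_cat D) a \<and>
      b \<in> Hom (opposite_cat D) (FO S2 (FO R2 Y)) Y \<and> is_isomorphism (opposite_cat D) b \<and>
      b \<cdot>\<^bsub>opposite_cat D\<^esub> FM S2 (FM R2 f) = f \<cdot>\<^bsub>opposite_cat D\<^esub> a"
    if "f \<in> Hom (opposite_cat D) X Y" for f X Y
    using square2[of f Y X] that unfolding isomorphism_opposite[OF oD] opposite_simps[OF oD] by metis
  have op: "\<And>f. f \<in> Arr (opposite_cat B) \<Longrightarrow> \<exists>k. is_kernel (opposite_cat B) k f"
    "\<And>f. is_mono (opposite_cat B) f \<Longrightarrow> \<exists>g. is_kernel (opposite_cat B) f g"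
    using B.ex_cokernel B.epi_is_cokernel
    unfolding kernel_opposite[OF oB] mono_opposite[OF oB] opposite_simps[OF oB] by blast+
  note K2 = kernels_via_right_adjoints[OF additive_category_opposite[OF oD D]
      additive_category_opposite[OF oB B.additive_category_axioms] op
      adjunction_opposite[OF oD oB adj(3)] adjunction_opposite[OF oB oD adj(4)]
      add(3)[folded additive_functor_opposite[OF oB oD]] add(4)[folded additive_functor_opposite[OF oD oB]]
      square2']
  note K2' = K2[unfolded kernel_opposite[OF oD] mono_opposite[OF oD] opposite_simps(2)[OF oD]]
  show ?thesis
    by (rule abelian_category.intro[OF D abelian_category_axioms.intro[OF K1(1) K2'(1) K1(2) K2'(2)]])
qed

section \<open>Epimorphisms and biproducts under isomorphism\<close>

context additive_category
begin

lemma isomorphism_epi: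
  assumes f: "f \<in> Hom C X Y" and "is_isomorphism C f"
  shows "is_epi C f"
  unfolding epi_iff[OF f]
proof (intro allI impI)
  fix W u v assume u: "u \<in> Hom C Y W" and v: "v \<in> Hom C Y W" and eq: "u \<cdot> f = v \<cdot> f"
  obtain g where g: "g \<in> Hom C Y X" "f \<cdot> g = Ident C Y"
    using isomorphismE[OF assms(2,1)] by metis
  show "u = v"
    using Comp_assoc[OF g(1) f u] Comp_assoc[OF g(1) f v] eq g(2) Comp_Ident_right[OF u] Comp_Ident_right[OF v]
    by metis
qed

lemma epi_Comp:
  assumes f: "f \<in> Hom C X Y" "is_epi C f" and g: "g \<in> Hom C Y Z" "is_epi C g"
  shows "is_epi C (g \<cdot> f)"
  unfolding epi_iff[OF Comp_Hom[OF f(1) g(1)]]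
proof (intro allI impI)
  fix W u v assume u: "u \<in> Hom C Z W" and v: "v \<in> Hom C Z W" and "u \<cdot> (g \<cdot> f) = v \<cdot> (g \<cdot> f)"
  then have "(u \<cdot> g) \<cdot> f = (v \<cdot> g) \<cdot> f"
    using Comp_assoc[OF f(1) g(1) u] Comp_assoc[OF f(1) g(1) v] by simp
  then show "u = v"
    using f(2)[unfolded epi_iff[OF f(1)]] g(2)[unfolded epi_iff[OF g(1)]] u v Comp_Hom[OF g(1) u] Comp_Hom[OF g(1) v]
    by metis
qed

lemma epi_if_Comp_epi:
  assumes f: "f \<in> Hom C X Y" and g: "g \<in> Hom C Y Z" and epi: "is_epi C (g \<cdot> f)"
  shows "is_epi C g"
  unfolding epi_iff[OF g]
proof (intro allI impI)
  fix W u v assume u: "u \<in> Hom C Z W" and v: "v \<in> Hom C Z W" and "u \<cdot> g = v \<cdot> g"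
  then have "u \<cdot> (g \<cdot> f) = v \<cdot> (g \<cdot> f)"
    using Comp_assoc[OF f g u] Comp_assoc[OF f g v] by simp
  then show "u = v"
    using epi[unfolded epi_iff[OF Comp_Hom[OF f g]]] u v by blast
qed

text \<open>The object \<open>S\<close> stays and only its inclusions and projections are composed
  with the isomorphisms. Thus a sum in an image subcategory can be an honest value of the functor
  even when its summands are only isomorphic to values.\<close>

lemma biproduct_isomorphism:
  assumes bip: "biproduct C X Y S i1 i2 p1 p2" and iso: "isomorphic C X X'" "isomorphic C Y Y'"
  shows "\<exists>i1 i2 p1 p2. biproduct C X' Y' S i1 i2 p1 p2"
proof -
  note b = biproduct_D[OF bip]
  obtain a where a0: "a \<in> Hom C X X'" "is_isomorphism C a"
    using iso(1) unfolding isomorphic_def by blast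
  then obtain a' where a: "a \<in> Hom C X X'" "a' \<in> Hom C X' X" "a' \<cdot> a = Ident C X" "a \<cdot> a' = Ident C X'"
    using isomorphismE by metis
  obtain c where c0: "c \<in> Hom C Y Y'" "is_isomorphism C c"
    using iso(2) unfolding isomorphic_def by blast
  then obtain c' where c: "c \<in> Hom C Y Y'" "c' \<in> Hom C Y' Y" "c' \<cdot> c = Ident C Y" "c \<cdot> c' = Ident C Y'"
    using isomorphismE by metis
  have shift: "(g \<cdot> p) \<cdot> (i \<cdot> g') = g \<cdot> (p \<cdot> i) \<cdot> g'"
    if "g' \<in> Hom C U' U" "i \<in> Hom C U S" "p \<in> Hom C S V" "g \<in> Hom C V V'" for g p i g' U U' V V'
    using Comp_assoc[OF Comp_Hom[OF that(1,2)] that(3,4)] Comp_assoc[OF that(1,2,3)]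
      Comp_assoc[OF that(1) Comp_Hom[OF that(2,3)] that(4)] by simp
  have idem: "(i \<cdot> g') \<cdot> (g \<cdot> p) = i \<cdot> p"
    if "p \<in> Hom C S U" "g \<in> Hom C U V" "g' \<in> Hom C V U" "i \<in> Hom C U S" "g' \<cdot> g = Ident C U" for i g' g p U V
    using Comp_assoc[OF Comp_Hom[OF that(1,2)] that(3,4)] Comp_assoc[OF that(1,2,3)] that(5)
      Comp_Ident_left[OF that(1)] by simp
  note O = Hom_Obj_Cod[OF a(1)] Hom_Obj_Cod[OF c(1)]
  have "biproduct C X' Y' S (i1 \<cdot> a') (i2 \<cdot> c') (a \<cdot> p1) (c \<cdot> p2)"
    unfolding biproduct_def
    using Comp_Hom[OF a(2) b(1)] Comp_Hom[OF c(2) b(2)] Comp_Hom[OF b(3) a(1)] Comp_Hom[OF b(4) c(1)]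
      shift[OF a(2) b(1,3) a(1)] shift[OF c(2) b(2,4) c(1)] shift[OF c(2) b(2,3) a(1)] shift[OF a(2) b(1,4) c(1)]
      b(5-9) Comp_Ident_right[OF a(1)] a(4) Comp_Ident_right[OF c(1)] c(4)
      Comp_Zero_right[OF a(1)] Comp_Zero_right[OF c(1)] Hom_Obj_Dom[OF a(1)] Hom_Obj_Dom[OF c(1)]
      Comp_Zero_left[OF c(2) O(1)] Comp_Zero_left[OF a(2) O(2)]
      idem[OF b(3) a(1,2) b(1) a(3)] idem[OF b(4) c(1,2) b(2) c(3)] by simp
  then show ?thesis by blast
qed

end

lemma (in category) image_subcatI: "\<lbrakk>S \<in> T; G S \<in> Obj C\<rbrakk> \<Longrightarrow> G S \<in> image_subcat C G T"
  unfolding image_subcat_def using isomorphicI Ident_Hom isomorphism_Ident by blast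

lemma additive_quotient_image_subcat:
  assumes "additive_quotient K T" "additive_category L" "additive_functor K L F"
  shows "additive_quotient L (image_subcat L (FO F) T)"
proof -
  interpret K: additive_quotient K T by fact
  interpret L: additive_category L by fact
  interpret additive_functor_between K L F
    using assms(3) by unfold_locales
  show ?thesis
  proof
    show "Y \<in> Obj L" if "Y \<in> image_subcat L (FO F) T" for Y
      using that by (simp add: image_subcat_def)
    show "image_subcat L (FO F) T \<noteq> {}"
      using K.T_nonempty K.T_Obj F_Obj L.image_subcatI[of _ T "FO F"] by blast
    show "\<exists>U i1 i2 p1 p2. U \<in> image_subcat L (FO F) T \<and> biproduct L Y Y' U i1 i2 p1 p2"
      if Y: "Y \<in> image_subcat L (FO F) T" and Y': "Y' \<in> image_subcat L (FO F) T" for Y Y'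
    proof -
      obtain S S' where S: "S \<in> T" "isomorphic L (FO F S) Y" "S' \<in> T" "isomorphic L (FO F S') Y'"
        using Y Y' by (auto simp: image_subcat_def)
      obtain U i1 i2 p1 p2 where U: "U \<in> T" "biproduct K S S' U i1 i2 p1 p2"
        using K.T_sum[OF S(1,3)] by blast
      show ?thesis
        using L.image_subcatI[OF U(1), of "FO F"] F_Obj[OF K.T_Obj[OF U(1)]]
          L.biproduct_isomorphism[OF F_biproduct[OF U(2)] S(2,4)] by blast
    qed
  qed
qed

section \<open>Induced functors\<close>

locale induced = K: additive_quotient K T + L: additive_quotient L U
  for K :: "('o, 'm, 'z) precat_scheme" and T :: "'o set"
    and L :: "('p, 'n, 'y) precat_scheme" and U :: "'p set" +
  fixes F :: "('o, 'm, 'p, 'n) fct"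
  assumes F_additive: "additive_functor K L F" and F_T: "FO F ` T \<subseteq> U"
begin

sublocale additive_functor_between K L F
  using F_additive by unfold_locales

abbreviation IF :: "('o, 'm set, 'p, 'n set) fct" where "IF \<equiv> induced_functor L U F"

lemma IF_FO [simp]: "FO IF = FO F"
  by (simp add: induced_functor_def)

lemma F_fac: "h \<in> K.fac X Y \<Longrightarrow> FM F h \<in> L.fac (FO F X) (FO F Y)"
  using F_T by (elim K.facE) (auto simp: F_Comp intro: L.facI[OF _ F_Hom F_Hom])

text \<open>The chosen representative differs from \<open>f\<close> by a map through
  \<open>T\<close>, whose image is a map through \<open>U\<close>.\<close>

lemma IF_cls:
  assumes f: "f \<in> Hom K X Y"
  shows "FM IF (K.cls f) = L.cls (FM F f)"
proof -
  note r = K.arr_rep_cls[OF f]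
  have "arr_rep (K.cls f) \<ominus>\<^bsub>K\<^esub> f \<in> K.fac X Y"
    using K.cls_eq_iff[OF r(1) f] r(2) by blast
  then have "L.cls (FM F (arr_rep (K.cls f))) = L.cls (FM F f)"
    using L.cls_eqI[OF F_Hom[OF r(1)] F_Hom[OF f]] F_sub[OF r(1) f] F_fac by metis
  then show ?thesis
    by (simp add: induced_functor_def)
qed

lemma additive_functor_IF: "additive_functor K.Q L.Q IF"
  unfolding additive_functor_def is_functor_def
proof (intro conjI ballI impI)
  show "FO IF X \<in> Obj L.Q" "FM IF (Ident K.Q X) = Ident L.Q (FO IF X)" if "X \<in> Obj K.Q" for X
    using that F_Obj F_Ident IF_cls[OF K.Ident_Hom] by simp_all
  show "FM IF V \<in> Hom L.Q (FO IF (Dom K.Q V)) (FO IF (Cod K.Q V))" if "V \<in> Arr K.Q" for V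
    by (rule K.Q_ArrE[OF that]) (simp add: IF_cls K.Q_Dom K.Q_Cod L.Q_Hom[OF F_Hom])
  show "FM IF (W \<cdot>\<^bsub>K.Q\<^esub> V) = FM IF W \<cdot>\<^bsub>L.Q\<^esub> FM IF V" if V: "V \<in> Arr K.Q" and W: "W \<in> Arr K.Q"
    and eq: "Dom K.Q W = Cod K.Q V" for V W
  proof -
    obtain X Y f where f: "f \<in> Hom K X Y" "V = K.cls f" using V K.Q_ArrE by blast
    obtain Y' Z g where g': "g \<in> Hom K Y' Z" "W = K.cls g" using W K.Q_ArrE by blast
    have "Y' = Y"
      using eq K.Q_Dom[OF g'(1)] K.Q_Cod[OF f(1)] f(2) g'(2) by simp
    then have g: "g \<in> Hom K Y Z"
      using g' by simp
    show ?thesis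
      unfolding f(2) g'(2) K.Q_Comp[OF f(1) g] IF_cls[OF f(1)] IF_cls[OF g] IF_cls[OF K.Comp_Hom[OF f(1) g]]
        L.Q_Comp[OF F_Hom[OF f(1)] F_Hom[OF g]] F_Comp[OF f(1) g] ..
  qed
  show "FM IF \<in> hom (HomG K.Q X Y) (HomG L.Q (FO IF X) (FO IF Y))" if "X \<in> Obj K.Q" "Y \<in> Obj K.Q" for X Y
  proof (rule homI; unfold HomG_def monoid.simps partial_object.simps IF_FO)
    show "FM IF V \<in> Hom L.Q (FO F X) (FO F Y)" if "V \<in> Hom K.Q X Y" for V
      by (rule K.Q_HomE[OF that]) (simp add: IF_cls L.Q_Hom[OF F_Hom])
    show "FM IF (V \<oplus>\<^bsub>K.Q\<^esub> W) = FM IF V \<oplus>\<^bsub>L.Q\<^esub> FM IF W" if V: "V \<in> Hom K.Q X Y" and W: "W \<in> Hom K.Q X Y" for V W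
    proof -
      obtain f where f: "f \<in> Hom K X Y" "V = K.cls f" using V K.Q_HomE by blast
      obtain g where g: "g \<in> Hom K X Y" "W = K.cls g" using W K.Q_HomE by blast
      show ?thesis
        unfolding f(2) g(2) K.Q_Add[OF f(1) g(1)] IF_cls[OF f(1)] IF_cls[OF g(1)]
          IF_cls[OF K.Add_Hom[OF f(1) g(1)]] L.Q_Add[OF F_Hom[OF f(1)] F_Hom[OF g(1)]] F_Add[OF f(1) g(1)] ..
    qed
  qed
qed

end

text \<open>The classes of unit and counit work because naturality and the triangle identities hold
  before passing to classes.\<close>

lemma induced_adjunction:
  assumes "induced K T L U F" "induced L U K T G" "adjunction K L F G \<eta> \<epsilon>"
  shows "adjunction (quot_cat K T) (quot_cat L U) (induced_functor L U F) (induced_functor K T G)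
    (\<lambda>X. arr_class K T (\<eta> X)) (\<lambda>Y. arr_class L U (\<epsilon> Y))"
proof -
  interpret F: induced K T L U F by fact
  interpret G: induced L U K T G by fact
  interpret adjoint_pair K L F G \<eta> \<epsilon>
    by unfold_locales fact
  show ?thesis
    unfolding adjunction_def F.IF_FO G.IF_FO F.K.Q_Obj F.L.Q_Obj F.K.Q_Ident F.L.Q_Ident
  proof (intro conjI ballI)
    show "is_functor F.K.Q F.L.Q F.IF" "is_functor F.L.Q F.K.Q G.IF"
      using F.additive_functor_IF G.additive_functor_IF by (auto simp: additive_functor_def)
    show "F.K.cls (\<eta> X) \<in> Hom F.K.Q X (FO G (FO F X))" if "X \<in> Obj K" for X
      using F.K.Q_Hom[OF unit_Hom[OF that]] .
    show "F.L.cls (\<epsilon> Y) \<in> Hom F.L.Q (FO F (FO G Y)) Y" if "Y \<in> Obj L" for Y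
      using F.L.Q_Hom[OF counit_Hom[OF that]] .
    show "F.K.cls (\<eta> (Cod F.K.Q V)) \<cdot>\<^bsub>F.K.Q\<^esub> V = FM G.IF (FM F.IF V) \<cdot>\<^bsub>F.K.Q\<^esub> F.K.cls (\<eta> (Dom F.K.Q V))"
      if V: "V \<in> Arr F.K.Q" for V
    proof -
      obtain X Y f where f: "f \<in> Hom K X Y" "V = F.K.cls f" using V F.K.Q_ArrE by blast
      show ?thesis
        unfolding f(2) F.K.Q_Dom[OF f(1)] F.K.Q_Cod[OF f(1)] F.IF_cls[OF f(1)] G.IF_cls[OF F_Hom[OF f(1)]]
          F.K.Q_Comp[OF f(1) unit_Hom[OF F.K.Hom_Obj_Cod[OF f(1)]]]
          F.K.Q_Comp[OF unit_Hom[OF F.K.Hom_Obj_Dom[OF f(1)]] G_Hom[OF F_Hom[OF f(1)]]] unit_natural[OF f(1)] ..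
    qed
    show "F.L.cls (\<epsilon> (Cod F.L.Q V)) \<cdot>\<^bsub>F.L.Q\<^esub> FM F.IF (FM G.IF V) = V \<cdot>\<^bsub>F.L.Q\<^esub> F.L.cls (\<epsilon> (Dom F.L.Q V))"
      if V: "V \<in> Arr F.L.Q" for V
    proof -
      obtain X Y f where f: "f \<in> Hom L X Y" "V = F.L.cls f" using V F.L.Q_ArrE by blast
      show ?thesis
        unfolding f(2) F.L.Q_Dom[OF f(1)] F.L.Q_Cod[OF f(1)] G.IF_cls[OF f(1)] F.IF_cls[OF G_Hom[OF f(1)]]
          F.L.Q_Comp[OF counit_Hom[OF F.L.Hom_Obj_Dom[OF f(1)]] f(1)]
          F.L.Q_Comp[OF F_Hom[OF G_Hom[OF f(1)]] counit_Hom[OF F.L.Hom_Obj_Cod[OF f(1)]]] counit_natural[OF f(1)] ..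
    qed
    show "F.L.cls (\<epsilon> (FO F X)) \<cdot>\<^bsub>F.L.Q\<^esub> FM F.IF (F.K.cls (\<eta> X)) = F.L.cls (Ident L (FO F X))" if X: "X \<in> Obj K" for X
      unfolding F.IF_cls[OF unit_Hom[OF X]] F.L.Q_Comp[OF F_Hom[OF unit_Hom[OF X]] counit_Hom[OF F_Obj[OF X]]]
        counit_F_unit[OF X] ..
    show "FM G.IF (F.L.cls (\<epsilon> Y)) \<cdot>\<^bsub>F.K.Q\<^esub> F.K.cls (\<eta> (FO G Y)) = F.K.cls (Ident K (FO G Y))" if Y: "Y \<in> Obj L" for Y
      unfolding G.IF_cls[OF counit_Hom[OF Y]] F.K.Q_Comp[OF unit_Hom[OF G_Obj[OF Y]] G_Hom[OF counit_Hom[OF Y]]]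
        G_counit_unit[OF Y] ..
  qed
qed

section \<open>Recollements of extriangulated categories\<close>

context additive_category
begin

lemma zero_objects_isomorphism:
  assumes X: "is_zero_object C X" and Y: "is_zero_object C Y" and f: "f \<in> Hom C X Y"
  shows "is_isomorphism C f"
proof -
  have 0: "Zero C Y X \<in> Hom C Y X"
    using Zero_Hom Hom_Obj_Dom[OF f] Hom_Obj_Cod[OF f] by blast
  show ?thesis
    using isomorphismI[OF f 0] zero_object_Hom_to[OF X] zero_object_Hom_to[OF Y]
      Comp_Hom[OF f 0] Comp_Hom[OF 0 f] Ident_Hom Hom_Obj_Dom[OF f] Hom_Obj_Cod[OF f] by metis
qed

end

context extriangulated_category
begin

text \<open>An invertible \<open>x\<close> forces \<delta> to vanish, since its pushforward along
  \<open>x\<close> does. So \<open>y\<close> has a section, while \<open>y\<close> after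
  \<open>x\<close> being zero makes \<open>y\<close> itself zero.\<close>

lemma third_zero_if_isomorphism:
  assumes tri: "etriangle K A C \<delta> x y" and x: "x \<in> Hom K A B" and iso: "is_isomorphism K x"
  shows "is_zero_object K C"
proof -
  note t = etriangle_D[OF tri disjI1[OF x]]
  obtain g where g: "g \<in> Hom K B A" "g \<cdot> x = Ident K A" "x \<cdot> g = Ident K B"
    using isomorphismE[OF iso x] by metis
  have "\<delta> = \<one>\<^bsub>Ext K C A\<^esub>"
    using push_Comp[OF x g(1) t(5,6)] push_inflation[OF tri x] push_one[OF g(1) t(5)] g(2) push_Ident[OF t(5,3,6)]
    by simp
  then obtain s where s: "s \<in> Hom K C B" "y \<cdot> s = Ident K C"
    using lift_through_deflation[OF tri t(2) Ident_Hom[OF t(5)]] pull_one[OF Ident_Hom[OF t(5)] t(3)] by metis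
  have "y = Zero K B C"
    using Comp_assoc[OF g(1) x t(2)] deflation_inflation_Zero[OF tri x] Comp_Zero_left[OF g(1) t(5)] g(3)
      Comp_Ident_right[OF t(2)] by simp
  then show ?thesis
    using s Comp_Zero_left[OF s(1) t(5)] zero_object_iff t(5) by simp
qed

text \<open>The extension splits and gives a retraction \<open>r\<close>. The difference of
  \<open>x\<close> after \<open>r\<close> and the identity kills \<open>x\<close>, so it factors
  through the zero object \<open>C\<close>.\<close>

lemma isomorphism_if_third_zero:
  assumes tri: "etriangle K A C \<delta> x y" and x: "x \<in> Hom K A B" and Z: "is_zero_object K C"
  shows "is_isomorphism K x"
proof -
  note t = etriangle_D[OF tri disjI1[OF x]]
  have "\<delta> = \<one>\<^bsub>Ext K C A\<^esub>"
    using Ext_zero_left[OF Z t(3,6)] .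
  then obtain r where r: "r \<in> Hom K B A" "r \<cdot> x = Ident K A"
    using extend_along_inflation[OF tri x Ident_Hom[OF t(3)]] push_one[OF Ident_Hom[OF t(3)] t(5)] by metis
  note xr = Comp_Hom[OF r(1) x]
  have "(x \<cdot> r) \<cdot> x = x"
    using Comp_assoc[OF x r(1) x] r(2) Comp_Ident_right[OF x] by simp
  then have "(x \<cdot> r \<ominus> Ident K B) \<cdot> x = Zero K A B"
    using Comp_sub_left[OF x xr Ident_Hom[OF t(4)]] Comp_Ident_left[OF x] sub_self[OF x] by simp
  then obtain w where w: "w \<in> Hom K C B" "w \<cdot> y = x \<cdot> r \<ominus> Ident K B"
    using factor_through_deflation[OF tri x sub_Hom[OF xr Ident_Hom[OF t(4)]]] by metis
  then have "x \<cdot> r \<ominus> Ident K B = Zero K B B"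
    using Comp_zero_object[OF Z t(2) w(1)] by simp
  then have "x \<cdot> r = Ident K B"
    using sub_eq_Zero[OF xr Ident_Hom[OF t(4)]] by blast
  then show ?thesis
    using isomorphismI[OF x r(1)] r(2) by blast
qed

end

text \<open>The extension \<delta>' is left free, since the Ext arguments read only the arrows of
  the image triangle. In this form exactness is visibly self-dual.\<close>

definition preserves_triangles ::
  "('o, 'm, 'e) extcat \<Rightarrow> ('p, 'n, 'f) extcat \<Rightarrow> ('o, 'm, 'p, 'n) fct \<Rightarrow> bool" where
  "preserves_triangles K L F \<longleftrightarrow> (\<forall>A C \<delta> x y. etriangle K A C \<delta> x y \<longrightarrow>
     (\<exists>\<delta>'. etriangle L (FO F A) (FO F C) \<delta>' (FM F x) (FM F y)))"

lemma preserves_triangles_opp [simp]: "preserves_triangles (opp K) (opp L) F \<longleftrightarrow> preserves_triangles K L F"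
  unfolding preserves_triangles_def etriangle_opp by blast

lemma exact_functor_preserves_triangles: "exact_functor K L F \<Longrightarrow> preserves_triangles K L F"
  unfolding exact_functor_def preserves_triangles_def by blast

text \<open>Apply \<open>G\<close> to a triangle realizing \<delta>. The unit at \<open>X\<close>
  lifts through \<open>G y\<close> by the vanishing assumption, and the transpose of the lift is a
  section of \<open>y\<close>.\<close>

lemma Ext_vanish_left_adjoint:
  assumes "extriangulated_category K" "extriangulated_category L"
    and adj: "adjunction K L F G \<eta> \<epsilon>" and pres: "preserves_triangles L K G"
    and X: "X \<in> Obj K" and Y: "Y \<in> Obj L"
    and vanish: "\<And>\<omega>. \<omega> \<in> carrier (Ext K X (FO G Y)) \<Longrightarrow> \<omega> = \<one>\<^bsub>Ext K X (FO G Y)\<^esub>"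
    and d: "\<delta> \<in> carrier (Ext L (FO F X) Y)"
  shows "\<delta> = \<one>\<^bsub>Ext L (FO F X) Y\<^esub>"
proof -
  interpret K: extriangulated_category K by fact
  interpret L: extriangulated_category L by fact
  interpret adjoint_pair K L F G \<eta> \<epsilon>
    by unfold_locales fact
  note FX = F_Obj[OF X] and e = unit_Hom[OF X]
  obtain x y where tri: "etriangle L Y (FO F X) \<delta> x y"
    using L.etriangle_ex[OF FX Y d] by blast
  obtain M where y: "y \<in> Hom L M (FO F X)"
    using L.etriangleE[OF tri] by metis
  obtain \<delta>' where tri': "etriangle K (FO G Y) (FO G (FO F X)) \<delta>' (FM G x) (FM G y)"
    using pres tri unfolding preserves_triangles_def by blast
  note t' = K.etriangle_D[OF tri' disjI2[OF G_Hom[OF y]]]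
  obtain b where b: "b \<in> Hom K X (FO G M)" "FM G y \<cdot>\<^bsub>K\<^esub> b = \<eta> X"
    using K.lift_through_deflation[OF tri' G_Hom[OF y] e] vanish[OF K.pull_closed[OF e t'(3,6)]] by metis
  note M = L.Hom_Obj_Dom[OF y]
  let ?b = "\<epsilon> M \<cdot>\<^bsub>L\<^esub> FM F b"
  note Gb = transpose_left_Hom[OF b(1) M]
  have "y \<cdot>\<^bsub>L\<^esub> ?b = \<epsilon> (FO F X) \<cdot>\<^bsub>L\<^esub> FM F (\<eta> X)"
    using L.Comp_assoc[OF F_Hom[OF b(1)] counit_Hom[OF M] y] counit_natural[OF y]
      L.Comp_assoc[OF F_Hom[OF b(1)] F_Hom[OF G_Hom[OF y]] counit_Hom[OF FX]] F_Comp[OF b(1) G_Hom[OF y]] b(2)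
    by simp
  then have "y \<cdot>\<^bsub>L\<^esub> ?b = Ident L (FO F X)"
    using counit_F_unit[OF X] by simp
  then show ?thesis
    using L.pull_Comp_deflation[OF tri y Gb] L.pull_Ident[OF FX Y d] by simp
qed

lemma Ext_vanish_right_adjoint:
  assumes "extriangulated_category K" "extriangulated_category L"
    and "adjunction K L F G \<eta> \<epsilon>" and "preserves_triangles K L F"
    and "X \<in> Obj K" and "Y \<in> Obj L"
    and "\<And>\<omega>. \<omega> \<in> carrier (Ext L (FO F X) Y) \<Longrightarrow> \<omega> = \<one>\<^bsub>Ext L (FO F X) Y\<^esub>"
    and "\<delta> \<in> carrier (Ext K X (FO G Y))"
  shows "\<delta> = \<one>\<^bsub>Ext K X (FO G Y)\<^esub>"
  using Ext_vanish_left_adjoint[OF extriangulated_category_opp[OF assms(2)] extriangulated_category_opp[OF assms(1)]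
      adjunction_opposite[OF opposite_opp opposite_opp assms(3)], of Y X \<delta>] assms(4-8)
  by (simp add: opposite_simps[OF opposite_opp])

text \<open>In the opposite categories \<open>x\<close> is the deflation of the triangle, and right
  exactness there keeps the image of the deflation but replaces the fibre. Hence the image of
  \<open>x\<close> is an inflation, with no control over its third term.\<close>

lemma left_exact_functor_inflation:
  assumes "left_exact_functor K L F" "etriangle K A C \<delta> x y"
  shows "\<exists>Q e r. etriangle L (FO F A) Q e (FM F x) r"
proof -
  note o = opposite_simps[OF opposite_opp]
  have tri: "A \<in> Obj K" "C \<in> Obj K" "\<delta> \<in> carrier (Ext K C A)" "(x, y) \<in> Real K C A \<delta>"
    using assms(2) by (auto simp: etriangle_def)
  obtain Q q e where Qe: "\<forall>C \<in> Obj (opp K). \<forall>A \<in> Obj (opp K). \<forall>\<delta> \<in> carrier (Ext (opp K) C A).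
      Q C A \<delta> \<in> Obj (opp L) \<and>
      q C A \<delta> \<in> Hom (opp L) (FO F A) (Q C A \<delta>) \<and> deflation (opp L) (q C A \<delta>) \<and> compatible (opp L) (q C A \<delta>) \<and>
      e C A \<delta> \<in> carrier (Ext (opp L) (FO F C) (Q C A \<delta>)) \<and>
      (\<forall>(f, g) \<in> Real (opp K) C A \<delta>. \<exists>x \<in> Hom (opp L) (Q C A \<delta>) (FO F (Cod (opp K) f)).
         FM F f = x \<cdot>\<^bsub>opp L\<^esub> q C A \<delta> \<and> (x, FM F g) \<in> Real (opp L) (FO F C) (Q C A \<delta>) (e C A \<delta>))"
    using assms(1) unfolding left_exact_functor_def right_exact_functor_def by blast
  have QO: "Q A C \<delta> \<in> Obj L" and eC: "e A C \<delta> \<in> carrier (Ext L (Q A C \<delta>) (FO F A))"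
    using Qe[rule_format, of A C \<delta>] tri by (auto simp: o)
  have "(y, x) \<in> Real (opp K) A C \<delta>"
    using tri(4) by simp
  then obtain r where "(r, FM F x) \<in> Real (opp L) (FO F A) (Q A C \<delta>) (e A C \<delta>)"
    using Qe[rule_format, of A C \<delta>] tri(1-3) unfolding o(1) opp_simps by blast
  then have "(FM F x, r) \<in> Real L (Q A C \<delta>) (FO F A) (e A C \<delta>)"
    by simp
  moreover have "FO F A \<in> Obj L"
    using assms(1) tri(1) unfolding left_exact_functor_def right_exact_functor_def additive_functor_def is_functor_def o
    by blast
  ultimately show ?thesis
    using QO eC unfolding etriangle_def by blast
qed

text \<open>The part of a recollement that is shared, up to passing to opposite categories, by the two
  sides: I, S, J, R are \<open>i_*\<close>, \<open>i^!\<close>, \<open>j^*\<close>, \<open>j_*\<close> or, in the opposite categories, \<open>i_*\<close>, \<open>i^*\<close>,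
  \<open>j^*\<close>, \<open>j_!\<close>.\<close>

locale half_recollement = A: extriangulated_category \<A> + B: extriangulated_category \<B> + C: extriangulated_category \<C> +
  IS: adjoint_pair \<A> \<B> I S \<eta>\<^sub>I \<epsilon>\<^sub>I + JR: adjoint_pair \<B> \<C> J R \<eta>\<^sub>R \<epsilon>\<^sub>R
  for \<A> :: "('oa, 'ma, 'ea) extcat" and \<B> :: "('ob, 'mb, 'eb) extcat" and \<C> :: "('oc, 'mc, 'ec) extcat"
    and I S J R \<eta>\<^sub>I \<epsilon>\<^sub>I \<eta>\<^sub>R \<epsilon>\<^sub>R +
  assumes I_ff: "fully_faithful \<A> \<B> I" and R_ff: "fully_faithful \<C> \<B> R"
    and I_additive: "additive_functor \<A> \<B> I" and S_additive: "additive_functor \<B> \<A> S"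
    and S_triangles: "preserves_triangles \<B> \<A> S" and J_triangles: "preserves_triangles \<B> \<C> J"
    and JI_zero: "Y \<in> Obj \<A> \<Longrightarrow> is_zero_object \<C> (FO J (FO I Y))"
    and exact_seq: "X \<in> Obj \<B> \<Longrightarrow> \<exists>Y \<in> Obj \<A>. \<exists>h. Cod \<B> h = FO I Y \<and> left_exact_seq4 \<B> (\<epsilon>\<^sub>I X) (\<eta>\<^sub>R X) h"
begin

sublocale I: additive_functor_between \<A> \<B> I
  using I_additive by unfold_locales

sublocale S: additive_functor_between \<B> \<A> S
  using S_additive by unfold_locales

text \<open>\<open>S\<close> after \<open>R\<close> is right adjoint to \<open>J\<close> after
  \<open>I\<close>, which is zero: the counit into \<open>R Z\<close> corresponds to a map out of a
  zero object, and a triangle identity then kills the identity of \<open>S (R Z)\<close>.\<close>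

lemma SR_zero:
  assumes Z: "Z \<in> Obj \<C>"
  shows "is_zero_object \<A> (FO S (FO R Z))"
proof -
  let ?X = "FO R Z"
  note X = JR.G_Obj[OF Z]
  note SX = IS.G_Obj[OF X]
  note ISX = IS.F_Obj[OF SX]
  note e = IS.counit_Hom[OF X] and 0 = B.Zero_Hom[OF ISX X]
  have "\<epsilon>\<^sub>R Z \<cdot>\<^bsub>\<C>\<^esub> FM J (\<epsilon>\<^sub>I ?X) = \<epsilon>\<^sub>R Z \<cdot>\<^bsub>\<C>\<^esub> FM J (Zero \<B> (FO I (FO S ?X)) ?X)"
    using C.zero_object_Hom_from[OF JI_zero[OF SX]] JR.transpose_left_Hom[OF e Z] JR.transpose_left_Hom[OF 0 Z]
    by metis
  then have "\<epsilon>\<^sub>I ?X = Zero \<B> (FO I (FO S ?X)) ?X"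
    using JR.transpose_transpose_left[OF e Z] JR.transpose_transpose_left[OF 0 Z] by metis
  then have "Ident \<A> (FO S ?X) = Zero \<A> (FO S (FO I (FO S ?X))) (FO S ?X) \<cdot>\<^bsub>\<A>\<^esub> \<eta>\<^sub>I (FO S ?X)"
    using IS.G_counit_unit[OF X] S.F_Zero[OF ISX X] by simp
  then show ?thesis
    using A.zero_object_iff SX A.Comp_Zero_left[OF IS.unit_Hom[OF SX] SX] by simp
qed

text \<open>Exactness of S kills the last term of the 4-term sequence.\<close>

lemma counit_triangle:
  assumes X: "X \<in> Obj \<B>"
  obtains Q \<delta> g1 g2 where "etriangle \<B> (FO I (FO S X)) Q \<delta> (\<epsilon>\<^sub>I X) g1" "g1 \<in> Hom \<B> X Q"
    "g2 \<in> Hom \<B> Q (FO R (FO J X))" "is_isomorphism \<B> g2" "\<eta>\<^sub>R X = g2 \<cdot>\<^bsub>\<B>\<^esub> g1"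
proof -
  note SX = IS.G_Obj[OF X] and e = IS.counit_Hom[OF X] and u = JR.unit_Hom[OF X]
  obtain Y h Q \<delta> \<delta>' g1 g2 where Y: "Y \<in> Obj \<A>" and h: "Cod \<B> h = FO I Y"
    and tri: "etriangle \<B> (Dom \<B> (\<epsilon>\<^sub>I X)) Q \<delta> (\<epsilon>\<^sub>I X) g1" and tri': "etriangle \<B> Q (Cod \<B> h) \<delta>' g2 h"
    and eq: "\<eta>\<^sub>R X = g2 \<cdot>\<^bsub>\<B>\<^esub> g1"
    using exact_seq[OF X] unfolding left_exact_seq4_def by blast
  note tri = tri[unfolded B.Hom_Dom[OF e]] and tri' = tri'[unfolded h]
  note t = B.etriangle_D[OF tri disjI1[OF e]]
  obtain V where g2: "g2 \<in> Hom \<B> Q V"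
    using B.etriangleE[OF tri'] by metis
  then have g2: "g2 \<in> Hom \<B> Q (FO R (FO J X))"
    using B.Hom_Cod[OF B.Comp_Hom[OF t(2) g2]] eq B.Hom_Cod[OF u] by simp
  obtain \<omega> where \<omega>: "etriangle \<A> (FO S (FO I (FO S X))) (FO S Q) \<omega> (FM S (\<epsilon>\<^sub>I X)) (FM S g1)"
    using S_triangles tri unfolding preserves_triangles_def by blast
  obtain \<omega>' where \<omega>': "etriangle \<A> (FO S Q) (FO S (FO I Y)) \<omega>' (FM S g2) (FM S h)"
    using S_triangles tri' unfolding preserves_triangles_def by blast
  note uSX = IS.unit_Hom[OF SX] and Se = IS.G_Hom[OF e]
  obtain v where v: "v \<in> Hom \<A> (FO S (FO I (FO S X))) (FO S X)" "\<eta>\<^sub>I (FO S X) \<cdot>\<^bsub>\<A>\<^esub> v = Ident \<A> (FO S (FO I (FO S X)))"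
    "is_isomorphism \<A> v"
    using A.isomorphismE[OF IS.unit_isomorphism[OF I_ff SX] uSX] by metis
  have "FM S (\<epsilon>\<^sub>I X) = v"
    using A.Comp_assoc[OF v(1) uSX Se] v(2) IS.G_counit_unit[OF X] A.Comp_Ident_right[OF Se] A.Comp_Ident_left[OF v(1)]
    by simp
  \<comment> \<open>A triangle identity makes \<open>S\<close> of the counit inverse to the unit of
    the fully faithful \<open>I\<close>, so the image of the first triangle begins with an
    isomorphism.\<close>
  then have "is_zero_object \<A> (FO S Q)"
    using A.third_zero_if_isomorphism[OF \<omega> Se] v(3) by simp
  \<comment> \<open>The image of \<open>g2\<close> is a map between zero objects, hence invertible,
    so the third term of its triangle vanishes too.\<close>
  then have "is_zero_object \<A> (FO S (FO I Y))"
    using A.third_zero_if_isomorphism[OF \<omega>' IS.G_Hom[OF g2]]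
      A.zero_objects_isomorphism[OF _ SR_zero[OF JR.F_Obj[OF X]] IS.G_Hom[OF g2]] by blast
  then have "is_zero_object \<A> Y"
    using A.zero_object_isomorphic A.isomorphicI[OF IS.unit_Hom[OF Y] IS.unit_isomorphism[OF I_ff Y]] by blast
  then have "is_isomorphism \<B> g2"
    using B.isomorphism_if_third_zero[OF tri' g2] I.F_zero_object by blast
  then show ?thesis
    using that[OF tri t(2) g2 _ eq] by blast
qed

text \<open>The map \<open>r\<close> completing \<open>R x\<close> to a triangle need not be \<open>R y\<close>; it suffices that its target Q
  satisfies S Q = 0, as then every map to R J Q lifts to Q.\<close>

lemma Ext_vanish_J:
  assumes inflation: "\<And>A C \<delta> x y. etriangle \<C> A C \<delta> x y \<Longrightarrow> \<exists>Q e r. etriangle \<B> (FO R A) Q e (FM R x) r"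
    and X: "X \<in> Obj \<B>" and A: "A \<in> Obj \<C>"
    and vanish: "\<And>\<omega>. \<omega> \<in> carrier (Ext \<B> X (FO R A)) \<Longrightarrow> \<omega> = \<one>\<^bsub>Ext \<B> X (FO R A)\<^esub>"
    and d: "\<delta> \<in> carrier (Ext \<C> (FO J X) A)"
  shows "\<delta> = \<one>\<^bsub>Ext \<C> (FO J X) A\<^esub>"
proof -
  note JX = JR.F_Obj[OF X] and RA = JR.G_Obj[OF A]
  obtain x y where tri: "etriangle \<C> A (FO J X) \<delta> x y"
    using C.etriangle_ex[OF JX A d] by blast
  obtain M where x: "x \<in> Hom \<C> A M" and y: "y \<in> Hom \<C> M (FO J X)"
    using C.etriangleE[OF tri] by metis
  note M = C.Hom_Obj_Cod[OF x]
  obtain Q e r where Q: "etriangle \<B> (FO R A) Q e (FM R x) r"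
    using inflation[OF tri] by blast
  note q = B.etriangle_D[OF Q disjI1[OF JR.G_Hom[OF x]]]
  obtain \<omega> where "etriangle \<A> (FO S (FO R A)) (FO S Q) \<omega> (FM S (FM R x)) (FM S r)"
    using S_triangles Q unfolding preserves_triangles_def by blast
  \<comment> \<open>\<open>S\<close> sends \<open>R x\<close> to a map between zero objects, which
    forces \<open>S Q\<close> to be zero.\<close>
  from A.third_zero_if_isomorphism[OF this IS.G_Hom[OF q(1)]
      A.zero_objects_isomorphism[OF SR_zero[OF A] SR_zero[OF M] IS.G_Hom[OF q(1)]]]
  have ISQ: "is_zero_object \<B> (FO I (FO S Q))"
    by (rule I.F_zero_object)
  obtain e' where e': "etriangle \<C> (FO J (FO R A)) (FO J Q) e' (FM J (FM R x)) (FM J r)"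
    using J_triangles Q unfolding preserves_triangles_def by blast
  have inverse: "\<exists>g \<in> Hom \<C> Z (FO J (FO R Z)). g \<cdot>\<^bsub>\<C>\<^esub> \<epsilon>\<^sub>R Z = Ident \<C> (FO J (FO R Z)) \<and> \<epsilon>\<^sub>R Z \<cdot>\<^bsub>\<C>\<^esub> g = Ident \<C> Z"
    if "Z \<in> Obj \<C>" for Z
    using C.isomorphismE[OF JR.counit_isomorphism[OF R_ff that] JR.counit_Hom[OF that]] by metis
  obtain a where a: "a \<in> Hom \<C> A (FO J (FO R A))" "\<epsilon>\<^sub>R A \<cdot>\<^bsub>\<C>\<^esub> a = Ident \<C> A"
    using inverse[OF A] by blast
  obtain b where b: "b \<in> Hom \<C> M (FO J (FO R M))" "b \<cdot>\<^bsub>\<C>\<^esub> \<epsilon>\<^sub>R M = Ident \<C> (FO J (FO R M))"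
    using inverse[OF M] by blast
  note eA = JR.counit_Hom[OF A] and eM = JR.counit_Hom[OF M]
  note JRx = JR.F_Hom[OF q(1)]
  \<comment> \<open>The inverse counits compare \<open>x\<close> with its image under
    \<open>J\<close> after \<open>R\<close>, so that (ET3) yields a morphism from \<delta> to the
    extension \<open>e'\<close> of the image triangle.\<close>
  have "FM J (FM R x) \<cdot>\<^bsub>\<C>\<^esub> a = b \<cdot>\<^bsub>\<C>\<^esub> (\<epsilon>\<^sub>R M \<cdot>\<^bsub>\<C>\<^esub> FM J (FM R x)) \<cdot>\<^bsub>\<C>\<^esub> a"
    using C.Comp_assoc[OF JRx eM b(1)] b(2) C.Comp_Ident_left[OF JRx] by simp
  also have "\<dots> = b \<cdot>\<^bsub>\<C>\<^esub> x"
    using JR.counit_natural[OF x] C.Comp_assoc[OF a(1) C.Comp_Hom[OF eA x] b(1)] C.Comp_assoc[OF a(1) eA x] a(2)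
      C.Comp_Ident_right[OF x] by simp
  finally have "b \<cdot>\<^bsub>\<C>\<^esub> x = FM J (FM R x) \<cdot>\<^bsub>\<C>\<^esub> a" ..
  then obtain c where c: "c \<in> Hom \<C> (FO J X) (FO J Q)" "push \<C> (FO J X) a \<delta> = pull \<C> (FO J (FO R A)) c e'"
    using C.ET3_rule[OF tri e' x JRx a(1) b(1)] by metis
  \<comment> \<open>The transpose of \<open>c\<close> goes to \<open>R (J Q)\<close>, which the
    counit triangle at \<open>Q\<close> identifies with the target of a deflation from
    \<open>Q\<close> whose fibre \<open>I (S Q)\<close> is zero; so nothing obstructs a lift to
    \<open>Q\<close>.\<close>
  obtain t where t: "t \<in> Hom \<B> X Q" "FM J t = c"
  proof -
    obtain Q' \<delta>' g1 g2 where g: "etriangle \<B> (FO I (FO S Q)) Q' \<delta>' (\<epsilon>\<^sub>I Q) g1" "g1 \<in> Hom \<B> Q Q'"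
      "g2 \<in> Hom \<B> Q' (FO R (FO J Q))" "is_isomorphism \<B> g2" "\<eta>\<^sub>R Q = g2 \<cdot>\<^bsub>\<B>\<^esub> g1"
      using counit_triangle[OF q(5)] .
    note tg = B.etriangle_D[OF g(1) disjI2[OF g(2)]]
    obtain v where v: "v \<in> Hom \<B> (FO R (FO J Q)) Q'" "g2 \<cdot>\<^bsub>\<B>\<^esub> v = Ident \<B> (FO R (FO J Q))"
      using B.isomorphismE[OF g(4,3)] by metis
    let ?c = "FM R c \<cdot>\<^bsub>\<B>\<^esub> \<eta>\<^sub>R X"
    note cH = JR.transpose_right_Hom[OF c(1) X]
    note vc = B.Comp_Hom[OF cH v(1)]
    obtain t where t: "t \<in> Hom \<B> X Q" "g1 \<cdot>\<^bsub>\<B>\<^esub> t = v \<cdot>\<^bsub>\<B>\<^esub> ?c"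
      using B.lift_through_deflation[OF g(1,2) vc] B.Ext_zero_right[OF ISQ X B.pull_closed[OF vc tg(3,6)]] by metis
    have "\<eta>\<^sub>R Q \<cdot>\<^bsub>\<B>\<^esub> t = ?c"
      using B.Comp_assoc[OF t(1) g(2,3)] g(5) t(2) B.Comp_assoc[OF cH v(1) g(3)] v(2) B.Comp_Ident_left[OF cH] by simp
    then have "FM R (FM J t) \<cdot>\<^bsub>\<B>\<^esub> \<eta>\<^sub>R X = ?c"
      using JR.unit_natural[OF t(1)] by simp
    then have "FM J t = c"
      using JR.transpose_transpose_right[OF JR.F_Hom[OF t(1)] X] JR.transpose_transpose_right[OF c(1) X] by metis
    then show ?thesis
      using that t(1) by blast
  qed
  \<comment> \<open>The vanishing of extensions of \<open>X\<close> by \<open>R A\<close> lifts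
    \<open>t\<close> through \<open>r\<close>. Under \<open>J\<close> this factors \<open>c\<close>
    through the deflation of the image triangle, so \<open>e'\<close> pulls back along
    \<open>c\<close> to zero.\<close>
  obtain s where s: "s \<in> Hom \<B> X (FO R M)" "r \<cdot>\<^bsub>\<B>\<^esub> s = t"
    using B.lift_through_deflation[OF Q q(2) t(1)] vanish[OF B.pull_closed[OF t(1) RA q(6)]] by metis
  have "FM J r \<cdot>\<^bsub>\<C>\<^esub> FM J s = c"
    using JR.F_Comp[OF s(1) q(2)] s(2) t(2) by simp
  then have "push \<C> (FO J X) a \<delta> = \<one>\<^bsub>Ext \<C> (FO J X) (FO J (FO R A))\<^esub>"
    using C.pull_Comp_deflation[OF e' JR.F_Hom[OF q(2)] JR.F_Hom[OF s(1)]] c(2) by simp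
  \<comment> \<open>The counit is a left inverse of \<open>a\<close>, so pushing forward along
    \<open>a\<close> loses nothing.\<close>
  then show ?thesis
    using C.push_Comp[OF a(1) eA JX d] a(2) C.push_Ident[OF JX A d] C.push_one[OF eA JX] by simp
qed

end

section \<open>The recollement of the quotients\<close>

text \<open>Units and counits are parameters, so that the 4-term sequences and the adjunctions speak
  of the same ones. The assumption \<open>j_lst_inflation\<close> is the form in which left
  exactness of \<open>j_lst\<close> enters.\<close>

locale cluster_tilting_recollement =
  fixes \<A> :: "('oa, 'ma, 'ea) extcat" and \<B> :: "('ob, 'mb, 'eb) extcat" and \<C> :: "('oc, 'mc, 'ec) extcat"
    and i_ust i_ush :: "('ob, 'mb, 'oa, 'ma) fct" and i_lst :: "('oa, 'ma, 'ob, 'mb) fct"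
    and j_ust :: "('ob, 'mb, 'oc, 'mc) fct" and j_lsh j_lst :: "('oc, 'mc, 'ob, 'mb) fct"
    and \<eta>1 \<epsilon>1 \<eta>2 \<epsilon>2 \<eta>3 \<epsilon>3 \<eta>4 \<epsilon>4 and \<T> :: "'ob set"
  assumes A: "extriangulated_category \<A>" and C: "extriangulated_category \<C>"
    and cluster_tilting_\<T>: "cluster_tilting_subcategory \<B> \<T>"
    and adjunctions: "adjunction \<B> \<A> i_ust i_lst \<eta>1 \<epsilon>1" "adjunction \<A> \<B> i_lst i_ush \<eta>2 \<epsilon>2"
      "adjunction \<C> \<B> j_lsh j_ust \<eta>3 \<epsilon>3" "adjunction \<B> \<C> j_ust j_lst \<eta>4 \<epsilon>4"
    and additive_functors: "additive_functor \<B> \<A> i_ust" "additive_functor \<A> \<B> i_lst" "additive_functor \<B> \<A> i_ush"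
      "additive_functor \<C> \<B> j_lsh" "additive_functor \<B> \<C> j_ust" "additive_functor \<C> \<B> j_lst"
    and fully_faithful: "fully_faithful \<A> \<B> i_lst" "fully_faithful \<C> \<B> j_lsh" "fully_faithful \<C> \<B> j_lst"
    and triangles: "preserves_triangles \<B> \<A> i_ust" "preserves_triangles \<A> \<B> i_lst" "preserves_triangles \<B> \<A> i_ush"
      "preserves_triangles \<B> \<C> j_ust"
    and j_lst_inflation: "\<And>A C \<delta> x y. etriangle \<C> A C \<delta> x y \<Longrightarrow>
      \<exists>Q e r. etriangle \<B> (FO j_lst A) Q e (FM j_lst x) r"
    and i_lst_kernel: "Y \<in> Obj \<A> \<Longrightarrow> is_zero_object \<C> (FO j_ust (FO i_lst Y))"
    and left_exact: "X \<in> Obj \<B> \<Longrightarrow> \<exists>Y \<in> Obj \<A>. \<exists>h. Cod \<B> h = FO i_lst Y \<and> left_exact_seq4 \<B> (\<epsilon>2 X) (\<eta>4 X) h"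
    and right_exact: "X \<in> Obj \<B> \<Longrightarrow> \<exists>Y \<in> Obj \<A>. \<exists>h. Dom \<B> h = FO i_lst Y \<and> right_exact_seq4 \<B> h (\<epsilon>3 X) (\<eta>1 X)"
    and jj_\<T>: "S \<in> \<T> \<Longrightarrow> FO j_lst (FO j_ust S) \<in> \<T>"
    and ii_\<T>: "S \<in> \<T> \<Longrightarrow> FO i_lst (FO i_ust S) \<in> \<T>"
begin

abbreviation \<T>\<^sub>A :: "'oa set" where "\<T>\<^sub>A \<equiv> image_subcat \<A> (FO i_ust) \<T>"
abbreviation \<T>\<^sub>C :: "'oc set" where "\<T>\<^sub>C \<equiv> image_subcat \<C> (FO j_ust) \<T>"

sublocale A: extriangulated_category \<A> by (rule A)
sublocale C: extriangulated_category \<C> by (rule C)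
sublocale B: cluster_tilting_subcategory \<B> \<T> by (rule cluster_tilting_\<T>)

sublocale adj1: adjoint_pair \<B> \<A> i_ust i_lst \<eta>1 \<epsilon>1 using adjunctions(1) by unfold_locales
sublocale adj2: adjoint_pair \<A> \<B> i_lst i_ush \<eta>2 \<epsilon>2 using adjunctions(2) by unfold_locales
sublocale adj3: adjoint_pair \<C> \<B> j_lsh j_ust \<eta>3 \<epsilon>3 using adjunctions(3) by unfold_locales
sublocale adj4: adjoint_pair \<B> \<C> j_ust j_lst \<eta>4 \<epsilon>4 using adjunctions(4) by unfold_locales

lemma half_recollement: "half_recollement \<A> \<B> \<C> i_lst i_ush j_ust j_lst \<eta>2 \<epsilon>2 \<eta>4 \<epsilon>4"
  by unfold_locales (use fully_faithful additive_functors triangles i_lst_kernel left_exact in blast)+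

text \<open>Passing to opposites makes \<open>i_ust\<close> right adjoint to \<open>i_lst\<close>
  and \<open>j_lsh\<close> right adjoint to \<open>j_ust\<close>, with units and counits exchanged.
  Compatibility is self-dual, so right exact 4-term sequences become left exact ones.\<close>

lemma half_recollement_opp:
  "half_recollement (opp \<A>) (opp \<B>) (opp \<C>) i_lst i_ust j_ust j_lsh \<epsilon>1 \<eta>1 \<epsilon>3 \<eta>3"
proof -
  note o = opposite_opp[of \<A>] opposite_opp[of \<B>] opposite_opp[of \<C>]
  have seq: "left_exact_seq4 (opp \<B>) f g h \<longleftrightarrow> right_exact_seq4 \<B> h g f" if "compatible \<B> = compatible (opp \<B>)" for f g h
    unfolding left_exact_seq4_def right_exact_seq4_def etriangle_opp opposite_simps[OF o(2)] that by blast
  have "inflation (opp \<B>) = deflation \<B>" "deflation (opp \<B>) = inflation \<B>"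
    by (auto simp: inflation_def deflation_def fun_eq_iff)
  then have "compatible \<B> = compatible (opp \<B>)"
    by (auto simp: compatible_def fun_eq_iff opposite_simps[OF o(2)] isomorphism_opposite[OF o(2)])
  note seq = seq[OF this]
  interpret A': extriangulated_category "opp \<A>" by (rule extriangulated_category_opp[OF A])
  interpret B': extriangulated_category "opp \<B>"
    by (rule extriangulated_category_opp[OF B.extriangulated_category_axioms])
  interpret C': extriangulated_category "opp \<C>" by (rule extriangulated_category_opp[OF C])
  show ?thesis
  proof
    show "adjunction (opp \<A>) (opp \<B>) i_lst i_ust \<epsilon>1 \<eta>1" "adjunction (opp \<B>) (opp \<C>) j_ust j_lsh \<epsilon>3 \<eta>3"
      using adjunction_opposite o adjunctions by blast+
    show "fully_faithful (opp \<A>) (opp \<B>) i_lst" "fully_faithful (opp \<C>) (opp \<B>) j_lsh"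
      "additive_functor (opp \<A>) (opp \<B>) i_lst" "additive_functor (opp \<B>) (opp \<A>) i_ust"
      "preserves_triangles (opp \<B>) (opp \<A>) i_ust" "preserves_triangles (opp \<B>) (opp \<C>) j_ust"
      using fully_faithful additive_functors triangles fully_faithful_opposite o additive_functor_opposite
        preserves_triangles_opp by blast+
    show "is_zero_object (opp \<C>) (FO j_ust (FO i_lst Y))" if "Y \<in> Obj (opp \<A>)" for Y
      using that i_lst_kernel by (simp add: zero_object_opposite[OF o(3)] opposite_simps[OF o(1)])
    show "\<exists>Y \<in> Obj (opp \<A>). \<exists>h. Cod (opp \<B>) h = FO i_lst Y \<and> left_exact_seq4 (opp \<B>) (\<eta>1 X) (\<epsilon>3 X) h"
      if "X \<in> Obj (opp \<B>)" for X
      using that right_exact unfolding seq opposite_simps[OF o(1)] opposite_simps[OF o(2)] by blast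
  qed
qed

text \<open>\<open>j_lst (j_ust S')\<close> lies in \<T>, so the extensions of \<open>S\<close> by
  it vanish. As \<open>j_lst\<close> is only left exact, \<open>Ext_vanish_J\<close> moves this to
  \<C>.\<close>

lemma Ext_j_ust:
  assumes "S \<in> \<T>" "S' \<in> \<T>" "\<delta> \<in> carrier (Ext \<C> (FO j_ust S) (FO j_ust S'))"
  shows "\<delta> = \<one>\<^bsub>Ext \<C> (FO j_ust S) (FO j_ust S')\<^esub>"
  using half_recollement.Ext_vanish_J[OF half_recollement j_lst_inflation B.T_Obj[OF assms(1)]
      adj4.F_Obj[OF B.T_Obj[OF assms(2)]] B.rigid[OF assms(1) jj_\<T>[OF assms(2)]] assms(3)] .

text \<open>\<open>j_lsh\<close> is left adjoint to the exact \<open>j_ust\<close>, so the vanishing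
  between \<open>j_ust S\<close> and \<open>j_ust S'\<close> moves to \<open>j_lsh (j_ust S)\<close>
  and \<open>S'\<close>.\<close>

lemma j_lsh_j_ust_\<T>:
  assumes S: "S \<in> \<T>"
  shows "FO j_lsh (FO j_ust S) \<in> \<T>"
proof (rule B.in_T_if_Ext_from)
  note jS = adj4.F_Obj[OF B.T_Obj[OF S]]
  show "FO j_lsh (FO j_ust S) \<in> Obj \<B>"
    using adj3.F_Obj[OF jS] .
  show "\<delta> = \<one>\<^bsub>Ext \<B> (FO j_lsh (FO j_ust S)) S'\<^esub>"
    if S': "S' \<in> \<T>" and d: "\<delta> \<in> carrier (Ext \<B> (FO j_lsh (FO j_ust S)) S')" for S' \<delta>
    using Ext_vanish_left_adjoint[OF C B.extriangulated_category_axioms adjunctions(3) triangles(4) jS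
        B.T_Obj[OF S'] Ext_j_ust[OF S S'] d] .
qed

text \<open>Two adjunctions in a row: from extensions of \<open>i_lst (i_ust S')\<close> by
  \<open>S\<close>, through extensions of \<open>i_ust S'\<close> by \<open>i_ush S\<close>, to
  extensions of \<open>S'\<close> by \<open>i_lst (i_ush S)\<close>.\<close>

lemma i_lst_i_ush_\<T>:
  assumes S: "S \<in> \<T>"
  shows "FO i_lst (FO i_ush S) \<in> \<T>"
proof (rule B.in_T_if_Ext_to)
  note BS = B.T_Obj[OF S]
  note iS = adj2.G_Obj[OF BS]
  show "FO i_lst (FO i_ush S) \<in> Obj \<B>"
    using adj2.F_Obj[OF iS] .
  show "\<delta> = \<one>\<^bsub>Ext \<B> S' (FO i_lst (FO i_ush S))\<^esub>"
    if S': "S' \<in> \<T>" and d: "\<delta> \<in> carrier (Ext \<B> S' (FO i_lst (FO i_ush S)))" for S' \<delta>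
  proof -
    note BS' = B.T_Obj[OF S']
    note vanish = Ext_vanish_right_adjoint[OF A B.extriangulated_category_axioms adjunctions(2) triangles(2)
        adj1.F_Obj[OF BS'] BS B.rigid[OF ii_\<T>[OF S'] S]]
    show ?thesis
      using Ext_vanish_right_adjoint[OF B.extriangulated_category_axioms A adjunctions(1) triangles(1) BS' iS vanish d] .
  qed
qed

lemma \<T>\<^sub>A_E:
  assumes "Y \<in> \<T>\<^sub>A"
  obtains S where "S \<in> \<T>" "isomorphic \<A> (FO i_ust S) Y" "Y \<in> Obj \<A>"
  using assms by (auto simp: image_subcat_def)

lemma \<T>\<^sub>C_E:
  assumes "Y \<in> \<T>\<^sub>C"
  obtains S where "S \<in> \<T>" "isomorphic \<C> (FO j_ust S) Y" "Y \<in> Obj \<C>"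
  using assms by (auto simp: image_subcat_def)

lemma i_ust_\<T>: "FO i_ust ` \<T> \<subseteq> \<T>\<^sub>A"
  using A.image_subcatI[of _ \<T> "FO i_ust"] adj1.F_Obj B.T_Obj by blast

lemma j_ust_\<T>: "FO j_ust ` \<T> \<subseteq> \<T>\<^sub>C"
  using C.image_subcatI[of _ \<T> "FO j_ust"] adj4.F_Obj B.T_Obj by blast

text \<open>The invertible counit makes \<open>i_ush S\<close> isomorphic to \<open>i_ust\<close> of
  the object \<open>i_lst (i_ush S)\<close> of \<T>.\<close>

lemma i_ush_\<T>: "FO i_ush ` \<T> \<subseteq> \<T>\<^sub>A"
proof
  fix Y assume "Y \<in> FO i_ush ` \<T>"
  then obtain S where S: "S \<in> \<T>" "Y = FO i_ush S" by blast
  have Y: "Y \<in> Obj \<A>"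
    using adj2.G_Obj[OF B.T_Obj[OF S(1)]] S(2) by simp
  have "isomorphic \<A> (FO i_ust (FO i_lst Y)) Y"
    using A.isomorphicI[OF adj1.counit_Hom[OF Y] adj1.counit_isomorphism[OF fully_faithful(1) Y]] .
  then show "Y \<in> \<T>\<^sub>A"
    using i_lst_i_ush_\<T>[OF S(1)] Y S(2) unfolding image_subcat_def by blast
qed

lemma i_lst_\<T>: "FO i_lst ` \<T>\<^sub>A \<subseteq> \<T>"
proof
  fix X assume "X \<in> FO i_lst ` \<T>\<^sub>A"
  then obtain Y where "Y \<in> \<T>\<^sub>A" and X: "X = FO i_lst Y" by blast
  then obtain S where S: "S \<in> \<T>" "isomorphic \<A> (FO i_ust S) Y" "Y \<in> Obj \<A>"
    using \<T>\<^sub>A_E by blast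
  then show "X \<in> \<T>"
    using functor_isomorphic[OF adj2.F_functor A.category_axioms B.category_axioms S(2)]
      B.isomorphic_in_T[OF ii_\<T>[OF S(1)]] adj2.F_Obj[OF S(3)] X by simp
qed

lemma j_lsh_\<T>: "FO j_lsh ` \<T>\<^sub>C \<subseteq> \<T>"
proof
  fix X assume "X \<in> FO j_lsh ` \<T>\<^sub>C"
  then obtain Y where "Y \<in> \<T>\<^sub>C" and X: "X = FO j_lsh Y" by blast
  then obtain S where S: "S \<in> \<T>" "isomorphic \<C> (FO j_ust S) Y" "Y \<in> Obj \<C>"
    using \<T>\<^sub>C_E by blast
  then show "X \<in> \<T>"
    using functor_isomorphic[OF adj3.F_functor C.category_axioms B.category_axioms S(2)]
      B.isomorphic_in_T[OF j_lsh_j_ust_\<T>[OF S(1)]] adj3.F_Obj[OF S(3)] X by simp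
qed

lemma j_lst_\<T>: "FO j_lst ` \<T>\<^sub>C \<subseteq> \<T>"
proof
  fix X assume "X \<in> FO j_lst ` \<T>\<^sub>C"
  then obtain Y where "Y \<in> \<T>\<^sub>C" and X: "X = FO j_lst Y" by blast
  then obtain S where S: "S \<in> \<T>" "isomorphic \<C> (FO j_ust S) Y" "Y \<in> Obj \<C>"
    using \<T>\<^sub>C_E by blast
  then show "X \<in> \<T>"
    using functor_isomorphic[OF adj4.G_functor C.category_axioms B.category_axioms S(2)]
      B.isomorphic_in_T[OF jj_\<T>[OF S(1)]] adj4.G_Obj[OF S(3)] X by simp
qed

section \<open>The induced functors and their adjunctions\<close>

abbreviation "QA \<equiv> quot_cat \<A> \<T>\<^sub>A"
abbreviation "QB \<equiv> quot_cat \<B> \<T>"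
abbreviation "QC \<equiv> quot_cat \<C> \<T>\<^sub>C"
abbreviation "Ii_ust \<equiv> induced_functor \<A> \<T>\<^sub>A i_ust"
abbreviation "Ii_lst \<equiv> induced_functor \<B> \<T> i_lst"
abbreviation "Ii_ush \<equiv> induced_functor \<A> \<T>\<^sub>A i_ush"
abbreviation "Ij_lsh \<equiv> induced_functor \<B> \<T> j_lsh"
abbreviation "Ij_ust \<equiv> induced_functor \<C> \<T>\<^sub>C j_ust"
abbreviation "Ij_lst \<equiv> induced_functor \<B> \<T> j_lst"

sublocale QuA: additive_quotient \<A> \<T>\<^sub>A
  using additive_quotient_image_subcat[OF B.additive_quotient_axioms A.additive_category_axioms additive_functors(1)] .

sublocale QuC: additive_quotient \<C> \<T>\<^sub>C
  using additive_quotient_image_subcat[OF B.additive_quotient_axioms C.additive_category_axioms additive_functors(5)] .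

lemma induced:
  "induced \<B> \<T> \<A> \<T>\<^sub>A i_ust" "induced \<A> \<T>\<^sub>A \<B> \<T> i_lst" "induced \<B> \<T> \<A> \<T>\<^sub>A i_ush"
  "induced \<C> \<T>\<^sub>C \<B> \<T> j_lsh" "induced \<B> \<T> \<C> \<T>\<^sub>C j_ust" "induced \<C> \<T>\<^sub>C \<B> \<T> j_lst"
  by (simp_all add: induced_def induced_axioms_def QuA.additive_quotient_axioms QuC.additive_quotient_axioms
      B.additive_quotient_axioms additive_functors i_ust_\<T> i_lst_\<T> i_ush_\<T> j_lsh_\<T> j_ust_\<T> j_lst_\<T>)

lemmas induced_additive = induced[THEN induced.additive_functor_IF]

lemmas induced_adjunctions =
  induced_adjunction[OF induced(1,2) adjunctions(1)] induced_adjunction[OF induced(2,3) adjunctions(2)]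
  induced_adjunction[OF induced(4,5) adjunctions(3)] induced_adjunction[OF induced(5,6) adjunctions(4)]

lemma induced_adjoint_pairs:
  "adjoint_pair QB QA Ii_ust Ii_lst (\<lambda>X. arr_class \<B> \<T> (\<eta>1 X)) (\<lambda>Y. arr_class \<A> \<T>\<^sub>A (\<epsilon>1 Y))"
  "adjoint_pair QA QB Ii_lst Ii_ush (\<lambda>X. arr_class \<A> \<T>\<^sub>A (\<eta>2 X)) (\<lambda>Y. arr_class \<B> \<T> (\<epsilon>2 Y))"
  "adjoint_pair QC QB Ij_lsh Ij_ust (\<lambda>X. arr_class \<C> \<T>\<^sub>C (\<eta>3 X)) (\<lambda>Y. arr_class \<B> \<T> (\<epsilon>3 Y))"
  "adjoint_pair QB QC Ij_ust Ij_lst (\<lambda>X. arr_class \<B> \<T> (\<eta>4 X)) (\<lambda>Y. arr_class \<C> \<T>\<^sub>C (\<epsilon>4 Y))"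
  using induced_adjunctions
  by (simp_all add: adjoint_pair_def adjoint_pair_axioms_def QuA.category_Q B.category_Q QuC.category_Q)

lemma induced_isomorphisms:
  "Y \<in> Obj QA \<Longrightarrow> is_isomorphism QA (arr_class \<A> \<T>\<^sub>A (\<epsilon>1 Y))"
  "Y \<in> Obj QA \<Longrightarrow> is_isomorphism QA (arr_class \<A> \<T>\<^sub>A (\<eta>2 Y))"
  "Z \<in> Obj QC \<Longrightarrow> is_isomorphism QC (arr_class \<C> \<T>\<^sub>C (\<eta>3 Z))"
  "Z \<in> Obj QC \<Longrightarrow> is_isomorphism QC (arr_class \<C> \<T>\<^sub>C (\<epsilon>4 Z))"
  using QuA.Q_isomorphism[OF adj1.counit_Hom adj1.counit_isomorphism[OF fully_faithful(1)]]
    QuA.Q_isomorphism[OF adj2.unit_Hom adj2.unit_isomorphism[OF fully_faithful(1)]]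
    QuC.Q_isomorphism[OF adj3.unit_Hom adj3.unit_isomorphism[OF fully_faithful(2)]]
    QuC.Q_isomorphism[OF adj4.counit_Hom adj4.counit_isomorphism[OF fully_faithful(3)]]
  by simp_all

lemma induced_fully_faithful:
  "fully_faithful QA QB Ii_lst" "fully_faithful QC QB Ij_lsh" "fully_faithful QC QB Ij_lst"
  using adjoint_pair.fully_faithful_left[OF induced_adjoint_pairs(2) induced_isomorphisms(2)]
    adjoint_pair.fully_faithful_left[OF induced_adjoint_pairs(3) induced_isomorphisms(3)]
    adjoint_pair.fully_faithful_right[OF induced_adjoint_pairs(4) induced_isomorphisms(4)] by blast+

text \<open>\<open>i_lst\<close> is a right adjoint of \<open>i_ust\<close> and a left adjoint of
  \<open>i_ush\<close>, so it embeds into the quotient of \<B> on both sides; kernels return through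
  \<open>i_ush\<close> and cokernels through \<open>i_ust\<close>.\<close>

lemma abelian_QA: "abelian_category QA"
  by (rule abelian_category_via_adjoints[OF QuA.additive_category_Q B.abelian_category_Q
        induced_adjunctions(1,2,2,1) induced_additive(3,2,1,2)
        adjoint_pair.unit_inverse_square[OF induced_adjoint_pairs(2) induced_isomorphisms(2)]
        adjoint_pair.counit_inverse_square[OF induced_adjoint_pairs(1) induced_isomorphisms(1)]])

text \<open>Here the embeddings differ, \<open>j_lst\<close> for kernels and \<open>j_lsh\<close>
  for cokernels, and \<open>j_ust\<close> is the way back for both.\<close>

lemma abelian_QC: "abelian_category QC"
  by (rule abelian_category_via_adjoints[OF QuC.additive_category_Q B.abelian_category_Q
        induced_adjunctions(4,3,3,4) induced_additive(5,4,5,6)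
        adjoint_pair.counit_square[OF induced_adjoint_pairs(4) induced_isomorphisms(4)]
        adjoint_pair.unit_square[OF induced_adjoint_pairs(3) induced_isomorphisms(3)]])

text \<open>If \<open>j^* X\<close> vanishes in the quotient, then the counit \<open>i_* i^! X \<rightarrow> X\<close> is epi and the unit
  \<open>X \<rightarrow> i_* i^* X\<close> is mono, and naturality of the unit makes the latter an isomorphism.\<close>

lemma kernel_Ij_ust:
  assumes X: "X \<in> Obj \<B>" and Z: "is_zero_object QC (FO j_ust X)"
  shows "isomorphic QB (FO i_lst (FO i_ust X)) X"
proof -
  interpret jl: induced \<C> \<T>\<^sub>C \<B> \<T> j_lst by (rule induced(6))
  interpret js: induced \<C> \<T>\<^sub>C \<B> \<T> j_lsh by (rule induced(4))
  interpret Jl: additive_functor_between QC QB Ij_lst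
    using induced_additive(6) by (simp add: additive_functor_between_def additive_functor_between_axioms_def
        QuC.additive_category_Q B.additive_category_Q)
  interpret Js: additive_functor_between QC QB Ij_lsh
    using induced_additive(4) by (simp add: additive_functor_between_def additive_functor_between_axioms_def
        QuC.additive_category_Q B.additive_category_Q)
  interpret ad1: adjoint_pair QB QA Ii_ust Ii_lst "\<lambda>X. arr_class \<B> \<T> (\<eta>1 X)" "\<lambda>Y. arr_class \<A> \<T>\<^sub>A (\<epsilon>1 Y)"
    by (rule induced_adjoint_pairs(1))
  interpret ad2: adjoint_pair QA QB Ii_lst Ii_ush "\<lambda>X. arr_class \<A> \<T>\<^sub>A (\<eta>2 X)" "\<lambda>Y. arr_class \<B> \<T> (\<epsilon>2 Y)"
    by (rule induced_adjoint_pairs(2))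
  interpret QB: abelian_category QB
    by (rule B.abelian_category_Q)
  note FO = induced[THEN induced.IF_FO]
  \<comment> \<open>Vanishing in the quotient of \<C> is carried by the induced functors to the
    quotient of \<B>, where it means membership in \<T>.\<close>
  have jj: "FO j_lst (FO j_ust X) \<in> \<T>" "FO j_lsh (FO j_ust X) \<in> \<T>"
    using Jl.F_zero_object[OF Z] Js.F_zero_object[OF Z] B.Q_zero_iff by simp_all
  let ?e = "arr_class \<B> \<T> (\<epsilon>2 X)" and ?u = "\<lambda>X. arr_class \<B> \<T> (\<eta>1 X)"
  note e = adj2.counit_Hom[OF X] and u = adj1.unit_Hom[OF X]
  have epi: "is_epi QB ?e"
  proof -
    obtain Q \<delta> g1 g2 where tri: "etriangle \<B> (FO i_lst (FO i_ush X)) Q \<delta> (\<epsilon>2 X) g1"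
      and g2: "g2 \<in> Hom \<B> Q (FO j_lst (FO j_ust X))" "is_isomorphism \<B> g2"
      using half_recollement.counit_triangle[OF half_recollement X] by metis
    have "Q \<in> \<T>"
      using B.isomorphic_in_T[OF jj(1) B.isomorphic_sym[OF B.isomorphicI[OF g2]] B.Hom_Obj_Dom[OF g2(1)]] .
    then show ?thesis
      using B.Q_epi_inflation[OF tri e] by blast
  qed
  have mono: "is_mono QB (?u X)"
  proof -
    note o = opposite_opp[of \<B>]
    \<comment> \<open>Read in \<B>, \<open>Q\<close> is the first term of a triangle whose deflation
      is the unit; it is isomorphic to \<open>j_lsh (j_ust X)\<close>, hence in \<T>, and this makes
      the unit mono.\<close>
    obtain Q \<delta> g1 g2 where tri: "etriangle (opp \<B>) (FO i_lst (FO i_ust X)) Q \<delta> (\<eta>1 X) g1"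
      and g2: "g2 \<in> Hom (opp \<B>) Q (FO j_lsh (FO j_ust X))" "is_isomorphism (opp \<B>) g2"
      using half_recollement.counit_triangle[OF half_recollement_opp] X opposite_simps(1)[OF o] by metis
    have "g2 \<in> Hom \<B> (FO j_lsh (FO j_ust X)) Q" "is_isomorphism \<B> g2"
      using g2 by (simp_all add: opposite_simps[OF o] isomorphism_opposite[OF o])
    then have "Q \<in> \<T>"
      using B.isomorphic_in_T[OF jj(2)] B.isomorphicI B.Hom_Obj_Cod by blast
    then show ?thesis
      using B.Q_mono_deflation tri u by simp
  qed
  note eQ = B.Q_Hom[OF e] and uQ = B.Q_Hom[OF u]
  let ?Y = "FO i_ush X"
  have Y: "?Y \<in> Obj \<A>" using adj2.G_Obj[OF X] .
  note iY = adj2.F_Obj[OF Y]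
  note c = adj1.counit_Hom[OF Y]
  obtain g where g: "g \<in> Hom \<A> ?Y (FO i_ust (FO i_lst ?Y))" "g \<cdot>\<^bsub>\<A>\<^esub> \<epsilon>1 ?Y = Ident \<A> (FO i_ust (FO i_lst ?Y))"
    "is_isomorphism \<A> g"
    using A.isomorphismE[OF adj1.counit_isomorphism[OF fully_faithful(1) Y] c] by metis
  \<comment> \<open>With \<open>g\<close> inverse to the counit, a triangle identity identifies
    \<open>i_lst g\<close> with the unit at \<open>i_lst ?Y\<close>, which is therefore
    invertible.\<close>
  have "FM i_lst g = FM i_lst g \<cdot>\<^bsub>\<B>\<^esub> (FM i_lst (\<epsilon>1 ?Y) \<cdot>\<^bsub>\<B>\<^esub> \<eta>1 (FO i_lst ?Y))"
    using adj1.G_counit_unit[OF Y] B.Comp_Ident_right[OF adj2.F_Hom[OF g(1)]] by simp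
  also have "\<dots> = \<eta>1 (FO i_lst ?Y)"
    using B.Comp_assoc[OF adj1.unit_Hom[OF iY] adj2.F_Hom[OF c] adj2.F_Hom[OF g(1)]] adj2.F_Comp[OF c g(1)] g(2)
      adj2.F_Ident[OF adj1.F_Obj[OF iY]] B.Comp_Ident_left[OF adj1.unit_Hom[OF iY]] by simp
  finally have "is_isomorphism \<B> (\<eta>1 (FO i_lst ?Y))"
    using functor_isomorphism[OF adj2.F_functor A.category_axioms B.category_axioms g(1,3)] by simp
  then have "is_isomorphism QB (?u (FO i_lst ?Y))"
    using B.Q_isomorphism[OF adj1.unit_Hom[OF iY]] by blast
  note u_epi = B.Q.isomorphism_epi[OF B.Q_Hom[OF adj1.unit_Hom[OF iY]] this]
  note e2 = ad2.F_Hom[OF ad1.F_Hom[OF eQ], unfolded FO]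
  have e2_epi: "is_epi QB (FM Ii_lst (FM Ii_ust ?e))"
    using ad2.F_epi[OF ad1.F_Hom[OF eQ] ad1.F_epi[OF eQ epi]] .
  \<comment> \<open>By naturality this is the invertible unit at \<open>i_lst ?Y\<close> followed by
    the image of \<open>?e\<close> under the induced \<open>i_ust\<close> and \<open>i_lst\<close>.
    Both functors are left adjoints and so preserve epis.\<close>
  have "is_epi QB (?u X \<cdot>\<^bsub>QB\<^esub> ?e)"
    unfolding ad1.unit_natural[OF eQ]
    using B.Q.epi_Comp[OF B.Q_Hom[OF adj1.unit_Hom[OF iY]] u_epi e2 e2_epi] .
  then have "is_epi QB (?u X)"
    using B.Q.epi_if_Comp_epi[OF eQ uQ] by blast
  then have "is_isomorphism QB (?u X)"
    using QB.mono_epi_isomorphism[OF uQ mono] by blast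
  then show ?thesis
    using B.Q.isomorphic_sym[OF B.Q.isomorphicI[OF uQ]] by blast
qed

text \<open>Objects of the image die because \<open>j_ust\<close> after \<open>i_lst\<close> is
  already zero before passing to quotients; the other inclusion is
  \<open>kernel_Ij_ust\<close>.\<close>

lemma image_Ii_lst: "image_subcat QB (FO Ii_lst) (Obj QA) = kernel_subcat QB QC Ij_ust"
proof -
  note FO = induced[THEN induced.IF_FO]
  have "is_zero_object QC (FO j_ust X)" if Y: "Y \<in> Obj \<A>" and iso: "isomorphic QB (FO i_lst Y) X" for X Y
  proof -
    have "isomorphic QC (FO j_ust (FO i_lst Y)) (FO j_ust X)"
      using functor_isomorphic[OF adjoint_pair.F_functor[OF induced_adjoint_pairs(4)] B.category_Q QuC.category_Q iso]
      unfolding FO .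
    then show ?thesis
      using QuC.Q.zero_object_isomorphic[OF QuC.Q_zero_object[OF i_lst_kernel[OF Y]]] QuC.Q.isomorphic_sym by blast
  qed
  moreover have "\<exists>Y \<in> Obj \<A>. isomorphic QB (FO i_lst Y) X" if "X \<in> Obj \<B>" "is_zero_object QC (FO j_ust X)" for X
    using kernel_Ij_ust[OF that] adj1.F_Obj[OF that(1)] by blast
  ultimately show ?thesis
    unfolding FO kernel_subcat_def QuA.Q_Obj image_subcat_def[of QB "FO i_lst" "Obj \<A>"] B.Q_Obj by blast
qed

lemma abelian_recollement_quotients:
  "abelian_recollement QA QB QC Ii_ust Ii_lst Ii_ush Ij_lsh Ij_ust Ij_lst"
  unfolding abelian_recollement_def
  using abelian_QA B.abelian_category_Q abelian_QC induced_additive induced_adjunctions image_Ii_lst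
    induced_fully_faithful by blast

end

theorem theorem4p5:
  fixes \<A> :: "('oa, 'ma, 'ea) extcat"
    and \<B> :: "('ob, 'mb, 'eb) extcat"
    and \<C> :: "('oc, 'mc, 'ec) extcat"
    and i_ust i_ush :: "('ob, 'mb, 'oa, 'ma) fct"
    and i_lst :: "('oa, 'ma, 'ob, 'mb) fct"
    and j_ust :: "('ob, 'mb, 'oc, 'mc) fct"
    and j_lsh j_lst :: "('oc, 'mc, 'ob, 'mb) fct"
    and \<T> :: "'ob set"
  defines "\<T>\<^sub>A \<equiv> image_subcat \<A> (FO i_ust) \<T>"
    and "\<T>\<^sub>C \<equiv> image_subcat \<C> (FO j_ust) \<T>"
  assumes "extriangulated_category \<A>"
    and "extriangulated_category \<B>"
    and "extriangulated_category \<C>"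
    and "enough_projectives \<B>"
    and "recollement \<A> \<B> \<C> i_ust i_lst i_ush j_lsh j_ust j_lst"
    and "exact_functor \<B> \<A> i_ust"
    and "exact_functor \<B> \<A> i_ush"
    and "cluster_tilting \<B> \<T>"
    and "image_subcat \<B> (FO j_lst \<circ> FO j_ust) \<T> \<subseteq> \<T>"
    and "image_subcat \<B> (FO i_lst \<circ> FO i_ust) \<T> \<subseteq> \<T>"
  shows "abelian_category (quot_cat \<A> \<T>\<^sub>A) \<and>
    abelian_category (quot_cat \<B> \<T>) \<and>
    abelian_category (quot_cat \<C> \<T>\<^sub>C) \<and>
    FO i_ust ` \<T> \<subseteq> \<T>\<^sub>A \<and> FO i_ush ` \<T> \<subseteq> \<T>\<^sub>A \<and> FO i_lst ` \<T>\<^sub>A \<subseteq> \<T> \<and>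
    FO j_ust ` \<T> \<subseteq> \<T>\<^sub>C \<and> FO j_lsh ` \<T>\<^sub>C \<subseteq> \<T> \<and> FO j_lst ` \<T>\<^sub>C \<subseteq> \<T> \<and>
    abelian_recollement (quot_cat \<A> \<T>\<^sub>A) (quot_cat \<B> \<T>) (quot_cat \<C> \<T>\<^sub>C)
      (induced_functor \<A> \<T>\<^sub>A i_ust) (induced_functor \<B> \<T> i_lst) (induced_functor \<A> \<T>\<^sub>A i_ush)
      (induced_functor \<B> \<T> j_lsh) (induced_functor \<C> \<T>\<^sub>C j_ust) (induced_functor \<B> \<T> j_lst)"
proof -
  note recollement = assms(7)[unfolded recollement_def]
  interpret B: extriangulated_category \<B> by fact
  interpret T: cluster_tilting_subcategory \<B> \<T>
    by unfold_locales fact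
  obtain \<eta>1 \<epsilon>1 \<eta>2 \<epsilon>2 \<eta>3 \<epsilon>3 \<eta>4 \<epsilon>4 where
    adj: "adjunction \<B> \<A> i_ust i_lst \<eta>1 \<epsilon>1" "adjunction \<A> \<B> i_lst i_ush \<eta>2 \<epsilon>2"
      "adjunction \<C> \<B> j_lsh j_ust \<eta>3 \<epsilon>3" "adjunction \<B> \<C> j_ust j_lst \<eta>4 \<epsilon>4"
    and seq: "\<forall>X \<in> Obj \<B>. \<exists>A \<in> Obj \<A>. \<exists>h. Cod \<B> h = FO i_lst A \<and> left_exact_seq4 \<B> (\<epsilon>2 X) (\<eta>4 X) h"
      "\<forall>X \<in> Obj \<B>. \<exists>A \<in> Obj \<A>. \<exists>h. Dom \<B> h = FO i_lst A \<and> right_exact_seq4 \<B> h (\<epsilon>3 X) (\<eta>1 X)"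
    using recollement[THEN conjunct2, THEN conjunct2, THEN conjunct2, THEN conjunct2, THEN conjunct2,
        THEN conjunct2, THEN conjunct2, THEN conjunct2, THEN conjunct2, THEN conjunct2] by blast
  have functors: "is_functor \<A> \<B> i_lst" "is_functor \<B> \<A> i_ust" "is_functor \<B> \<C> j_ust" "is_functor \<C> \<B> j_lst"
    using adj unfolding adjunction_def by blast+
  have left_additive: "additive_functor K L F" if "left_exact_functor K L F"
    for F :: "('p, 'n, 'q, 'k) fct" and K :: "('p, 'n, 'e) extcat" and L :: "('q, 'k, 'f) extcat"
    using that additive_functor_opposite[OF opposite_opp opposite_opp]
    unfolding left_exact_functor_def right_exact_functor_def by blast
  have kernel: "is_zero_object \<C> (FO j_ust (FO i_lst Y))" if "Y \<in> Obj \<A>" for Y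
  proof -
    have "FO i_lst Y \<in> image_subcat \<B> (FO i_lst) (Obj \<A>)"
      using B.image_subcatI[of _ _ "FO i_lst", OF that] functor_Obj[OF functors(1) that] by blast
    then show ?thesis
      using recollement unfolding kernel_subcat_def by blast
  qed
  have jj: "FO j_lst (FO j_ust S) \<in> \<T>" if S: "S \<in> \<T>" for S
    using subsetD[OF assms(11) B.image_subcatI[OF S, of "FO j_lst \<circ> FO j_ust"]]
      functor_Obj[OF functors(4) functor_Obj[OF functors(3) T.T_Obj[OF S]]] by simp
  have ii: "FO i_lst (FO i_ust S) \<in> \<T>" if S: "S \<in> \<T>" for S
    using subsetD[OF assms(12) B.image_subcatI[OF S, of "FO i_lst \<circ> FO i_ust"]]
      functor_Obj[OF functors(1) functor_Obj[OF functors(2) T.T_Obj[OF S]]] by simp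
  interpret R: cluster_tilting_recollement \<A> \<B> \<C> i_ust i_ush i_lst j_ust j_lsh j_lst
    \<eta>1 \<epsilon>1 \<eta>2 \<epsilon>2 \<eta>3 \<epsilon>3 \<eta>4 \<epsilon>4 \<T>
  proof (rule cluster_tilting_recollement.intro)
    show "additive_functor \<B> \<A> i_ust" "additive_functor \<A> \<B> i_lst" "additive_functor \<B> \<A> i_ush"
      "additive_functor \<C> \<B> j_lsh" "additive_functor \<B> \<C> j_ust"
      using recollement assms(8,9) unfolding exact_functor_def right_exact_functor_def by blast+
    show "additive_functor \<C> \<B> j_lst"
      using recollement left_additive by blast
    show "preserves_triangles \<B> \<A> i_ust" "preserves_triangles \<A> \<B> i_lst" "preserves_triangles \<B> \<A> i_ush"
      "preserves_triangles \<B> \<C> j_ust"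
      using recollement assms(8,9) exact_functor_preserves_triangles by blast+
    show "\<exists>Q e r. etriangle \<B> (FO j_lst A) Q e (FM j_lst x) r" if "etriangle \<C> A C \<delta> x y" for A C \<delta> x y
      using left_exact_functor_inflation[OF _ that] recollement by blast
    show "fully_faithful \<A> \<B> i_lst" "fully_faithful \<C> \<B> j_lsh" "fully_faithful \<C> \<B> j_lst"
      using recollement by blast+
    show "\<exists>Y \<in> Obj \<A>. \<exists>h. Cod \<B> h = FO i_lst Y \<and> left_exact_seq4 \<B> (\<epsilon>2 X) (\<eta>4 X) h" if "X \<in> Obj \<B>" for X
      using seq(1) that by blast
    show "\<exists>Y \<in> Obj \<A>. \<exists>h. Dom \<B> h = FO i_lst Y \<and> right_exact_seq4 \<B> h (\<epsilon>3 X) (\<eta>1 X)" if "X \<in> Obj \<B>" for X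
      using seq(2) that by blast
  qed (fact assms(3) assms(5) T.cluster_tilting_subcategory_axioms adj kernel jj ii)+
  show ?thesis
    unfolding \<T>\<^sub>A_def \<T>\<^sub>C_def
    using R.abelian_QA T.abelian_category_Q R.abelian_QC R.i_ust_\<T> R.i_ush_\<T> R.i_lst_\<T> R.j_ust_\<T> R.j_lsh_\<T>
      R.j_lst_\<T> R.abelian_recollement_quotients by blast
qed

end
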